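(* (a) If $(w_1,\dots,w_n)$ is a KMS-factorization for $r$, then each permutation $w_i$ has a reduced factorization $w_i = v_{i-1} \cdot W_{i-1,i} \cdot u_i$ with $v_{i-1} \in S_{e_{i-1}}$ and $u_i \in S_{e_i}$, such that $v_0 = u_n = 1$. (b) Let $u_1,v_1,\dots,u_{n-1},v_{n-1}$ be permutations with $u_i,v_i \in S_{e_i}$. Then the sequence $(W_{01}\cdot u_1,\ v_1 \cdot W_{12} \cdot u_2,\ \dots,\ v_{n-1} \cdot W_{n-1,n})$ is a KMS-factorization for $r$ if and only if $(u_1 \cdot v_1, u_2 \cdot v_2, \dots, u_{n-1} \cdot v_{n-1})$ is a KMS-factorization for $r^{(1)}$.
   Context: Let $r=\{r_{ij}\}_{0\le i\le j\le n}$ be a set of rank conditions (non-negative integers that occur as the ranks of the composed maps $E_i\to E_j$ of a sequence of vector bundles $E_0\to\cdots\to E_n$ at a point), with dimension vector $e_i=r_{ii}$. Extend $r$ by $r_{ij}=e_j+e_{j+1}+\dots+e_i$ for $j\le i$, and $r_{ij}=0$ for $i<0$ or $j>n$; set $N=r_{n0}$. For $0\le i<n$, $0<j\le n$, define $W_{ij}\in S_{r_{i+1,j-1}}$ by $W_{ij}(p)=p+r_{i,j-1}-r_{ij}$ if $r_{ij}<p\le r_{i+1,j}$; $W_{ij}(p)=p-r_{i+1,j}+r_{ij}$ if $r_{i+1,j}<p\le r_{i+1,j}+r_{i,j-1}-r_{ij}$; $W_{ij}(p)=p$ otherwise. Symmetric groups $S_m\subset S_{m'}$ ($m\le m'$)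 are embedded naturally. The degenerate Hecke algebra is generated by $s_1,s_2,\dots$ with $s_is_j=s_js_i$ for $|i-j|\ge2$, $s_is_{i+1}s_i=s_{i+1}s_is_{i+1}$, $s_i^2=-s_i$; for permutations $u_1,\dots,u_k$ the product $u_1\cdots u_k$ in this algebra is $\pm$ a single permutation $w$, called the absolute Hecke product and written $u_1\cdot u_2\cdots u_k$. A factorization $w=u_1\cdot u_2\cdot u_3$ is reduced if $\ell(w)=\sum\ell(u_i)$ (then it agrees with the ordinary product). The conjugate Zelevinsky permutation is $z(r)=\prod_{j=1}^n\prod_{i=0}^{n-1}W_{ij}\in S_N$ (south-west to north-east product of the matrix with rows $W_{n-1,\cdot},\dots,W_{0,\cdot}$ from top to bottom). For $1\le j\le n-1$ let $\delta_j=W_{jj}W_{j+1,j}\cdots W_{n-1,j}$. A KMS-factorization for $r$ is a sequence $(w_1,\dots,w_n)$ with $w_i\in S_{e_{i-1}+e_i}$ such that $z(r)$ equals the absolute Hecke product $w_1\cdot\delta_1\cdot w_2\cdot\delta_2\cdots\delta_{n-1}\cdot w_n$. Finally $r^{(1)}$ denotes the rank conditions $\{r^{(1)}_{ij}=r_{i,j+1}\mid 0\le i\le j\le n-1\}$ obtained by dropping all $r_{ii}$. In the statement, $\cdot$ denotes the absolute Hecke product. *)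

theory Defs
  imports
    "HOL-Combinatorics.Permutations"
    "HOL-Library.Poly_Mapping"
    "Jordan_Normal_Form.DL_Rank"
begin

section \<open>Rank conditions\<close>

text \<open>
  The composition of \<open>k\<close> consecutive maps starting at \<open>E\<^sub>i\<close>, where
  \<open>\<phi> i\<close> is the matrix of \<open>E\<^sub>i \<rightarrow> E\<^sub>i\<^sub>+\<^sub>1\<close>.
\<close>

primrec composite :: "(nat \<Rightarrow> nat) \<Rightarrow> (nat \<Rightarrow> 'k::field mat) \<Rightarrow> nat \<Rightarrow> nat \<Rightarrow> 'k mat" where
  "composite e \<phi> i 0 = 1\<^sub>m (e i)"
| "composite e \<phi> i (Suc k) = \<phi> (i + k) * composite e \<phi> i k"

text \<open>
  \<open>r\<close> occurs as the ranks of the maps between the fibres, over the field \<open>'k\<close>, of a sequence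
  of vector bundles at a point. Only the entries \<open>r i j\<close> with \<open>i \<le> j \<le> n\<close> carry meaning.
\<close>

definition rank_conditions :: "'k::field itself \<Rightarrow> nat \<Rightarrow> (nat \<Rightarrow> nat \<Rightarrow> nat) \<Rightarrow> bool" where
  "rank_conditions K n r \<longleftrightarrow>
     (\<exists>\<phi> :: nat \<Rightarrow> 'k mat.
        (\<forall>i<n. \<phi> i \<in> carrier_mat (r (Suc i) (Suc i)) (r i i)) \<and>
        (\<forall>i j. i \<le> j \<and> j \<le> n \<longrightarrow>
           r i j = vec_space.rank (r j j) (composite (\<lambda>l. r l l) \<phi> i (j - i))))"

text \<open>
  The extension of \<open>r\<close> below the diagonal. The further convention \<open>r\<^sub>i\<^sub>j = 0\<close> for
  \<open>i < 0\<close> or \<open>j > n\<close> is not needed: the permutations \<open>W\<^sub>i\<^sub>j\<close> with \<open>0 \<le> i < n\<close>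
  and \<open>0 < j \<le> n\<close> only involve indices between \<open>0\<close> and \<open>n\<close>.
\<close>

definition ext_rank :: "(nat \<Rightarrow> nat \<Rightarrow> nat) \<Rightarrow> nat \<Rightarrow> nat \<Rightarrow> nat" where
  "ext_rank r i j = (if j \<le> i then (\<Sum>k=j..i. r k k) else r i j)"

definition drop_diag :: "(nat \<Rightarrow> nat \<Rightarrow> nat) \<Rightarrow> nat \<Rightarrow> nat \<Rightarrow> nat" where
  "drop_diag r i j = r i (Suc j)"


section \<open>Permutations\<close>

text \<open>
  \<open>S\<^sub>m\<close> is the set of \<open>w :: nat \<Rightarrow> nat\<close> with \<open>w permutes {1..m}\<close>, so that
  the embeddings \<open>S\<^sub>m \<subseteq> S\<^sub>m\<^sub>'\<close> are inclusions. The product is \<open>(u v)(p) = u (v p)\<close>.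
\<close>

definition perm_prod :: "(nat \<Rightarrow> nat) list \<Rightarrow> nat \<Rightarrow> nat" where
  "perm_prod us = foldr (\<circ>) us id"

definition perm_length :: "(nat \<Rightarrow> nat) \<Rightarrow> nat" where
  "perm_length w = card {(p, q). p < q \<and> w q < w p}"

definition W_perm :: "(nat \<Rightarrow> nat \<Rightarrow> nat) \<Rightarrow> nat \<Rightarrow> nat \<Rightarrow> nat \<Rightarrow> nat" where
  "W_perm r i j p =
     (let a = ext_rank r i j; b = ext_rank r (i + 1) j; c = ext_rank r i (j - 1)
      in if a < p \<and> p \<le> b then p + (c - a)
         else if b < p \<and> p \<le> b + (c - a) then p - (b - a)
         else p)"

text \<open>Column by column from left to right, each column from bottom (\<open>i = 0\<close>) to top.\<close>

definition zelevinsky :: "nat \<Rightarrow> (nat \<Rightarrow> nat \<Rightarrow> nat) \<Rightarrow> nat \<Rightarrow> nat" where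
  "zelevinsky n r =
     perm_prod (concat (map (\<lambda>j. map (\<lambda>i. W_perm r i j) [0..<n]) [1..<n + 1]))"

definition delta_perm :: "nat \<Rightarrow> (nat \<Rightarrow> nat \<Rightarrow> nat) \<Rightarrow> nat \<Rightarrow> nat \<Rightarrow> nat" where
  "delta_perm n r j = perm_prod (map (\<lambda>i. W_perm r i j) [j..<n])"


section \<open>The degenerate Hecke algebra\<close>

text \<open>
  Words in the generators; the letter \<open>k\<close> stands for \<open>s\<^sub>k\<^sub>+\<^sub>1\<close>. With
  concatenation as addition, \<open>gen_word \<Rightarrow>\<^sub>0 int\<close> is the free associative algebra
  over the integers.
\<close>

datatype gen_word = Word (letters: "nat list")

instantiation gen_word :: monoid_add
begin

definition "0 = Word []"
definition "v + w = Word (letters v @ letters w)"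

instance
  by standard (simp_all add: zero_gen_word_def plus_gen_word_def)

end

type_synonym free_algebra = "gen_word \<Rightarrow>\<^sub>0 int"

definition free_gen :: "nat \<Rightarrow> free_algebra" where
  "free_gen k = Poly_Mapping.single (Word [k]) 1"

inductive_set hecke_ideal :: "free_algebra set" where
  commute: "i + 2 \<le> j \<Longrightarrow>
    free_gen i * free_gen j - free_gen j * free_gen i \<in> hecke_ideal"
| braid: "free_gen i * free_gen (i + 1) * free_gen i
    - free_gen (i + 1) * free_gen i * free_gen (i + 1) \<in> hecke_ideal"
| quadratic: "free_gen i * free_gen i + free_gen i \<in> hecke_ideal"
| add: "a \<in> hecke_ideal \<Longrightarrow> b \<in> hecke_ideal \<Longrightarrow> a + b \<in> hecke_ideal"
| mult: "a \<in> hecke_ideal \<Longrightarrow> x * a * y \<in> hecke_ideal"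

lemma hecke_ideal_zero: "0 \<in> hecke_ideal"
  using hecke_ideal.mult[OF hecke_ideal.quadratic, of 0] by simp

lemma hecke_ideal_left: "a \<in> hecke_ideal \<Longrightarrow> x * a \<in> hecke_ideal"
  using hecke_ideal.mult[of a x 1] by simp

lemma hecke_ideal_right: "a \<in> hecke_ideal \<Longrightarrow> a * y \<in> hecke_ideal"
  using hecke_ideal.mult[of a 1 y] by simp

lemma hecke_ideal_uminus: "a \<in> hecke_ideal \<Longrightarrow> - a \<in> hecke_ideal"
  using hecke_ideal_left[of a "-1"] by simp

lemma add_eq_0_gen_word_iff: "v + w = 0 \<longleftrightarrow> v = 0 \<and> w = (0 :: gen_word)"
  by (cases v; cases w) (simp add: zero_gen_word_def plus_gen_word_def)

lemma lookup_mult_0_free_algebra: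
  fixes a b :: free_algebra
  shows "Poly_Mapping.lookup (a * b) 0 = Poly_Mapping.lookup a 0 * Poly_Mapping.lookup b 0"
proof -
  have "(\<Sum>r. Poly_Mapping.lookup b r when 0 = q + r) = (Poly_Mapping.lookup b 0 when q = 0)"
    for q
  proof -
    have "(Poly_Mapping.lookup b r when 0 = q + r) =
      ((Poly_Mapping.lookup b 0 when q = 0) when r = 0)" for r
      using add_eq_0_gen_word_iff[of q r] by (auto simp: when_def)
    then show ?thesis
      by simp
  qed
  then show ?thesis
    by (simp add: lookup_mult mult_when)
qed

lemma one_notin_hecke_ideal: "1 \<notin> hecke_ideal"
proof -
  have gen: "Poly_Mapping.lookup (free_gen i) 0 = 0" for i
    by (simp add: free_gen_def lookup_single zero_gen_word_def)
  have "a \<in> hecke_ideal \<Longrightarrow> Poly_Mapping.lookup a 0 = 0" for a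
    by (induction rule: hecke_ideal.induct)
      (simp_all add: lookup_mult_0_free_algebra lookup_add lookup_minus gen)
  then show ?thesis
    by (metis lookup_one_zero zero_neq_one)
qed

definition hecke_rel :: "free_algebra \<Rightarrow> free_algebra \<Rightarrow> bool" where
  "hecke_rel a b \<longleftrightarrow> a - b \<in> hecke_ideal"

quotient_type hecke = free_algebra / hecke_rel
proof (rule equivpI)
  show "reflp hecke_rel"
    by (simp add: reflp_def hecke_rel_def hecke_ideal_zero)
  show "symp hecke_rel"
    unfolding symp_def hecke_rel_def by (metis hecke_ideal_uminus minus_diff_eq)
  show "transp hecke_rel"
    unfolding transp_def hecke_rel_def by (metis diff_add_cancel add_diff_eq hecke_ideal.add)
qed

instantiation hecke :: ring_1
begin

lift_definition zero_hecke :: hecke is 0 .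

lift_definition one_hecke :: hecke is 1 .

lift_definition plus_hecke :: "hecke \<Rightarrow> hecke \<Rightarrow> hecke" is "(+)"
  unfolding hecke_rel_def by (metis add_diff_add hecke_ideal.add)

lift_definition uminus_hecke :: "hecke \<Rightarrow> hecke" is uminus
  unfolding hecke_rel_def by (metis hecke_ideal_uminus minus_diff_minus)

lift_definition minus_hecke :: "hecke \<Rightarrow> hecke \<Rightarrow> hecke" is "(-)"
proof -
  fix a b c d assume "hecke_rel a b" "hecke_rel c d"
  then have "(a - b) + - (c - d) \<in> hecke_ideal"
    unfolding hecke_rel_def by (intro hecke_ideal.add hecke_ideal_uminus)
  then show "hecke_rel (a - c) (b - d)"
    by (simp add: hecke_rel_def algebra_simps)
qed

lift_definition times_hecke :: "hecke \<Rightarrow> hecke \<Rightarrow> hecke" is "(*)"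
proof -
  fix a b c d assume "hecke_rel a b" "hecke_rel c d"
  then have "(a - b) * c + b * (c - d) \<in> hecke_ideal"
    unfolding hecke_rel_def
    by (intro hecke_ideal.add hecke_ideal_left hecke_ideal_right)
  then show "hecke_rel (a * c) (b * d)"
    by (simp add: hecke_rel_def algebra_simps)
qed

instance
proof
  show "(0 :: hecke) \<noteq> 1"
  proof (transfer, unfold hecke_rel_def, rule notI)
    assume "(0 :: free_algebra) - 1 \<in> hecke_ideal"
    then show False
      using hecke_ideal_uminus[of "0 - 1"] one_notin_hecke_ideal by simp
  qed
qed (transfer, simp add: hecke_rel_def hecke_ideal_zero algebra_simps)+

end

lift_definition hecke_gen :: "nat \<Rightarrow> hecke" is free_gen .

definition reduced_word :: "(nat \<Rightarrow> nat) \<Rightarrow> nat list \<Rightarrow> bool" where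
  "reduced_word w ks \<longleftrightarrow>
     perm_prod (map (\<lambda>k. Transposition.transpose (k + 1) (k + 2)) ks) = w \<and>
     length ks = perm_length w"

text \<open>
  The basis element of a permutation; by Matsumoto's theorem it does not depend on the
  choice of the reduced word.
\<close>

definition hecke_of_perm :: "(nat \<Rightarrow> nat) \<Rightarrow> hecke" where
  "hecke_of_perm w = prod_list (map hecke_gen (SOME ks. reduced_word w ks))"

definition hecke_prod :: "(nat \<Rightarrow> nat) list \<Rightarrow> nat \<Rightarrow> nat" where
  "hecke_prod us =
     (THE w. (\<exists>m. w permutes {1..m}) \<and>
        (prod_list (map hecke_of_perm us) = hecke_of_perm w \<or>
         prod_list (map hecke_of_perm us) = - hecke_of_perm w))"

definition reduced_factorization :: "(nat \<Rightarrow> nat) \<Rightarrow> (nat \<Rightarrow> nat) list \<Rightarrow> bool" where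
  "reduced_factorization w us \<longleftrightarrow>
     w = hecke_prod us \<and> perm_length w = sum_list (map perm_length us)"


section \<open>KMS-factorizations\<close>

text \<open>
  A sequence \<open>(w\<^sub>1, \<dots>, w\<^sub>n)\<close> is given by a function of which only the values at
  \<open>1, \<dots>, n\<close> matter. The list below is \<open>w\<^sub>1, \<delta>\<^sub>1, w\<^sub>2, \<delta>\<^sub>2, \<dots>, \<delta>\<^sub>n\<^sub>-\<^sub>1, w\<^sub>n\<close>;
  for \<open>n = 0\<close> it is empty, and the empty sequence is the only KMS-factorization.
\<close>

definition KMS_factorization ::
  "nat \<Rightarrow> (nat \<Rightarrow> nat \<Rightarrow> nat) \<Rightarrow> (nat \<Rightarrow> nat \<Rightarrow> nat) \<Rightarrow> bool" where
  "KMS_factorization n r w \<longleftrightarrow>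
     (\<forall>i\<in>{1..n}. w i permutes {1..r (i - 1) (i - 1) + r i i}) \<and>
     zelevinsky n r =
       hecke_prod (concat (map (\<lambda>i. if i = 1 then [w 1] else [delta_perm n r (i - 1), w i])
         [1..<n + 1]))"

end

theory Submission
  imports Defs
begin

text \<open>
  In the degenerate Hecke algebra, multiplying a permutation \<open>w\<close> on the right by \<open>s\<^sub>k\<close> acts, up to
  sign, on the sequence of values of \<open>w\<close> by a comparator that puts the entries at \<open>k\<close>
  and \<open>k + 1\<close> in decreasing order. Hence an inversion, once created, persists.

  The permutation \<open>z(r)\<close> is increasing on certain intervals of positions and so is its inverse on
  intervals of values, and the ranks prescribe how many values from the first blocks occur in its first
  positions. As inversions persist, each factor \<open>w\<^sub>i\<close> inherits such monotonicity and moves a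
  prescribed number of entries across. This forces it to be a block swap up to a left and a right
  factor, which is (a).

  For (b), both products describe the same queue process: in every round the new labels enter behind
  those that are kept, the factor \<open>u\<^sub>i \<cdot> v\<^sub>i\<close> permutes them, and the labels that are
  not kept leave. The queues for \<open>r\<close> and for \<open>r\<^sup>(\<^sup>1\<^sup>)\<close> differ only in the number of
  labels that the factors do not move, so one product has the required value if and only if the other does.
\<close>

section \<open>Finitary permutations and their words\<close>

text \<open>\<open>hecke_of_perm\<close> picks a reduced word and \<open>hecke_prod\<close> is a
  description by \<open>THE\<close>, so the product first has to be shown to exist: Matsumoto's
  theorem makes the choice of word harmless, and a coordinate functional on the free algebra that
  kills the ideal keeps permutations distinct in the quotient, even up to sign. Afterwards only
  \<open>\<star>\<close> is used, whose left argument may be any sequence over a linear order.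
  Comparators commute with monotone maps, so values can be replaced by truth values (to count) or by
  labels (to compare two queues). Of the linear maps there remain three families of inequalities:
  monotonicity of the ranks in both indices and Frobenius' inequality. No closed formula for z(r) is
  used. As a product of columns it is itself of KMS shape, so in (a) the ranks are read off from
  this instance, and (b) compares products of the same shape. The obstacle in (b) is the group: the
  product of u_i and v_i is given in S_m with m = e_i, whereas r^(1) asks for m = r_{i-1,i} +
  r_{i,i+1}, which may be smaller and has to be derived from the value of the product.\<close>

definition fin_perm :: "(nat \<Rightarrow> nat) \<Rightarrow> bool" where
  "fin_perm w \<longleftrightarrow> (\<exists>m. w permutes {1..m})"

abbreviation adj :: "nat \<Rightarrow> nat \<Rightarrow> nat" where
  "adj k \<equiv> Transposition.transpose (Suc k) (Suc (Suc k))"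

lemma adj_adj [simp]: "adj k \<circ> adj k = id" "adj k (adj k p) = p"
  by (auto simp: fun_eq_iff)

lemma comp_adj_adj [simp]: "w \<circ> adj k \<circ> adj k = w"
  by (auto simp: fun_eq_iff)

lemma adj_permutes: "k + 2 \<le> m \<Longrightarrow> adj k permutes {1..m}"
  by (rule permutes_swap_id) auto

lemma permutes_mono: "w permutes {1..m} \<Longrightarrow> m \<le> m' \<Longrightarrow> w permutes {1..m'::nat}"
  by (erule permutes_subset) auto

lemma fin_perm_comp: "fin_perm u \<Longrightarrow> fin_perm v \<Longrightarrow> fin_perm (u \<circ> v)"
  unfolding fin_perm_def by (meson max.cobounded1 max.cobounded2 permutes_compose permutes_mono)

lemma fin_perm_id [simp]: "fin_perm id"
  unfolding fin_perm_def using permutes_id by blast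

lemma fin_perm_adj [simp]: "fin_perm (adj k)"
  unfolding fin_perm_def using adj_permutes by blast

lemma fin_perm_comp_adj: "fin_perm w \<Longrightarrow> fin_perm (w \<circ> adj k)"
  by (rule fin_perm_comp) auto

lemma fin_perm_bij: "fin_perm w \<Longrightarrow> bij w"
  unfolding fin_perm_def using permutes_bij by blast

lemma fin_perm_inj: "fin_perm w \<Longrightarrow> inj w"
  using fin_perm_bij bij_def by blast

lemma fin_perm_0: "fin_perm w \<Longrightarrow> w 0 = 0"
  unfolding fin_perm_def permutes_def by auto

lemma finite_inversions:
  assumes "fin_perm w" shows "finite {(p, q). p < q \<and> w q < w p}"
proof -
  from assms obtain m where m: "w permutes {1..m}" unfolding fin_perm_def by auto
  have "p \<in> {..m} \<and> q \<in> {..m}" if "p < q" "w q < w p" for p q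
  proof -
    have "q \<le> m"
    proof (rule ccontr)
      assume "\<not> q \<le> m"
      then have "w q = q" using m by (auto simp: permutes_def)
      moreover have "w p \<le> max p m" using permutes_in_image[OF m, of p] m
        by (cases "p \<in> {1..m}") (auto simp: permutes_def)
      ultimately show False using that \<open>\<not> q \<le> m\<close> by auto
    qed
    then show ?thesis using that by auto
  qed
  then have "{(p, q). p < q \<and> w q < w p} \<subseteq> {..m} \<times> {..m}" by auto
  then show ?thesis by (rule finite_subset) auto
qed

lemma adj_less: "p < q \<Longrightarrow> \<not> (p = Suc k \<and> q = Suc (Suc k)) \<Longrightarrow> adj k p < adj k q"
  by (auto simp: Transposition.transpose_def)

text \<open>Moving both positions of a pair by \<open>adj k\<close> maps the inversions of
  \<open>w\<close> injectively to inversions of the product; the ascent at \<open>k\<close> makes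
  the exchanged pair the only further one.\<close>

lemma perm_length_comp_adj:
  assumes w: "fin_perm w" and up: "w (Suc k) < w (Suc (Suc k))"
  shows "perm_length (w \<circ> adj k) = Suc (perm_length w)"
proof -
  let ?I = "{(p, q). p < q \<and> w q < w p}"
  let ?f = "map_prod (adj k) (adj k)"
  have eq: "{(p, q). p < q \<and> (w \<circ> adj k) q < (w \<circ> adj k) p} = insert (Suc k, Suc (Suc k)) (?f ` ?I)"
    (is "?L = ?R")
  proof -
    have "(p, q) \<in> ?L \<longleftrightarrow> (p, q) \<in> ?R" for p q
    proof -
    have "(p, q) \<in> ?f ` ?I \<longleftrightarrow> (adj k p, adj k q) \<in> ?I"
    proof
      assume "(adj k p, adj k q) \<in> ?I"
      then have "?f (adj k p, adj k q) \<in> ?f ` ?I" by blast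
      then show "(p, q) \<in> ?f ` ?I" by simp
    qed auto
    moreover have "(p, q) \<in> ?L \<longleftrightarrow> (p, q) = (Suc k, Suc (Suc k)) \<or> (adj k p, adj k q) \<in> ?I"
      using up adj_less[of p q k] adj_less[of "adj k p" "adj k q" k] by (cases "adj k p = Suc k \<and> adj k q = Suc (Suc k)") auto
    ultimately show ?thesis by blast
  qed
  then show ?thesis by auto
  qed
  have "(Suc k, Suc (Suc k)) \<notin> ?f ` ?I"
  proof
    assume "(Suc k, Suc (Suc k)) \<in> ?f ` ?I"
    then obtain p q where "Suc k = adj k p" "Suc (Suc k) = adj k q" "p < q" by auto
    then have "p = Suc (Suc k)" "q = Suc k" by (metis adj_adj(2) transpose_apply_first transpose_apply_second)+
    with \<open>p < q\<close> show False by simp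
  qed
  moreover have "inj ?f"
    by (intro prod.inj_map) (auto intro: inj_on_inverseI[where g = "adj k"])
  ultimately show ?thesis
    unfolding perm_length_def eq using finite_inversions[OF w]
    by (simp add: card_insert_disjoint card_image inj_on_subset)
qed

lemma perm_length_comp_adj_descent:
  assumes w: "fin_perm w" and down: "w (Suc (Suc k)) < w (Suc k)"
  shows "perm_length w = Suc (perm_length (w \<circ> adj k))"
  using perm_length_comp_adj[OF fin_perm_comp_adj[OF w], of k k] down by simp

lemma fin_perm_adj_neq: "fin_perm w \<Longrightarrow> w (Suc k) \<noteq> w (Suc (Suc k))"
  using fin_perm_inj[of w] by (metis injD n_not_Suc_n)

lemma perm_length_comp_adj_le:
  assumes w: "fin_perm w"
  shows "perm_length (w \<circ> adj k) \<le> Suc (perm_length w)"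
  using perm_length_comp_adj[OF w] perm_length_comp_adj_descent[OF w] fin_perm_adj_neq[OF w, of k]
  by (metis le_SucI linorder_neqE_nat order.refl)

text \<open>Position 0 is fixed, so \<open>w\<close> is strictly increasing on all of nat, and so is
  its inverse. Strictly increasing maps never go below the identity, which squeezes \<open>w\<close>
  onto it.\<close>

lemma fin_perm_no_descent:
  assumes w: "fin_perm w" and "\<And>k. w (Suc k) < w (Suc (Suc k))"
  shows "w = id"
proof -
  have *: "w p < w (Suc p)" for p
  proof (cases p)
    case 0
    then show ?thesis using w fin_perm_inj[OF w] by (metis fin_perm_0 gr0I injD lessI less_irrefl)
  next
    case (Suc k)
    then show ?thesis using assms(2)[of k] by simp
  qed
  then have sm: "strict_mono w" by (simp add: strict_mono_Suc_iff)
  from w obtain m where m: "w permutes {1..m}" unfolding fin_perm_def by auto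
  have "inv_into UNIV w permutes {1..m}" using m by (rule permutes_inv)
  have sm': "strict_mono (inv_into UNIV w)"
  proof (rule strict_monoI)
    fix x y :: nat assume "x < y"
    then have "w (inv_into UNIV w x) < w (inv_into UNIV w y)" using m by (simp add: permutes_inverses)
    then show "inv_into UNIV w x < inv_into UNIV w y" using sm by (simp add: strict_mono_less)
  qed
  have "w p = p" for p
  proof -
    have "p \<le> w p" "w p \<le> inv_into UNIV w (w p)" using sm sm' strict_mono_imp_increasing by blast+
    then show ?thesis using m by (simp add: permutes_inverses)
  qed
  then show ?thesis by auto
qed

lemma perm_prod_Nil [simp]: "perm_prod [] = id"
  and perm_prod_Cons [simp]: "perm_prod (u # us) = u \<circ> perm_prod us"
  by (simp_all add: perm_prod_def)

lemma perm_prod_append [simp]: "perm_prod (us @ vs) = perm_prod us \<circ> perm_prod vs"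
  by (induction us) (auto simp: fun_eq_iff)

abbreviation word_prod :: "nat list \<Rightarrow> nat \<Rightarrow> nat" where
  "word_prod ks \<equiv> perm_prod (map adj ks)"

lemma fin_perm_word_prod [simp]: "fin_perm (word_prod ks)"
proof (induction ks)
  case Nil
  show "fin_perm (word_prod [])" by simp
next
  case (Cons k ks)
  show "fin_perm (word_prod (k # ks))" using fin_perm_comp[OF fin_perm_adj Cons] by simp
qed

lemma perm_length_id [simp]: "perm_length id = 0"
proof -
  have "{(p, q). p < q \<and> id q < id p} = ({} :: (nat \<times> nat) set)" by auto
  then show ?thesis unfolding perm_length_def by (metis card.empty)
qed

lemma perm_length_word_prod_le: "perm_length (word_prod ks) \<le> length ks"
proof (induction ks rule: rev_induct)
  case (snoc k ks)
  have "perm_length (word_prod ks \<circ> adj k) \<le> Suc (length ks)"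
    using perm_length_comp_adj_le[of "word_prod ks" k] snoc by simp
  then show "perm_length (word_prod (ks @ [k])) \<le> length (ks @ [k])" by simp
next
  case Nil
  show "perm_length (word_prod []) \<le> length ([] :: nat list)" by simp
qed

lemma perm_length_0:
  assumes "fin_perm w" "perm_length w = 0" shows "w = id"
proof (rule fin_perm_no_descent[OF assms(1)])
  fix k show "w (Suc k) < w (Suc (Suc k))"
    using perm_length_comp_adj_descent[OF assms(1), of k] assms fin_perm_adj_neq[OF assms(1), of k]
    by (metis linorder_neqE_nat nat.distinct(1))
qed

section \<open>Reduced words and Matsumoto's theorem\<close>

lemma reduced_word_Nil: "reduced_word id []"
  by (simp add: reduced_word_def)

text \<open>At an ascent \<open>k\<close> the shorter word would spell a permutation with more
  inversions than letters. This lets inductions run over the last letter.\<close>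

lemma reduced_word_snoc:
  assumes "fin_perm w"
  shows "reduced_word w (ks @ [k]) \<longleftrightarrow> w (Suc (Suc k)) < w (Suc k) \<and> reduced_word (w \<circ> adj k) ks"
proof
  assume *: "reduced_word w (ks @ [k])"
  then have eq: "word_prod ks \<circ> adj k = w" and len: "perm_length w = Suc (length ks)"
    by (auto simp: reduced_word_def)
  have eq': "word_prod ks = w \<circ> adj k" using eq by force
  have desc: "w (Suc (Suc k)) < w (Suc k)"
  proof (rule ccontr)
    assume "\<not> ?thesis"
    then have "w (Suc k) < w (Suc (Suc k))" using fin_perm_adj_neq[OF assms, of k] by simp
    then have "perm_length (word_prod ks) = Suc (perm_length w)"
      unfolding eq' by (rule perm_length_comp_adj[OF assms])
    then show False using perm_length_word_prod_le[of ks] len by simp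
  qed
  then show "w (Suc (Suc k)) < w (Suc k) \<and> reduced_word (w \<circ> adj k) ks"
    using perm_length_comp_adj_descent[OF assms desc] len eq' by (simp add: reduced_word_def)
next
  assume *: "w (Suc (Suc k)) < w (Suc k) \<and> reduced_word (w \<circ> adj k) ks"
  then have "perm_length w = Suc (length ks)" "word_prod ks \<circ> adj k = w"
    using perm_length_comp_adj_descent[OF assms] by (auto simp: reduced_word_def)
  then show "reduced_word w (ks @ [k])" by (simp add: reduced_word_def)
qed

lemma reduced_word_ex:
  assumes "fin_perm w" shows "\<exists>ks. reduced_word w ks"
  using assms
proof (induction "perm_length w" arbitrary: w)
  case 0
  then show ?case using perm_length_0 reduced_word_Nil by metis
next
  case (Suc l)
  then have "w \<noteq> id" by auto
  then obtain k where "\<not> w (Suc k) < w (Suc (Suc k))" using fin_perm_no_descent[OF Suc.prems] by blast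
  then have k: "w (Suc (Suc k)) < w (Suc k)" using fin_perm_adj_neq[OF Suc.prems, of k] by simp
  then obtain ks where "reduced_word (w \<circ> adj k) ks"
    using Suc perm_length_comp_adj_descent[OF Suc.prems k] fin_perm_comp_adj by (metis nat.inject)
  then show ?case using reduced_word_snoc[OF Suc.prems] k by blast
qed

text \<open>The 0-Hecke monoid: with \<open>idem\<close> in place of the quadratic relation, words
  are compared up to the sign of the algebra element, which is all that an absolute product
  retains.\<close>

inductive hecke_cong :: "nat list \<Rightarrow> nat list \<Rightarrow> bool" where
  refl: "hecke_cong ks ks"
| sym: "hecke_cong ks ls \<Longrightarrow> hecke_cong ls ks"
| trans [trans]: "hecke_cong ks ls \<Longrightarrow> hecke_cong ls ms \<Longrightarrow> hecke_cong ks ms"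
| ctxt: "hecke_cong ks ls \<Longrightarrow> hecke_cong (xs @ ks @ ys) (xs @ ls @ ys)"
| comm: "i + 2 \<le> j \<Longrightarrow> hecke_cong [i, j] [j, i]"
| braid: "hecke_cong [i, Suc i, i] [Suc i, i, Suc i]"
| idem: "hecke_cong [i, i] [i]"

lemma hecke_cong_append: "hecke_cong ks ls \<Longrightarrow> hecke_cong ks' ls' \<Longrightarrow> hecke_cong (ks @ ks') (ls @ ls')"
  using hecke_cong.ctxt[of ks ls "[]" ks'] hecke_cong.ctxt[of ks' ls' ls "[]"] hecke_cong.trans by auto

text \<open>Induction on the length by comparing last letters. Two different last letters are both
  descents of \<open>w\<close>, so \<open>w\<close> also has a reduced word ending in the longest
  element of the subgroup that they generate; the induction hypothesis links both given words to
  it.\<close>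

theorem matsumoto:
  assumes "fin_perm w" "reduced_word w ks" "reduced_word w ls"
  shows "hecke_cong ks ls"
  using assms
proof (induction "length ks" arbitrary: w ks ls rule: less_induct)
  case less
  note w = \<open>fin_perm w\<close>
  have len: "length ks = length ls" using less.prems by (simp add: reduced_word_def)
  show ?case
  proof (cases ks rule: rev_cases)
    case Nil
    then show ?thesis using len by (auto intro: hecke_cong.refl)
  next
    case ks: (snoc ks' k)
    with len obtain ls' l where ls: "ls = ls' @ [l]" by (cases ls rule: rev_cases) auto
    have k: "w (Suc (Suc k)) < w (Suc k)" "reduced_word (w \<circ> adj k) ks'"
      and l: "w (Suc (Suc l)) < w (Suc l)" "reduced_word (w \<circ> adj l) ls'"
      using less.prems reduced_word_snoc[OF w] unfolding ks ls by auto
    have IH: "hecke_cong ms ms'" if "reduced_word v ms" "reduced_word v ms'" "fin_perm v"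
      "length ms < length ks" for v ms ms'
      using less.hyps[OF that(4) that(3,1,2)] .
    \<comment> \<open>\<open>ms\<close> spells \<open>w\<close> without both letters; the chain
      passes through \<open>ms @ [b, a]\<close> and \<open>ms @ [a, b]\<close>.\<close>
    have far: "hecke_cong (as @ [a]) (bs @ [b])"
      if "a + 2 \<le> b" "w (Suc (Suc a)) < w (Suc a)" "w (Suc (Suc b)) < w (Suc b)"
        "reduced_word (w \<circ> adj a) as" "reduced_word (w \<circ> adj b) bs"
        "length as < length ks" "length bs < length ks" for as bs a b
    proof -
      let ?v = "w \<circ> adj a \<circ> adj b"
      have v: "fin_perm ?v" "fin_perm (w \<circ> adj a)" "fin_perm (w \<circ> adj b)" using w by (simp_all only: fin_perm_comp_adj)
      have "w \<circ> adj a \<circ> adj b = w \<circ> adj b \<circ> adj a"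
        using that(1) by (auto simp: fun_eq_iff Transposition.transpose_def)
      obtain ms where ms: "reduced_word ?v ms" using reduced_word_ex[OF v(1)] by blast
      have "reduced_word (w \<circ> adj a) (ms @ [b])"
        using reduced_word_snoc[OF v(2), of ms b] ms that by (simp add: Transposition.transpose_def)
      then have 1: "hecke_cong as (ms @ [b])" using IH that(4,6) v(2) by blast
      have "reduced_word (w \<circ> adj b) (ms @ [a])"
        using reduced_word_snoc[OF v(3), of ms a] ms that \<open>?v = _\<close> by (simp add: Transposition.transpose_def)
      then have 2: "hecke_cong (ms @ [a]) bs" using IH that(5,7) v(3) hecke_cong.sym by blast
      have "hecke_cong (as @ [a]) ((ms @ [b]) @ [a])"
        by (rule hecke_cong_append[OF 1 hecke_cong.refl])
      also have "hecke_cong \<dots> ((ms @ [a]) @ [b])"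
        using hecke_cong_append[OF hecke_cong.refl hecke_cong.sym[OF hecke_cong.comm[OF that(1)]], of ms] by simp
      also have "hecke_cong \<dots> (bs @ [b])"
        by (rule hecke_cong_append[OF 2 hecke_cong.refl])
      finally show ?thesis .
    qed
    \<comment> \<open>Here \<open>ms\<close> spells \<open>w\<close> without the longest element of
      a copy of S_3, and the braid relation joins its two reduced words at the end.\<close>
    have near: "hecke_cong (as @ [a]) (bs @ [Suc a])"
      if "w (Suc (Suc a)) < w (Suc a)" "w (Suc (Suc (Suc a))) < w (Suc (Suc a))"
        "reduced_word (w \<circ> adj a) as" "reduced_word (w \<circ> adj (Suc a)) bs"
        "length as < length ks" "length bs < length ks" for as bs a
    proof -
      let ?v = "w \<circ> adj a \<circ> adj (Suc a) \<circ> adj a"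
      have v: "fin_perm ?v" "fin_perm (w \<circ> adj a)" "fin_perm (w \<circ> adj (Suc a))"
        "fin_perm (w \<circ> adj a \<circ> adj (Suc a))" "fin_perm (w \<circ> adj (Suc a) \<circ> adj a)"
        using w by (simp_all only: fin_perm_comp_adj)
      have eq: "?v = w \<circ> adj (Suc a) \<circ> adj a \<circ> adj (Suc a)"
        by (auto simp: fun_eq_iff Transposition.transpose_def)
      obtain ms where ms: "reduced_word ?v ms" using reduced_word_ex[OF v(1)] by blast
      have "reduced_word (w \<circ> adj a) ((ms @ [a]) @ [Suc a])"
        unfolding reduced_word_snoc[OF v(2)] reduced_word_snoc[OF v(4)]
        using ms that by (simp add: Transposition.transpose_def)
      then have 1: "hecke_cong as (ms @ [a, Suc a])" using IH that v(2) by simp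
      have "reduced_word (w \<circ> adj (Suc a)) ((ms @ [Suc a]) @ [a])"
        unfolding reduced_word_snoc[OF v(3)] reduced_word_snoc[OF v(5)]
        using ms that unfolding eq by (simp add: Transposition.transpose_def)
      then have 2: "hecke_cong (ms @ [Suc a, a]) bs" using IH that v(3) hecke_cong.sym by simp
      have "hecke_cong (as @ [a]) ((ms @ [a, Suc a]) @ [a])"
        by (rule hecke_cong_append[OF 1 hecke_cong.refl])
      also have "hecke_cong \<dots> ((ms @ [Suc a, a]) @ [Suc a])"
        using hecke_cong_append[OF hecke_cong.refl hecke_cong.braid[of a], of ms] by simp
      also have "hecke_cong \<dots> (bs @ [Suc a])"
        by (rule hecke_cong_append[OF 2 hecke_cong.refl])
      finally show ?thesis .
    qed
    have lens: "length ks' < length ks" "length ls' < length ks" using ks ls len by auto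
    consider "k = l" | "k + 2 \<le> l" | "l + 2 \<le> k" | "l = Suc k" | "k = Suc l" by linarith
    then show ?thesis
    proof cases
      case 1
      then have "hecke_cong ks' ls'" using IH k l lens fin_perm_comp_adj[OF w] by blast
      then show ?thesis unfolding ks ls 1 by (rule hecke_cong_append[OF _ hecke_cong.refl])
    next
      case 2 then show ?thesis using far[of k l ks' ls'] k l lens unfolding ks ls by simp
    next
      case 3 then show ?thesis using far[of l k ls' ks'] k l lens hecke_cong.sym unfolding ks ls by simp
    next
      case 4 then show ?thesis using near[of k ks' ls'] k l lens unfolding ks ls by simp
    next
      case 5 then show ?thesis using near[of l ls' ks'] k l lens hecke_cong.sym unfolding ks ls by simp
    qed
  qed
qed

section \<open>Absolute Hecke products as sequences of comparators\<close>

text \<open>Any linear order is allowed for the entries, since the same word later acts on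
  permutations, on truth values and on labels.\<close>

definition comparator :: "nat \<Rightarrow> (nat \<Rightarrow> 'a::linorder) \<Rightarrow> nat \<Rightarrow> 'a" where
  "comparator k a = a(Suc k := max (a (Suc k)) (a (Suc (Suc k))),
    Suc (Suc k) := min (a (Suc k)) (a (Suc (Suc k))))"

definition act :: "(nat \<Rightarrow> 'a::linorder) \<Rightarrow> nat list \<Rightarrow> nat \<Rightarrow> 'a" where
  "act a ks = foldl (\<lambda>a k. comparator k a) a ks"

lemma act_simps [simp]:
  "act a [] = a" "act a (k # ks) = act (comparator k a) ks" "act a (ks @ ls) = act (act a ks) ls"
  by (simp_all add: act_def)

lemma comparator_eq: "comparator k a = (if a (Suc k) < a (Suc (Suc k)) then a \<circ> adj k else a)"
  by (auto simp: comparator_def fun_eq_iff Transposition.transpose_def)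

text \<open>Distant comparators touch disjoint positions, both sides of the braid relation sort
  three entries decreasingly, and sorting a pair twice changes nothing.\<close>

lemma act_hecke_cong: "hecke_cong ks ls \<Longrightarrow> act a ks = act a ls"
proof (induction arbitrary: a rule: hecke_cong.induct)
  case (comm i j)
  then show ?case by (auto simp: comparator_def fun_eq_iff)
next
  case (braid i)
  then show ?case by (auto simp: comparator_def fun_eq_iff max_def min_def)
next
  case (idem i)
  then show ?case by (auto simp: comparator_def fun_eq_iff max_def min_def)
qed auto

lemma reduced_word_fin_perm: "reduced_word w ks \<Longrightarrow> fin_perm w"
  unfolding reduced_word_def using fin_perm_word_prod[of ks] by auto

lemma act_id_reduced_word: "reduced_word w ks \<Longrightarrow> act id ks = w"
proof (induction ks arbitrary: w rule: rev_induct)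
  case Nil
  then show ?case by (simp add: reduced_word_def)
next
  case (snoc k ks)
  then have "w (Suc (Suc k)) < w (Suc k)" "reduced_word (w \<circ> adj k) ks"
    using reduced_word_snoc reduced_word_fin_perm by blast+
  with snoc.IH show ?case by (simp add: comparator_eq)
qed

text \<open>For a permutation \<open>a\<close> this is the absolute Hecke product of
  \<open>a\<close> and \<open>w\<close>; arbitrary sequences on the left make it a right action of
  the 0-Hecke monoid.\<close>

definition star :: "(nat \<Rightarrow> 'a::linorder) \<Rightarrow> (nat \<Rightarrow> nat) \<Rightarrow> nat \<Rightarrow> 'a" (infixl \<open>\<star>\<close> 65) where
  "a \<star> w = act a (SOME ks. reduced_word w ks)"

lemma star_reduced_word: "reduced_word w ks \<Longrightarrow> a \<star> w = act a ks"
  unfolding star_def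
  by (rule act_hecke_cong, rule matsumoto) (auto intro: reduced_word_fin_perm someI)

lemma star_id_right [simp]: "a \<star> id = a"
  using star_reduced_word[OF reduced_word_Nil] by simp

lemma star_id_left: "fin_perm w \<Longrightarrow> id \<star> w = w"
  using reduced_word_ex star_reduced_word act_id_reduced_word by metis

lemma star_snoc:
  assumes "fin_perm w" "w (Suc (Suc k)) < w (Suc k)"
  shows "a \<star> w = comparator k (a \<star> (w \<circ> adj k))"
proof -
  obtain ks where "reduced_word (w \<circ> adj k) ks"
    using reduced_word_ex fin_perm_comp_adj assms by blast
  then show ?thesis using star_reduced_word[of w "ks @ [k]" a] star_reduced_word[of _ ks a]
    assms reduced_word_snoc[of w ks k] by simp
qed

text \<open>An ascent at the new letter extends a reduced word. At a descent there is a reduced word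
  that already ends in this letter, and \<open>idem\<close> absorbs the repetition.\<close>

lemma hecke_cong_reduced:
  "fin_perm (act id ks) \<and> (\<forall>ls. reduced_word (act id ks) ls \<longrightarrow> hecke_cong ks ls)"
proof (induction ks rule: rev_induct)
  case Nil
  show "fin_perm (act id []) \<and> (\<forall>ls. reduced_word (act id []) ls \<longrightarrow> hecke_cong [] ls)"
    by (auto simp: reduced_word_def intro: hecke_cong.refl)
next
  case (snoc k ks)
  let ?w = "act id ks"
  have w: "fin_perm ?w" using snoc by blast
  obtain ms where ms: "reduced_word ?w ms" using reduced_word_ex[OF w] by blast
  have fin: "fin_perm (act id (ks @ [k]))"
    using w fin_perm_comp_adj[OF w] by (simp add: comparator_eq)
  have 1: "hecke_cong (ks @ [k]) (ms @ [k])"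
    using snoc ms hecke_cong_append hecke_cong.refl by blast
  have "\<exists>ls. reduced_word (act id (ks @ [k])) ls \<and> hecke_cong (ks @ [k]) ls"
  proof (cases "?w (Suc k) < ?w (Suc (Suc k))")
    case True
    then have "reduced_word (act id (ks @ [k])) (ms @ [k])"
      using ms reduced_word_snoc[OF fin, of ms k] by (simp add: comparator_eq)
    then show ?thesis using 1 by blast
  next
    case False
    then have desc: "?w (Suc (Suc k)) < ?w (Suc k)" using fin_perm_adj_neq[OF w, of k] by simp
    obtain ns where ns: "reduced_word (?w \<circ> adj k) ns"
      using reduced_word_ex fin_perm_comp_adj w by blast
    then have red: "reduced_word ?w (ns @ [k])" using reduced_word_snoc[OF w] desc by blast
    have "hecke_cong (ks @ [k]) (ns @ [k, k])"
      using hecke_cong_append[OF matsumoto[OF w ms red] hecke_cong.refl, of "[k]"] 1 hecke_cong.trans by simp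
    also have "hecke_cong \<dots> (ns @ [k])"
      by (rule hecke_cong_append[OF hecke_cong.refl hecke_cong.idem])
    finally show ?thesis using red False by (auto simp: comparator_eq)
  qed
  then show ?case using fin matsumoto[OF fin] hecke_cong.trans by blast
qed

lemma fin_perm_act_id: "fin_perm (act id ks)"
  using hecke_cong_reduced by blast

lemma star_act_id: "a \<star> act id ks = act a ks"
  using hecke_cong_reduced[of ks] reduced_word_ex[of "act id ks"] star_reduced_word act_hecke_cong by metis

lemma star_assoc:
  assumes "fin_perm u" "fin_perm v" shows "a \<star> u \<star> v = a \<star> (u \<star> v)"
proof -
  obtain ks ls where "reduced_word u ks" "reduced_word v ls" using assms reduced_word_ex by metis
  then show ?thesis
    using star_act_id[of a "ks @ ls"] by (simp add: star_reduced_word act_id_reduced_word)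
qed

lemma fin_perm_star: "fin_perm u \<Longrightarrow> fin_perm v \<Longrightarrow> fin_perm (u \<star> v)"
  by (metis star_id_left act_id_reduced_word fin_perm_act_id reduced_word_ex star_reduced_word act_simps(3))

lemma perm_length_act_id_le: "perm_length (act id ks) \<le> length ks"
proof (induction ks rule: rev_induct)
  case Nil
  show "perm_length (act id []) \<le> length ([] :: nat list)" by simp
next
  case (snoc k ks)
  have "perm_length (act id ks) \<le> length ks" using snoc .
  then show "perm_length (act id (ks @ [k])) \<le> length (ks @ [k])"
    using perm_length_comp_adj_le[OF fin_perm_act_id[of ks], of k] by (simp add: comparator_eq)
qed

lemma perm_length_star_le:
  assumes "fin_perm u" "fin_perm v"
  shows "perm_length (u \<star> v) \<le> perm_length u + perm_length v"
proof -
  obtain ks ls where *: "reduced_word u ks" "reduced_word v ls" using assms reduced_word_ex by metis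
  then have "u \<star> v = act id (ks @ ls)"
    by (simp add: star_reduced_word act_id_reduced_word)
  then show ?thesis using perm_length_act_id_le[of "ks @ ls"] * by (simp add: reduced_word_def)
qed

lemma reduced_word_letters:
  assumes "reduced_word w ks" "w permutes {Suc l..m}"
  shows "\<forall>k\<in>set ks. l \<le> k \<and> k + 2 \<le> m"
  using assms
proof (induction ks arbitrary: w rule: rev_induct)
  case (snoc k ks)
  note w = \<open>w permutes {Suc l..m}\<close>
  have red: "w (Suc (Suc k)) < w (Suc k)" "reduced_word (w \<circ> adj k) ks"
    using snoc.prems reduced_word_snoc reduced_word_fin_perm by blast+
  have fixed: "w p = p" if "p \<notin> {Suc l..m}" for p using w that by (simp add: permutes_def)
  have img: "w p \<in> {Suc l..m} \<longleftrightarrow> p \<in> {Suc l..m}" for p using permutes_in_image[OF w] .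
  have k: "l \<le> k \<and> k + 2 \<le> m"
  proof (rule ccontr)
    assume "\<not> ?thesis"
    then consider "Suc k \<notin> {Suc l..m}" | "Suc (Suc k) \<notin> {Suc l..m}" "Suc k \<in> {Suc l..m}" by force
    then show False
    proof cases
      case 1
      then show ?thesis using fixed[of "Suc k"] fixed[of "Suc (Suc k)"] img[of "Suc (Suc k)"] red
        by (cases "Suc (Suc k) \<in> {Suc l..m}") auto
    next
      case 2
      then show ?thesis using fixed[of "Suc (Suc k)"] img[of "Suc k"] red by auto
    qed
  qed
  have "adj k permutes {Suc l..m}" using k by (intro permutes_swap_id) auto
  then have "(w \<circ> adj k) permutes {Suc l..m}" using w permutes_compose by blast
  from snoc.IH[OF red(2) this] show ?case using k by auto
qed simp

lemma permutes_fin_perm: "w permutes {Suc l..m} \<Longrightarrow> fin_perm w"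
  unfolding fin_perm_def by (rule exI[of _ m], erule permutes_subset) auto

lemma permutes_fin_perm': "w permutes {1..m} \<Longrightarrow> fin_perm w"
  unfolding fin_perm_def by blast

text \<open>Which permutation arises depends on \<open>a\<close>; the point is that entries are
  merely rearranged, and only inside the interval that supports \<open>w\<close>.\<close>

lemma star_ex_perm:
  assumes "w permutes {Suc l..m}"
  shows "\<exists>\<sigma>. \<sigma> permutes {Suc l..m} \<and> a \<star> w = a \<circ> \<sigma>"
proof -
  obtain ks where ks: "reduced_word w ks" using assms permutes_fin_perm reduced_word_ex by blast
  have "\<exists>\<sigma>. \<sigma> permutes {Suc l..m} \<and> act a ks = a \<circ> \<sigma>"
    using reduced_word_letters[OF ks assms]
  proof (induction ks rule: rev_induct)
    case Nil
    then show ?case by (auto intro: exI[of _ id] permutes_id)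
  next
    case (snoc k ks)
    have "\<exists>\<sigma>. \<sigma> permutes {Suc l..m} \<and> act a ks = a \<circ> \<sigma>"
      using snoc by (simp add: comp_def)
    then obtain \<sigma> where \<sigma>: "\<sigma> permutes {Suc l..m}" "act a ks = a \<circ> \<sigma>" by blast
    have "adj k permutes {Suc l..m}" using snoc.prems by (intro permutes_swap_id) auto
    then have "(\<sigma> \<circ> adj k) permutes {Suc l..m}" using \<sigma>(1) permutes_compose by blast
    moreover have "act a (ks @ [k]) = a \<circ> (\<sigma> \<circ> adj k) \<or> act a (ks @ [k]) = a \<circ> \<sigma>"
      using \<sigma>(2) by (simp add: comparator_eq comp_assoc)
    ultimately show "\<exists>\<sigma>. \<sigma> permutes {Suc l..m} \<and> act a (ks @ [k]) = a \<circ> \<sigma>"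
      using \<sigma>(1) by blast
  qed
  then show ?thesis using star_reduced_word[OF ks] by metis
qed

lemma star_outside: "w permutes {Suc l..m} \<Longrightarrow> p \<notin> {Suc l..m} \<Longrightarrow> (a \<star> w) p = a p"
  using star_ex_perm[of w l m a] by (auto simp: permutes_def)

lemma star_permutes:
  assumes "u permutes {Suc l..m}" "v permutes {Suc l..m}"
  shows "(u \<star> v) permutes {Suc l..m}"
  using star_ex_perm[OF assms(2), of u] assms(1) permutes_compose by metis

text \<open>A weakly increasing map commutes with max and min, hence with comparators. Monotonicity
  is asked only on the entries that occur, because labels decode monotonically only where they are
  valid.\<close>

lemma star_mono_on:
  assumes w: "w permutes {1..m}" and v: "mono_on (b ` {1..m}) v"
    and a: "\<And>p. p \<in> {1..m} \<Longrightarrow> a p = v (b p)" and p: "p \<in> {1..m}"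
  shows "(a \<star> w) p = v ((b \<star> w) p)"
proof -
  obtain ks where ks: "reduced_word w ks" using w permutes_fin_perm' reduced_word_ex by blast
  have "\<forall>k\<in>set ks. k + 2 \<le> m" using reduced_word_letters[OF ks, of 0 m] w by simp
  then have "\<forall>p\<in>{1..m}. act a ks p = v (act b ks p) \<and> act b ks p \<in> b ` {1..m}"
  proof (induction ks rule: rev_induct)
    case (snoc k ks)
    then have IH: "\<And>p. p \<in> {1..m} \<Longrightarrow> act a ks p = v (act b ks p)"
      "\<And>p. p \<in> {1..m} \<Longrightarrow> act b ks p \<in> b ` {1..m}" and k: "k + 2 \<le> m" by auto
    have "max (v x) (v y) = v (max x y)" "min (v x) (v y) = v (min x y)"
      if "x \<in> b ` {1..m}" "y \<in> b ` {1..m}" for x y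
      using mono_onD[OF v that] mono_onD[OF v that(2,1)] by (auto simp: max_def min_def)
    then show ?case using IH k by (auto simp: comparator_def max_def min_def)
  qed (use a in auto)
  then show ?thesis using star_reduced_word[OF ks] p by metis
qed

lemma star_mono:
  assumes w: "fin_perm w" and v: "mono v"
  shows "(v \<circ> a) \<star> w = v \<circ> (a \<star> w)"
proof -
  obtain ks where ks: "reduced_word w ks" using w reduced_word_ex by blast
  have "act (v \<circ> a) ks = v \<circ> act a ks"
  proof (induction ks rule: rev_induct)
    case (snoc k ks)
    then show ?case using v by (auto simp: fun_eq_iff comparator_def max_of_mono min_of_mono)
  qed simp
  then show ?thesis using star_reduced_word[OF ks] by metis
qed

text \<open>Every inversion of \<open>w\<close> concerns two entries of \<open>a\<close> that are
  not strictly decreasing, so each comparator of a reduced word performs its exchange or meets equal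
  entries: sorting coincides with moving.\<close>

lemma star_comp:
  assumes "fin_perm w" "\<And>p q. p < q \<Longrightarrow> w q < w p \<Longrightarrow> a (w q) \<le> a (w p)"
  shows "a \<star> w = a \<circ> w"
  using assms
proof (induction "perm_length w" arbitrary: w)
  case 0
  then show ?case using perm_length_0 by (metis comp_id star_id_right)
next
  case (Suc n)
  note w = \<open>fin_perm w\<close>
  from Suc have "w \<noteq> id" by auto
  then obtain k where "\<not> w (Suc k) < w (Suc (Suc k))" using fin_perm_no_descent[OF w] by blast
  then have k: "w (Suc (Suc k)) < w (Suc k)" using fin_perm_adj_neq[OF w, of k] by simp
  let ?w = "w \<circ> adj k"
  have "a \<star> ?w = a \<circ> ?w"
  proof (rule Suc.hyps(1))
    show "n = perm_length ?w" using Suc(2) perm_length_comp_adj_descent[OF w k] by simp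
    show "fin_perm ?w" using w by (rule fin_perm_comp_adj)
    fix p q assume pq: "p < q" "?w q < ?w p"
    then have "\<not> (p = Suc k \<and> q = Suc (Suc k))" using k by auto
    from adj_less[OF pq(1) this] pq(2) show "a (?w q) \<le> a (?w p)" using Suc.prems(2) by simp
  qed
  moreover have "a (w (Suc (Suc k))) \<le> a (w (Suc k))" using Suc.prems(2)[OF lessI k] .
  ultimately show ?case
    using star_snoc[OF w k, of a] by (auto simp: comparator_def fun_eq_iff Transposition.transpose_def max_def min_def)
qed

lemma star_descent:
  assumes "fin_perm w" "w (Suc (Suc k)) < w (Suc k)"
  shows "(a \<star> w) (Suc (Suc k)) \<le> (a \<star> w) (Suc k)"
  using star_snoc[OF assms, of a] by (auto simp: comparator_def min_def max_def)

text \<open>The pair is followed by its entries, not its positions: a comparator exchanges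
  neighbours only if they ascend, so these two keep their order.\<close>

lemma star_inversion:
  assumes w: "fin_perm w" and "p < q" "a q < a p" "p \<noteq> 0"
  shows "\<exists>p' q'. p' \<noteq> 0 \<and> p' < q' \<and> (a \<star> w) p' = a p \<and> (a \<star> w) q' = a q"
proof -
  obtain ks where ks: "reduced_word w ks" using w reduced_word_ex by blast
  have "\<exists>p' q'. p' \<noteq> 0 \<and> p' < q' \<and> act a ks p' = a p \<and> act a ks q' = a q"
  proof (induction ks rule: rev_induct)
    case Nil
    then show ?case using assms by auto
  next
    case (snoc k ks)
    then obtain p' q' where *: "p' \<noteq> 0" "p' < q'" "act a ks p' = a p" "act a ks q' = a q" by auto
    show ?case
    proof (cases "act a ks (Suc k) < act a ks (Suc (Suc k))")
      case True
      then have eq: "act a (ks @ [k]) = act a ks \<circ> adj k" by (simp add: comparator_eq)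
      have "\<not> (p' = Suc k \<and> q' = Suc (Suc k))" using True * assms(3) by auto
      from adj_less[OF *(2) this] have "adj k p' < adj k q'" .
      moreover have "adj k p' \<noteq> 0" using *(1) by (auto simp: Transposition.transpose_def)
      ultimately show ?thesis unfolding eq using *
        by (intro exI[of _ "adj k p'"] exI[of _ "adj k q'"]) auto
    next
      case False
      then have eq: "act a (ks @ [k]) = act a ks" by (simp add: comparator_eq)
      show ?thesis unfolding eq using * by blast
    qed
  qed
  then show ?thesis using star_reduced_word[OF ks] by metis
qed

lemma star_adj: "a \<star> adj k = comparator k a"
  using star_snoc[of "adj k" k a] by simp

text \<open>An inversion of the values \<open>Suc k\<close> and \<open>Suc (Suc k)\<close> lets a
  reduced word of \<open>w\<close> begin with \<open>k\<close>. This is the left counterpart of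
  \<open>star_snoc\<close>.\<close>

lemma star_left_descent:
  assumes w: "fin_perm w" and pq: "p < q" "w p = Suc (Suc k)" "w q = Suc k"
  shows "a \<star> w = comparator k a \<star> (adj k \<circ> w)"
proof -
  let ?v = "adj k \<circ> w"
  have v: "fin_perm ?v" using w fin_perm_comp by simp
  have inj: "inj w" using w by (rule fin_perm_inj)
  have "adj k \<star> ?v = adj k \<circ> ?v"
  proof (rule star_comp[OF v])
    fix p' q' assume *: "p' < q'" "?v q' < ?v p'"
    have "\<not> (?v q' = Suc k \<and> ?v p' = Suc (Suc k))"
    proof
      assume "?v q' = Suc k \<and> ?v p' = Suc (Suc k)"
      then have "w q' = Suc (Suc k)" "w p' = Suc k"
        by (metis adj_adj(2) comp_apply transpose_apply_first transpose_apply_second)+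
      then have "q' = p" "p' = q" using pq inj by (metis injD)+
      then show False using * pq by simp
    qed
    from adj_less[OF *(2) this] show "adj k (?v q') \<le> adj k (?v p')" by simp
  qed
  also have "\<dots> = w" by (simp flip: comp_assoc)
  finally show ?thesis
    using star_assoc[of "adj k" ?v a] v by (simp add: star_adj)
qed

section \<open>Coordinates in the degenerate Hecke algebra\<close>

abbreviation word_elem :: "nat list \<Rightarrow> hecke" where
  "word_elem ks \<equiv> prod_list (map hecke_gen ks)"

lemma hecke_gen_comm: "i + 2 \<le> j \<Longrightarrow> hecke_gen i * hecke_gen j = hecke_gen j * hecke_gen i"
  by transfer (simp add: hecke_rel_def hecke_ideal.commute)

lemma hecke_gen_braid:
  "hecke_gen i * hecke_gen (Suc i) * hecke_gen i = hecke_gen (Suc i) * hecke_gen i * hecke_gen (Suc i)"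
  using hecke_ideal.braid[of i] by transfer (simp add: hecke_rel_def)

lemma hecke_gen_quadratic: "hecke_gen i * hecke_gen i = - hecke_gen i"
  by transfer (simp add: hecke_rel_def hecke_ideal.quadratic)

lemma word_elem_hecke_cong:
  "hecke_cong ks ls \<Longrightarrow> word_elem ks = word_elem ls \<or> word_elem ks = - word_elem ls"
proof (induction rule: hecke_cong.induct)
  case (comm i j)
  have "word_elem [i, j] = hecke_gen i * hecke_gen j" by simp
  also have "\<dots> = hecke_gen j * hecke_gen i" by (rule hecke_gen_comm[OF comm])
  also have "\<dots> = word_elem [j, i]" by simp
  finally show ?case by (rule disjI1)
next
  case (braid i)
  then show ?case using hecke_gen_braid[of i] by (simp add: mult.assoc)
next
  case (idem i)
  then show ?case by (simp add: hecke_gen_quadratic)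
qed auto

text \<open>Absorbing a letter costs one sign, so the true coordinate is -1 to the power
  \<open>length - perm_length w\<close>; the sign that depends on \<open>w\<close> alone is left
  out.\<close>

abbreviation word_sign :: "gen_word \<Rightarrow> (nat \<Rightarrow> nat) \<Rightarrow> int" where
  "word_sign v w \<equiv> (if act id (letters v) = w then (- 1) ^ length (letters v) else 0)"

text \<open>
  The \<open>w\<close>-coordinate with respect to the basis of permutations, as a functional on the free
  algebra that vanishes on the ideal.
\<close>

definition perm_coeff :: "(nat \<Rightarrow> nat) \<Rightarrow> free_algebra \<Rightarrow> int" where
  "perm_coeff w x = (\<Sum>v\<in>Poly_Mapping.keys x. Poly_Mapping.lookup x v * word_sign v w)"

lemma perm_coeff_add: "perm_coeff w (x + y) = perm_coeff w x + perm_coeff w y"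
  unfolding perm_coeff_def by (rule setsum_keys_plus_distrib) (simp_all add: algebra_simps)

lemma perm_coeff_0 [simp]: "perm_coeff w 0 = 0"
  by (simp add: perm_coeff_def)

lemma perm_coeff_uminus: "perm_coeff w (- x) = - perm_coeff w x"
  using perm_coeff_add[of w x "- x"] by simp

lemma perm_coeff_diff: "perm_coeff w (x - y) = perm_coeff w x - perm_coeff w y"
  using perm_coeff_add[of w x "- y"] perm_coeff_uminus[of w y] by simp

lemma perm_coeff_single: "perm_coeff w (Poly_Mapping.single v c) = c * word_sign v w"
  by (cases "c = 0") (simp_all add: perm_coeff_def)

lemma free_algebra_induct [case_names zero add_single]:
  fixes x :: free_algebra
  assumes "P 0" "\<And>x v c. P x \<Longrightarrow> P (x + Poly_Mapping.single v c)"
  shows "P x"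
proof (induction x rule: update_induct)
  case (update f a b)
  have "Poly_Mapping.update a b f = f + Poly_Mapping.single a b"
    using update(1) by (intro poly_mapping_eqI)
      (auto simp: lookup_update lookup_add lookup_single when_def in_keys_iff)
  then show ?case using assms(2) update by metis
qed (use assms in auto)

text \<open>The claim is linear in \<open>x\<close> and in \<open>y\<close>, so monomials with
  coefficient 1 suffice.\<close>

lemma perm_coeff_context_0:
  assumes "\<And>xs ys. perm_coeff w (Poly_Mapping.single (Word xs) 1 * a * Poly_Mapping.single (Word ys) 1) = 0"
  shows "perm_coeff w (x * a * y) = 0"
proof -
  have oi: "(of_int c :: free_algebra) = Poly_Mapping.single 0 c" for c
  proof -
    have "Poly_Mapping.single 0 (of_int c :: int) = (of_int c :: free_algebra)" by (rule single_of_int)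
    then show ?thesis by (simp only: of_int_eq_id id_apply)
  qed
  have scale: "Poly_Mapping.single v c = of_int c * Poly_Mapping.single v (1::int)" for v :: gen_word and c
    by (simp add: oi mult_single)
  have int_comm: "p * (of_int c * q) = of_int c * (p * q)" for p q :: free_algebra and c
  proof -
    have "p * (of_int c * q) = (p * of_int c) * q" by (simp only: mult.assoc)
    also have "p * of_int c = of_int c * p" by (rule mult_of_int_commute[symmetric])
    finally show ?thesis by (simp only: mult.assoc)
  qed
  have int_mult: "perm_coeff w (of_int c * z) = c * perm_coeff w z" for c z
  proof (induction z rule: free_algebra_induct)
    case (add_single x v d)
    have "of_int c * Poly_Mapping.single v d = Poly_Mapping.single v (c * d)"
      by (simp add: oi mult_single)
    then show ?case using add_single
      by (simp add: distrib_left perm_coeff_add perm_coeff_single)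
  qed simp
  have 1: "perm_coeff w (Poly_Mapping.single u 1 * a * y) = 0" for u
  proof (induction y rule: free_algebra_induct)
    case (add_single x v c)
    have "Poly_Mapping.single u 1 * a * Poly_Mapping.single v c =
        of_int c * (Poly_Mapping.single u 1 * a * Poly_Mapping.single v 1)"
      unfolding scale[of v c] by (rule int_comm)
    then show ?case using add_single assms[of "letters u" "letters v"]
      by (simp add: distrib_left perm_coeff_add int_mult)
  qed simp
  show ?thesis
  proof (induction x rule: free_algebra_induct)
    case (add_single x v c)
    have "Poly_Mapping.single v c * a * y = of_int c * (Poly_Mapping.single v 1 * a * y)"
      unfolding scale[of v c] by (simp only: mult.assoc)
    then show ?case using add_single 1[of v]
      by (simp add: distrib_right perm_coeff_add int_mult)
  qed simp
qed

lemma free_word: "foldr (\<lambda>k a. free_gen k * a) ks 1 = Poly_Mapping.single (Word ks) 1"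
proof (induction ks)
  case Nil
  then show ?case by (metis foldr_Nil id_apply single_one zero_gen_word_def)
qed (simp add: free_gen_def mult_single plus_gen_word_def)

text \<open>Words that act alike do so in every context, so only their signs differ, and
  \<open>c\<close> compensates: it is 1 for commutation and braid, -1 for the quadratic
  relation.\<close>

lemma perm_coeff_relation:
  assumes "\<And>a :: nat \<Rightarrow> nat. act a ks = act a ls" and c: "(- 1) ^ length ks = c * (- 1) ^ length ls"
  shows "perm_coeff w (x * (Poly_Mapping.single (Word ks) 1 - Poly_Mapping.single (Word ls) c) * y) = 0"
proof (rule perm_coeff_context_0)
  fix xs ys
  have "Poly_Mapping.single (Word xs) 1 *
      (Poly_Mapping.single (Word ks) 1 - Poly_Mapping.single (Word ls) c) * Poly_Mapping.single (Word ys) 1 =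
      Poly_Mapping.single (Word (xs @ ks @ ys)) 1 - Poly_Mapping.single (Word (xs @ ls @ ys)) c"
    by (simp add: right_diff_distrib left_diff_distrib mult_single plus_gen_word_def)
  then show "perm_coeff w (Poly_Mapping.single (Word xs) 1 *
      (Poly_Mapping.single (Word ks) 1 - Poly_Mapping.single (Word ls) c) * Poly_Mapping.single (Word ys) 1) = 0"
    using c by (simp add: perm_coeff_diff perm_coeff_single assms(1) power_add)
qed

text \<open>The factors \<open>x\<close> and \<open>y\<close> are built into the statement so that
  closure of the ideal under multiplication becomes associativity.\<close>

lemma perm_coeff_ideal: "a \<in> hecke_ideal \<Longrightarrow> perm_coeff w (x * a * y) = 0"
proof (induction arbitrary: x y rule: hecke_ideal.induct)
  case (commute i j)
  show ?case
    using perm_coeff_relation[where ks = "[i, j]" and ls = "[j, i]" and c = 1, OF act_hecke_cong[OF hecke_cong.comm[OF commute]]]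
    by (simp add: free_gen_def mult_single plus_gen_word_def)
next
  case (braid i)
  show ?case
    using perm_coeff_relation[where ks = "[i, Suc i, i]" and ls = "[Suc i, i, Suc i]" and c = 1, OF act_hecke_cong[OF hecke_cong.braid]]
    by (simp add: free_gen_def mult_single plus_gen_word_def)
next
  case (quadratic i)
  show ?case
    using perm_coeff_relation[where ks = "[i, i]" and ls = "[i]" and c = "- 1", OF act_hecke_cong[OF hecke_cong.idem]]
    by (simp add: free_gen_def mult_single plus_gen_word_def single_uminus)
next
  case (add a b)
  then show ?case by (simp add: algebra_simps perm_coeff_add)
next
  case (mult a x' y')
  then show ?case by (metis mult.assoc)
qed

lemma word_elem_abs: "word_elem ks = abs_hecke (Poly_Mapping.single (Word ks) 1)"
proof (induction ks)
  case Nil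
  then show ?case by (simp add: one_hecke_def flip: free_word)
next
  case (Cons k ks)
  have "Poly_Mapping.single (Word (k # ks)) 1 = free_gen k * Poly_Mapping.single (Word ks) 1"
    by (simp flip: free_word)
  then show ?case using Cons by (simp add: hecke_gen.abs_eq times_hecke.abs_eq)
qed

text \<open>If the permutations differ, the functional for \<open>act id ks\<close> is 1 or -1 on
  the first word and 0 on the second, so neither the sum nor the difference of the words lies in the
  ideal.\<close>

lemma word_elem_eqD:
  assumes "word_elem ks = word_elem ls \<or> word_elem ks = - word_elem ls"
  shows "act id ks = act id ls"
proof (rule ccontr)
  assume neq: "act id ks \<noteq> act id ls"
  let ?w = "act id ks" and ?x = "Poly_Mapping.single (Word ks) 1 :: free_algebra"
    and ?y = "Poly_Mapping.single (Word ls) 1 :: free_algebra"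
  have "hecke_rel ?x ?y \<or> hecke_rel ?x (- ?y)"
    using assms by (simp add: word_elem_abs uminus_hecke.abs_eq hecke.abs_eq_iff)
  then have "perm_coeff ?w (?x - ?y) = 0 \<or> perm_coeff ?w (?x + ?y) = 0"
    using perm_coeff_ideal[of "?x - ?y" ?w 1 1] perm_coeff_ideal[of "?x + ?y" ?w 1 1]
    unfolding hecke_rel_def mult_1_left mult_1_right diff_minus_eq_add by blast
  then show False using neq by (auto simp: perm_coeff_diff perm_coeff_add perm_coeff_single)
qed

lemma hecke_of_perm_eqD:
  assumes "fin_perm u" "fin_perm v" "hecke_of_perm u = hecke_of_perm v \<or> hecke_of_perm u = - hecke_of_perm v"
  shows "u = v"
proof -
  have red: "reduced_word w (SOME ks. reduced_word w ks)" if "fin_perm w" for w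
    using reduced_word_ex[OF that] by (rule someI_ex)
  have "act id (SOME ks. reduced_word u ks) = act id (SOME ks. reduced_word v ks)"
    using assms(3) unfolding hecke_of_perm_def by (rule word_elem_eqD)
  then show ?thesis using act_id_reduced_word[OF red] assms(1,2) by simp
qed

lemma word_elem_hecke_of_perm:
  "word_elem ks = hecke_of_perm (act id ks) \<or> word_elem ks = - hecke_of_perm (act id ks)"
proof -
  have "reduced_word (act id ks) (SOME ls. reduced_word (act id ks) ls)"
    using reduced_word_ex[OF fin_perm_act_id] by (rule someI_ex)
  then show ?thesis unfolding hecke_of_perm_def
    using hecke_cong_reduced word_elem_hecke_cong by blast
qed

lemma fin_perm_foldl_star: "(\<And>u. u \<in> set us \<Longrightarrow> fin_perm u) \<Longrightarrow> fin_perm v \<Longrightarrow> fin_perm (foldl (\<star>) v us)"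
  by (induction us arbitrary: v) (auto intro: fin_perm_star)

text \<open>Concatenating words gives existence up to sign, the coordinates give uniqueness. The
  algebra enters the rest of the argument only through this equation.\<close>

lemma hecke_prod_eq_foldl:
  assumes "\<And>u. u \<in> set us \<Longrightarrow> fin_perm u"
  shows "hecke_prod us = foldl (\<star>) id us"
proof -
  define ws where "ws = concat (map (\<lambda>u. SOME ks. reduced_word u ks) us)"
  have "prod_list (map hecke_of_perm us) = word_elem ws"
    unfolding ws_def by (induction us) (auto simp: hecke_of_perm_def)
  moreover have "act id ws = foldl (\<star>) id us"
  proof -
    have "act a ws = foldl (\<star>) a us" for a :: "nat \<Rightarrow> nat"
      unfolding ws_def by (induction us arbitrary: a) (auto simp: star_def)
    then show ?thesis .
  qed
  ultimately have eq: "prod_list (map hecke_of_perm us) = hecke_of_perm (foldl (\<star>) id us) \<or>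
      prod_list (map hecke_of_perm us) = - hecke_of_perm (foldl (\<star>) id us)"
    using word_elem_hecke_of_perm[of ws] by metis
  have fin: "fin_perm (foldl (\<star>) id us)" using assms by (intro fin_perm_foldl_star) auto
  show ?thesis
    unfolding hecke_prod_def
  proof (rule the_equality)
    show "(\<exists>m. foldl (\<star>) id us permutes {1..m}) \<and>
        (prod_list (map hecke_of_perm us) = hecke_of_perm (foldl (\<star>) id us) \<or>
         prod_list (map hecke_of_perm us) = - hecke_of_perm (foldl (\<star>) id us))"
      using eq fin unfolding fin_perm_def by blast
    fix w assume w: "(\<exists>m. w permutes {1..m}) \<and> (prod_list (map hecke_of_perm us) = hecke_of_perm w \<or>
         prod_list (map hecke_of_perm us) = - hecke_of_perm w)"
    then have "hecke_of_perm w = hecke_of_perm (foldl (\<star>) id us) \<or>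
        hecke_of_perm w = - hecke_of_perm (foldl (\<star>) id us)"
      using eq by (metis minus_minus)
    moreover have "fin_perm w" using w by (simp add: fin_perm_def)
    ultimately show "w = foldl (\<star>) id us" using fin by (intro hecke_of_perm_eqD)
  qed
qed

section \<open>Rank inequalities\<close>

context vec_space
begin

lemma lin_indpt_extend:
  assumes X: "finite X" "X \<subseteq> carrier_vec n" and S: "S \<subseteq> X" "lin_indpt S"
  obtains U where "S \<subseteq> U" "U \<subseteq> X" "lin_indpt U" "X \<subseteq> span U"
    "card U = vectorspace.dim class_ring (span_vs X)"
proof -
  obtain U where U: "maximal U (\<lambda>T. T \<subseteq> X \<and> lin_indpt T)" "S \<subseteq> U"
    using maximal_exists_superset[of X "\<lambda>T. T \<subseteq> X \<and> lin_indpt T" S] X(1) S by blast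
  then have UX: "U \<subseteq> X" "lin_indpt U" unfolding maximal_def by auto
  have "X \<subseteq> span U"
  proof (rule subsetI, rule ccontr)
    fix v assume v: "v \<in> X" "v \<notin> span U"
    have Uc: "U \<subseteq> carrier_vec n" using UX X by auto
    then have "v \<notin> U" using v span_mem by auto
    then have "lin_indpt (U \<union> {v})"
      using lin_dep_iff_in_span[of U v] Uc UX X v by auto
    then have "U \<union> {v} = U" using U(1) UX v unfolding maximal_def by blast
    then show False using \<open>v \<notin> U\<close> by auto
  qed
  moreover have "card U = vectorspace.dim class_ring (span_vs X)"
    using dim_span[OF _ X(1) U(1)] X(2) by simp
  ultimately show ?thesis using that UX U(2) by blast
qed

lemma rank_basis:
  assumes "A \<in> carrier_mat n k"
  obtains S where "S \<subseteq> set (cols A)" "lin_indpt S" "set (cols A) \<subseteq> span S" "card S = rank A"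
proof -
  have "set (cols A) \<subseteq> carrier_vec n" using assms cols_dim[of A] by auto
  moreover have "lin_indpt {}" using lindep_span[of "{}"] by auto
  ultimately show ?thesis using that unfolding rank_def
    by (rule lin_indpt_extend[OF finite_set _ empty_subsetI])
qed

lemma lin_indpt_card_le:
  assumes "finite W" "W \<subseteq> carrier_vec n" "finite U" "lin_indpt U" "U \<subseteq> span W"
  shows "card U \<le> card W"
proof -
  from replacement[OF assms(3,1,2,4,5)]
  obtain C :: "'a vec set" where "int (card C) \<le> int (card W) - int (card U)" by (elim exE conjE)
  then show ?thesis by linarith
qed

text \<open>The preimage of a subspace under \<open>A\<close> is a subspace; containing
  \<open>U\<close>, it contains \<open>span U\<close>.\<close>

lemma mult_mat_vec_in_span:
  assumes A: "A \<in> carrier_mat m n" and U: "U \<subseteq> carrier_vec n" and W: "W \<subseteq> carrier_vec m"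
    and AU: "\<And>u. u \<in> U \<Longrightarrow> A *\<^sub>v u \<in> LinearCombinations.module.span class_ring (module_vec TYPE('a) m) W"
    and v: "v \<in> span U"
  shows "A *\<^sub>v v \<in> LinearCombinations.module.span class_ring (module_vec TYPE('a) m) W"
proof -
  interpret m: vec_space "TYPE('a)" m .
  let ?N = "{v \<in> carrier_vec n. A *\<^sub>v v \<in> m.span W}"
  have "submodule class_ring ?N V"
  proof (rule submodule.intro, goal_cases)
    case 1 then show ?case by (rule module_axioms)
  next
    case 2 then show ?case by auto
  next
    case (3 v w)
    then have "A *\<^sub>v (v + w) = A *\<^sub>v v + A *\<^sub>v w" using A mult_add_distrib_mat_vec by blast
    then show ?case using 3 m.span_add1[OF W] by simp
  next
    case 4
    have "A *\<^sub>v 0\<^sub>v n = 0\<^sub>v m" using A by (intro eq_vecI) auto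
    moreover have "0\<^sub>v m \<in> m.span W"
      using submodule.zero_closed[OF m.span_is_submodule[of W]] W by simp
    ultimately show ?case by simp
  next
    case (5 c v)
    then have "A *\<^sub>v (c \<cdot>\<^sub>v v) = c \<cdot>\<^sub>v (A *\<^sub>v v)" using A mult_mat_vec by blast
    then show ?case using 5 m.smult_in_span[OF W] by simp
  qed
  moreover have "U \<subseteq> ?N" using U AU by auto
  ultimately have "span U \<subseteq> ?N" by (intro span_is_subset)
  then show ?thesis using v by auto
qed

end

text \<open>A basis \<open>S\<close> of the image of \<open>B * C\<close> is completed by
  \<open>T\<close> to one of the image of \<open>B\<close>. The image of \<open>A * B\<close> is
  spanned by that of \<open>A * B * C\<close> and \<open>A\<close> applied to \<open>T\<close>, and
  \<open>card T\<close> is at most the difference of the ranks of \<open>B\<close> and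
  \<open>B * C\<close>.\<close>

theorem frobenius_rank_inequality:
  fixes A B C :: "'a::field mat"
  assumes A: "A \<in> carrier_mat m n" and B: "B \<in> carrier_mat n k" and C: "C \<in> carrier_mat k l"
  shows "vec_space.rank m (A * B) + vec_space.rank n (B * C) \<le>
    vec_space.rank n B + vec_space.rank m (A * B * C)"
proof -
  interpret n: vec_space "TYPE('a)" n .
  interpret m: vec_space "TYPE('a)" m .
  have carr: "set (cols B) \<subseteq> carrier_vec n" "set (cols (B * C)) \<subseteq> carrier_vec n"
    "set (cols (A * B)) \<subseteq> carrier_vec m" "set (cols (A * B * C)) \<subseteq> carrier_vec m"
    using A B C cols_dim[of B] cols_dim[of "B * C"] cols_dim[of "A * B"] cols_dim[of "A * B * C"] by auto
  obtain S where S: "S \<subseteq> set (cols (B * C))" "n.lin_indpt S" "set (cols (B * C)) \<subseteq> n.span S"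
    "card S = n.rank (B * C)"
    by (rule n.rank_basis[OF mult_carrier_mat[OF B C]])
  obtain R where R: "R \<subseteq> set (cols B)" "n.lin_indpt R" "set (cols B) \<subseteq> n.span R"
    "card R = n.rank B"
    by (rule n.rank_basis[OF B])
  obtain P where P: "P \<subseteq> set (cols (A * B * C))" "m.lin_indpt P"
    "set (cols (A * B * C)) \<subseteq> m.span P" "card P = m.rank (A * B * C)"
    by (rule m.rank_basis[OF mult_carrier_mat[OF mult_carrier_mat[OF A B] C]])
  obtain Q where Q: "Q \<subseteq> set (cols (A * B))" "m.lin_indpt Q" "card Q = m.rank (A * B)"
    by (rule m.rank_basis[OF mult_carrier_mat[OF A B]])
  let ?X = "set (cols (B * C)) \<union> set (cols B)"
  have Xc: "?X \<subseteq> carrier_vec n" using carr by auto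
  have SX: "finite ?X" "S \<subseteq> ?X" using S(1) by auto
  obtain U where U: "S \<subseteq> U" "U \<subseteq> ?X" "n.lin_indpt U" "?X \<subseteq> n.span U"
    by (rule n.lin_indpt_extend[OF SX(1) Xc SX(2) S(2)])
  \<comment> \<open>The columns of the product are combinations of columns of \<open>B\<close>; so
    \<open>U\<close> cannot exceed the rank of \<open>B\<close> although it is chosen among the
    columns of both matrices.\<close>
  have BC: "set (cols (B * C)) \<subseteq> n.span R"
  proof
    fix v assume "v \<in> set (cols (B * C))"
    then obtain j where j: "j < l" "v = col (B * C) j" using B C by (auto simp: cols_def)
    have v: "v = B *\<^sub>v col C j" unfolding j(2) by (rule col_mult2[OF B C j(1)])
    interpret k: vec_space "TYPE('a)" k .
    have "col C j \<in> k.span (set (unit_vecs k))"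
      using C j k.span_unit_vecs_is_carrier by (metis carrier_matD(1) col_dim)
    moreover have "B *\<^sub>v u \<in> n.span R" if "u \<in> set (unit_vecs k)" for u
    proof -
      from that obtain i where i: "i < k" "u = unit_vec k i" by (auto simp: unit_vecs_def)
      then have "B *\<^sub>v u = col B i" using B by (intro eq_vecI) auto
      moreover have "col B i \<in> set (cols B)" using B i by (auto simp: cols_def)
      ultimately show ?thesis using R by auto
    qed
    ultimately show "v \<in> n.span R"
      unfolding v using k.mult_mat_vec_in_span[OF B, of "set (unit_vecs k)" R] R(1) carr(1)
      by (metis (no_types, lifting) subset_trans unit_vecs_carrier)
  qed
  have fin: "finite S" "finite R" "finite P" "finite Q" "finite U"
    using S(1) R(1) P(1) Q(1) U(2) by (auto intro: finite_subset)
  have Rc: "R \<subseteq> carrier_vec n" "P \<subseteq> carrier_vec m" "U \<subseteq> carrier_vec n" using R P U Xc carr by auto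
  have "card U \<le> card R"
    using n.lin_indpt_card_le[OF fin(2) Rc(1) fin(5) U(3)] U(2) BC R(3) by blast
  define T where "T = U - S"
  have cT: "card T + n.rank (B * C) = card U"
    unfolding T_def using S(4) U(1) fin by (metis add.commute card_Diff_subset card_mono le_add_diff_inverse)
  let ?W = "P \<union> (*\<^sub>v) A ` T"
  have Wc: "?W \<subseteq> carrier_vec m" using Rc A unfolding T_def by auto
  have inW: "A *\<^sub>v u \<in> m.span ?W" if u: "u \<in> U" for u
  proof (cases "u \<in> S")
    case True
    then obtain j where j: "j < l" "u = col (B * C) j" using S(1) B C by (auto simp: cols_def)
    have "A *\<^sub>v u = col (A * B * C) j"
      unfolding j(2) assoc_mult_mat[OF A B C] by (rule col_mult2[OF A mult_carrier_mat[OF B C] j(1), symmetric])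
    moreover have "\<dots> \<in> set (cols (A * B * C))" using A B C j by (auto simp: cols_def)
    ultimately have "A *\<^sub>v u \<in> m.span P" using P by auto
    then show ?thesis using m.span_is_monotone[of P ?W] by auto
  next
    case False
    then have "A *\<^sub>v u \<in> ?W" using u by (auto simp: T_def)
    then show ?thesis using m.span_mem[OF Wc] by auto
  qed
  have "Q \<subseteq> m.span ?W"
  proof
    fix q assume "q \<in> Q"
    then obtain j where j: "j < k" "q = col (A * B) j" using Q(1) A B by (auto simp: cols_def)
    have "q = A *\<^sub>v col B j" unfolding j(2) by (rule col_mult2[OF A B j(1)])
    moreover have "col B j \<in> n.span U" using U(4) B j by (auto simp: cols_def)
    ultimately show "q \<in> m.span ?W" using n.mult_mat_vec_in_span[OF A Rc(3) Wc inW] by simp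
  qed
  then have "card Q \<le> card ?W"
    using m.lin_indpt_card_le[OF _ Wc fin(4) Q(2)] fin by (simp add: T_def)
  also have "\<dots> \<le> card P + card ((*\<^sub>v) A ` T)" by (rule card_Un_le)
  also have "\<dots> \<le> card P + card T" using fin by (simp add: T_def card_image_le)
  finally show ?thesis using cT \<open>card U \<le> card R\<close> P(4) Q(3) R(4) by linarith
qed

section \<open>Block swaps\<close>

lemma composite_carrier:
  assumes "\<And>i. i < n \<Longrightarrow> \<phi> i \<in> carrier_mat (e (Suc i)) (e i)" "i + k \<le> n"
  shows "composite e \<phi> i k \<in> carrier_mat (e (i + k)) (e i)"
  using assms(2)
proof (induction k)
  case (Suc k)
  then show ?case using assms(1)[of "i + k"] by auto
qed simp

lemma composite_Suc_left:
  assumes "\<And>i. i < n \<Longrightarrow> \<phi> i \<in> carrier_mat (e (Suc i)) (e i)" "Suc (i + k) \<le> n"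
  shows "composite e \<phi> i (Suc k) = composite e \<phi> (Suc i) k * \<phi> i"
  using assms(2)
proof (induction k)
  case 0
  then show ?case using assms(1)[of i] by simp
next
  case (Suc k)
  have "\<phi> (Suc (i + k)) \<in> carrier_mat (e (Suc (Suc (i + k)))) (e (Suc (i + k)))"
    "\<phi> i \<in> carrier_mat (e (Suc i)) (e i)"
    "composite e \<phi> (Suc i) k \<in> carrier_mat (e (Suc (i + k))) (e (Suc i))"
    using composite_carrier[of n \<phi> e "Suc i" k, OF assms(1)] assms(1)[of "Suc (i + k)"] assms(1)[of i] Suc by auto
  then show ?case using Suc by (simp add: assoc_mult_mat)
qed

text \<open>All that is used of a sequence of linear maps: composing does not raise the rank, and
  Frobenius' inequality.\<close>

definition rank_ineqs :: "nat \<Rightarrow> (nat \<Rightarrow> nat \<Rightarrow> nat) \<Rightarrow> bool" where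
  "rank_ineqs n r \<longleftrightarrow>
    (\<forall>i j. i \<le> j \<and> j < n \<longrightarrow> r i (Suc j) \<le> r i j) \<and>
    (\<forall>i j. i < j \<and> j \<le> n \<longrightarrow> r i j \<le> r (Suc i) j) \<and>
    (\<forall>i j. i < j \<and> j < n \<longrightarrow> r (Suc i) (Suc j) + r i j \<le> r (Suc i) j + r i (Suc j))"

lemma rank_conditions_rank_ineqs:
  assumes "rank_conditions TYPE('k::field) n r"
  shows "rank_ineqs n r"
proof -
  let ?e = "\<lambda>l. r l l"
  obtain \<phi> :: "nat \<Rightarrow> 'k mat" where \<phi>: "\<And>i. i < n \<Longrightarrow> \<phi> i \<in> carrier_mat (r (Suc i) (Suc i)) (r i i)"
    and rk: "\<And>i j. i \<le> j \<Longrightarrow> j \<le> n \<Longrightarrow> r i j = vec_space.rank (r j j) (composite ?e \<phi> i (j - i))"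
    using assms unfolding rank_conditions_def by blast
  note carr = composite_carrier[of n \<phi> ?e, OF \<phi>]
  have 1: "r i (Suc j) \<le> r i j" if "i \<le> j" "j < n" for i j
  proof -
    let ?B = "composite ?e \<phi> i (j - i)"
    have B: "?B \<in> carrier_mat (r j j) (r i i)" using carr[of i "j - i"] that by simp
    have A: "\<phi> j \<in> carrier_mat (r (Suc j) (Suc j)) (r j j)" using \<phi> that by simp
    have eq: "r i j = vec_space.rank (r j j) ?B" "r i (Suc j) = vec_space.rank (r (Suc j) (Suc j)) (\<phi> j * ?B)"
      using rk[of i j] rk[of i "Suc j"] that by (simp_all add: Suc_diff_le)
    \<comment> \<open>With a third factor that has no columns, Frobenius' inequality bounds the rank
      after composing on the left.\<close>
    show ?thesis
      using frobenius_rank_inequality[OF A B zero_carrier_mat[of "r i i" 0]] A B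
      unfolding eq by (simp add: vec_space.rank_0I)
  qed
  have mid: "r i j = vec_space.rank (r j j) (composite ?e \<phi> (Suc i) (j - Suc i) * \<phi> i)"
    if "i < j" "j \<le> n" for i j
    using rk[of i j] composite_Suc_left[of n \<phi> ?e i "j - Suc i", OF \<phi>] that by (simp add: Suc_diff_Suc)
  have 2: "r i j \<le> r (Suc i) j" if "i < j" "j \<le> n" for i j
  proof -
    let ?B = "composite ?e \<phi> (Suc i) (j - Suc i)"
    have B: "?B \<in> carrier_mat (r j j) (r (Suc i) (Suc i))" using carr[of "Suc i" "j - Suc i"] that by simp
    have C: "\<phi> i \<in> carrier_mat (r (Suc i) (Suc i)) (r i i)" using \<phi> that by simp
    have eq: "r (Suc i) j = vec_space.rank (r j j) ?B" using rk[of "Suc i" j] that by simp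
    \<comment> \<open>Dually, a first factor without rows gives the bound for composing on the
      right.\<close>
    show ?thesis
      using frobenius_rank_inequality[OF zero_carrier_mat[of 0 "r j j"] B C] B C
      unfolding eq mid[OF that] by (simp add: vec_space.rank_0I)
  qed
  have 3: "r (Suc i) (Suc j) + r i j \<le> r (Suc i) j + r i (Suc j)" if "i < j" "j < n" for i j
  proof -
    let ?B = "composite ?e \<phi> (Suc i) (j - Suc i)"
    have B: "?B \<in> carrier_mat (r j j) (r (Suc i) (Suc i))" using carr[of "Suc i" "j - Suc i"] that by simp
    have C: "\<phi> i \<in> carrier_mat (r (Suc i) (Suc i)) (r i i)" using \<phi> that by simp
    have A: "\<phi> j \<in> carrier_mat (r (Suc j) (Suc j)) (r j j)" using \<phi> that by simp
    have "j - i = Suc (j - Suc i)" using that by simp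
    then have comp: "composite ?e \<phi> (Suc i) (j - i) = \<phi> j * ?B" using that by simp
    have eq: "r (Suc i) j = vec_space.rank (r j j) ?B"
      "r (Suc i) (Suc j) = vec_space.rank (r (Suc j) (Suc j)) (\<phi> j * ?B)"
      "r i (Suc j) = vec_space.rank (r (Suc j) (Suc j)) (\<phi> j * ?B * \<phi> i)"
      using rk[of "Suc i" j] rk[of "Suc i" "Suc j"] mid[of i "Suc j"] that comp by simp_all
    show ?thesis
      using frobenius_rank_inequality[OF A B C] unfolding eq mid[OF that(1) less_imp_le[OF that(2)]] .
  qed
  show ?thesis unfolding rank_ineqs_def using 1 2 3 by blast
qed

lemma rank_ineqs_drop_diag: "rank_ineqs n r \<Longrightarrow> rank_ineqs (n - 1) (drop_diag r)"
  unfolding rank_ineqs_def drop_diag_def by auto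

section \<open>The ranks extended below the diagonal\<close>

lemma ext_rank_upper: "i \<le> j \<Longrightarrow> ext_rank r i j = r i j"
  by (simp add: ext_rank_def)

lemma ext_rank_lower_Suc: "j \<le> i \<Longrightarrow> ext_rank r (Suc i) j = ext_rank r i j + r (Suc i) (Suc i)"
  by (auto simp: ext_rank_def)

lemma ext_rank_lower_col: "j < i \<Longrightarrow> ext_rank r i j = r j j + ext_rank r i (Suc j)"
  by (simp add: ext_rank_def sum.atLeast_Suc_atMost)

lemma ext_rank_mono_col:
  assumes "rank_ineqs n r" "i \<le> n" "j < n" shows "ext_rank r i (Suc j) \<le> ext_rank r i j"
proof (cases "i \<le> j")
  case True
  then show ?thesis using assms by (simp add: ext_rank_upper rank_ineqs_def)
next
  case False
  then show ?thesis using ext_rank_lower_col[of j i r] by simp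
qed

lemma ext_rank_mono_row:
  assumes "rank_ineqs n r" "i < n" "j \<le> n" shows "ext_rank r i j \<le> ext_rank r (Suc i) j"
proof (cases "i < j")
  case True
  then show ?thesis using assms by (simp add: ext_rank_upper rank_ineqs_def)
next
  case False
  then show ?thesis using ext_rank_lower_Suc[of j i r] by simp
qed

text \<open>Above the diagonal this is Frobenius' inequality; on it the sums of dimensions cancel
  and only \<open>r i (Suc i)\<close> remains, on the larger side; below it equality holds.\<close>

lemma ext_rank_frobenius:
  assumes "rank_ineqs n r" "i < n" "j < n"
  shows "ext_rank r (Suc i) (Suc j) + ext_rank r i j \<le> ext_rank r (Suc i) j + ext_rank r i (Suc j)"
proof -
  consider "i < j" | "i = j" | "j < i" by linarith
  then show ?thesis
  proof cases
    case 1
    then show ?thesis using assms by (simp add: ext_rank_upper rank_ineqs_def)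
  next
    case 2
    then show ?thesis using ext_rank_lower_Suc[of j i r] ext_rank_upper[of "Suc i" "Suc j" r] ext_rank_upper[of i j r] by simp
  next
    case 3
    then show ?thesis using ext_rank_lower_col[of j i r] ext_rank_lower_col[of j "Suc i" r] by simp
  qed
qed

text \<open>As a right factor it takes the \<open>x + y\<close> entries after position
  \<open>a\<close> and moves the last \<open>x\<close> of them in front of the first
  \<open>y\<close>.\<close>

definition block_swap :: "nat \<Rightarrow> nat \<Rightarrow> nat \<Rightarrow> nat \<Rightarrow> nat" where
  "block_swap a x y p = (if a < p \<and> p \<le> a + x then p + y
     else if a + x < p \<and> p \<le> a + x + y then p - x else p)"

lemma block_swap_inverse: "block_swap a y x (block_swap a x y p) = p"
  by (auto simp: block_swap_def)

lemma block_swap_permutes: "block_swap a x y permutes {Suc a..a + x + y}"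
  unfolding permutes_def
proof (intro conjI allI impI)
  fix p show "p \<notin> {Suc a..a + x + y} \<Longrightarrow> block_swap a x y p = p" by (auto simp: block_swap_def)
  show "\<exists>!q. block_swap a x y q = p"
    by (metis block_swap_inverse)
qed

lemma block_swap_fin_perm [simp]: "fin_perm (block_swap a x y)"
  using block_swap_permutes permutes_fin_perm by blast

lemma block_swap_0 [simp]: "block_swap a 0 y = id" "block_swap a x 0 = id"
  by (auto simp: block_swap_def fun_eq_iff)

lemma star_block_swap:
  assumes "\<And>p q. a < p \<Longrightarrow> p \<le> a + y \<Longrightarrow> a + y < q \<Longrightarrow> q \<le> a + y + x \<Longrightarrow> s p \<le> s q"
  shows "s \<star> block_swap a x y = s \<circ> block_swap a x y"
proof (rule star_comp)
  fix p q assume "p < q" "block_swap a x y q < block_swap a x y p"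
  then have "a < p \<and> p \<le> a + x \<and> a + x < q \<and> q \<le> a + x + y"
    by (auto simp: block_swap_def split: if_splits)
  then show "s (block_swap a x y q) \<le> s (block_swap a x y p)"
    by (auto simp: block_swap_def intro!: assms)
qed simp

text \<open>First \<open>x\<close> entries and then the next \<open>x'\<close> pass the same
  \<open>y\<close> entries. In this way a column below the diagonal collapses into one block swap,
  and conversely a long swap can be cut in two.\<close>

lemma block_swap_star_block_swap:
  "block_swap a x y \<star> block_swap (a + x) x' y = block_swap a (x + x') y"
proof -
  have "block_swap a x y \<star> block_swap (a + x) x' y = block_swap a x y \<circ> block_swap (a + x) x' y"
    by (rule star_block_swap) (auto simp: block_swap_def)
  also have "\<dots> = block_swap a (x + x') y"
    by (auto simp: block_swap_def fun_eq_iff)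
  finally show ?thesis .
qed

lemma block_swap_comp_block_swap:
  "block_swap a x y \<circ> block_swap (a + x) x' y = block_swap a (x + x') y"
  by (auto simp: block_swap_def fun_eq_iff)

lemma W_perm_eq:
  "ext_rank r i j \<le> ext_rank r (Suc i) j \<Longrightarrow> W_perm r i j =
    block_swap (ext_rank r i j) (ext_rank r (Suc i) j - ext_rank r i j) (ext_rank r i (j - 1) - ext_rank r i j)"
  by (auto simp: W_perm_def block_swap_def Let_def fun_eq_iff)

lemma foldl_star_assoc:
  assumes "\<And>u. u \<in> set us \<Longrightarrow> fin_perm u" "fin_perm v"
  shows "foldl (\<star>) (s \<star> v) us = s \<star> foldl (\<star>) v us"
  using assms
proof (induction us arbitrary: v)
  case (Cons u us)
  then show ?case using star_assoc[of v u s] fin_perm_star by simp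
qed simp

lemma foldl_star_id:
  assumes "\<And>u. u \<in> set us \<Longrightarrow> fin_perm u"
  shows "foldl (\<star>) s us = s \<star> foldl (\<star>) id us"
  using foldl_star_assoc[OF assms, of us id s] by simp

lemma fin_perm_W_perm:
  assumes "rank_ineqs n r" "i < n" "j \<le> n" shows "fin_perm (W_perm r i j)"
  using W_perm_eq[OF ext_rank_mono_row[OF assms]] by simp

lemma W_perm_lower:
  assumes "rank_ineqs n r" "j \<le> i" "i < n" "0 < j"
  shows "W_perm r i j = block_swap (ext_rank r i j) (r (Suc i) (Suc i)) (r (j - 1) (j - 1))"
proof -
  have "ext_rank r i j \<le> ext_rank r (Suc i) j" using assms ext_rank_mono_row[OF assms(1,3)] by simp
  moreover have "ext_rank r (Suc i) j - ext_rank r i j = r (Suc i) (Suc i)"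
    using assms by (simp add: ext_rank_lower_Suc)
  moreover have "ext_rank r i (j - 1) - ext_rank r i j = r (j - 1) (j - 1)"
    using assms ext_rank_lower_col[of "j - 1" i r] by simp
  ultimately show ?thesis by (simp add: W_perm_eq)
qed

text \<open>Below the diagonal the extended ranks are sums of dimensions, so consecutive factors of
  the column are adjacent blocks that pass the same \<open>r (j - 1) (j - 1)\<close> entries. They
  merge in either kind of product.\<close>

lemma delta_perm_eq:
  assumes r: "rank_ineqs n r" and j: "0 < j" "j \<le> n"
  shows "delta_perm n r j = block_swap (r j j) (\<Sum>k\<in>{j<..n}. r k k) (r (j - 1) (j - 1))" (is ?A)
    and "foldl (\<star>) s (map (\<lambda>i. W_perm r i j) [j..<n]) = s \<star> delta_perm n r j" (is ?B)
proof -
  have *: "perm_prod (map (\<lambda>i. W_perm r i j) [j..<m]) = block_swap (r j j) (\<Sum>k\<in>{j<..m}. r k k) (r (j - 1) (j - 1)) \<and>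
    foldl (\<star>) id (map (\<lambda>i. W_perm r i j) [j..<m]) = block_swap (r j j) (\<Sum>k\<in>{j<..m}. r k k) (r (j - 1) (j - 1))"
    if "j \<le> m" "m \<le> n" for m
    using that
  proof (induction m rule: dec_induct)
    case base
    show ?case by simp
  next
    case (step m)
    have W: "W_perm r m j = block_swap (r j j + (\<Sum>k\<in>{j<..m}. r k k)) (r (Suc m) (Suc m)) (r (j - 1) (j - 1))"
    proof -
      have "ext_rank r m j = r j j + (\<Sum>k\<in>{j<..m}. r k k)"
        using step by (simp add: ext_rank_def sum.head)
      then show ?thesis using W_perm_lower[OF r, of j m] step j by simp
    qed
    have s: "(\<Sum>k\<in>{j<..Suc m}. r k k) = (\<Sum>k\<in>{j<..m}. r k k) + r (Suc m) (Suc m)"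
    proof -
      have "{j<..Suc m} = insert (Suc m) {j<..m}" using step by auto
      then show ?thesis by simp
    qed
    show ?case using step block_swap_star_block_swap block_swap_comp_block_swap
      by (simp add: W s)
  qed
  show ?A unfolding delta_perm_def using *[of n] j by blast
  show ?B unfolding delta_perm_def using *[of n] j foldl_star_id[of "map (\<lambda>i. W_perm r i j) [j..<n]" s]
      fin_perm_W_perm[OF r] by force
qed

lemma delta_perm_0:
  assumes r: "rank_ineqs n r" shows "delta_perm n r 0 = id"
proof -
  \<comment> \<open>Truncated subtraction makes \<open>0 - 1\<close> column 0 again, so the second
    block is empty.\<close>
  have "W_perm r i 0 = id" if "i < n" for i
    using W_perm_eq[OF ext_rank_mono_row[OF r that, of 0]] by simp
  then have "map (\<lambda>i. W_perm r i 0) [0..<n] = map (\<lambda>i. id) [0..<n]" by (intro map_cong) auto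
  moreover have "perm_prod (map (\<lambda>i. id) xs) = id" for xs :: "nat list" by (induction xs) (auto simp: comp_def id_def)
  ultimately show ?thesis unfolding delta_perm_def by metis
qed

section \<open>The Zelevinsky permutation\<close>

text \<open>Values fall into blocks by dimension: block \<open>i\<close> consists of the values
  above \<open>dim_sum r i\<close> up to \<open>dim_sum r (Suc i)\<close>.\<close>

definition dim_sum :: "(nat \<Rightarrow> nat \<Rightarrow> nat) \<Rightarrow> nat \<Rightarrow> nat" where
  "dim_sum r i = (\<Sum>k<i. r k k)"

lemma dim_sum_mono: "i \<le> j \<Longrightarrow> dim_sum r i \<le> dim_sum r j"
  unfolding dim_sum_def by (rule sum_mono2) auto

lemma ext_rank_0: "ext_rank r i 0 = dim_sum r (Suc i)"
  by (simp add: ext_rank_def dim_sum_def atLeast0AtMost lessThan_Suc_atMost)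

lemma ext_rank_rows_mono:
  assumes "rank_ineqs n r" "i \<le> i'" "i' \<le> n" "j \<le> n" shows "ext_rank r i j \<le> ext_rank r i' j"
  using assms(2,3)
proof (induction i' rule: dec_induct)
  case (step m)
  then show ?case using ext_rank_mono_row[OF assms(1), of m j] assms(4) by simp
qed simp

text \<open>For a permutation: its inverse increases on every block of values. The form with a
  separating boundary is the one that a swap of entries from different blocks visibly
  preserves.\<close>

definition separated_inversions :: "(nat \<Rightarrow> nat \<Rightarrow> nat) \<Rightarrow> (nat \<Rightarrow> nat) \<Rightarrow> bool" where
  "separated_inversions r s \<longleftrightarrow>
    (\<forall>p q. 0 < p \<and> p < q \<and> s q < s p \<longrightarrow> (\<exists>l. s q \<le> dim_sum r l \<and> dim_sum r l < s p))"

text \<open>The state after \<open>j\<close> columns: the positions still in play are sorted, and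
  \<open>ext_rank r i j\<close> of them hold values of the blocks 0 to \<open>i\<close>.\<close>

definition column_inv :: "nat \<Rightarrow> (nat \<Rightarrow> nat \<Rightarrow> nat) \<Rightarrow> nat \<Rightarrow> (nat \<Rightarrow> nat) \<Rightarrow> bool" where
  "column_inv n r j T \<longleftrightarrow> strict_mono_on {0<..ext_rank r n j} T \<and>
    (\<forall>i\<le>n. \<forall>p\<in>{0<..ext_rank r n j}. T p \<le> dim_sum r (Suc i) \<longleftrightarrow> p \<le> ext_rank r i j)"

abbreviation W_column :: "(nat \<Rightarrow> nat \<Rightarrow> nat) \<Rightarrow> nat \<Rightarrow> nat \<Rightarrow> (nat \<Rightarrow> nat) list" where
  "W_column r j m \<equiv> map (\<lambda>i. W_perm r i j) [0..<m]"

context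
  fixes n :: nat and r :: "nat \<Rightarrow> nat \<Rightarrow> nat"
  assumes r: "rank_ineqs n r"
begin

text \<open>
  After \<open>i\<close> factors of a column, the first \<open>r\<^sub>i\<^sub>,\<^sub>j\<^sub>+\<^sub>1\<close> positions
  are sorted and contain entries of the blocks \<open>0, \<dots>, i\<close>; the next \<open>D i\<close> positions hold
  the entries of the blocks \<open>0, \<dots>, i - 1\<close> that do not survive.
\<close>

lemma column_step:
  assumes j: "j < n" and T: "column_inv n r j T" and sep: "separated_inversions r T" and i: "i \<le> n"
  defines "R \<equiv> ext_rank r" and "M \<equiv> dim_sum r"
  defines "D \<equiv> \<lambda>i. case i of 0 \<Rightarrow> 0 | Suc i \<Rightarrow> R i j - R i (Suc j)"
    and "U \<equiv> \<lambda>i. foldl (\<star>) T (W_column r (Suc j) i)"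
  shows "U i = T \<circ> perm_prod (W_column r (Suc j) i) \<and>
    strict_mono_on {0<..R i (Suc j)} (U i) \<and>
    (\<forall>l\<le>i. \<forall>p\<in>{0<..R i (Suc j)}. U i p \<le> M (Suc l) \<longleftrightarrow> p \<le> R l (Suc j)) \<and>
    strict_mono_on {R i (Suc j)<..R i (Suc j) + D i} (U i) \<and>
    (\<forall>p\<in>{R i (Suc j)<..R i (Suc j) + D i}. U i p \<le> M i) \<and>
    (\<forall>p>R i (Suc j) + D i. U i p = T p) \<and>
    separated_inversions r (U i)"
proof -
  have Tmono: "T p < T q" if "0 < p" "p < q" "q \<le> R n j" for p q
    using T that unfolding column_inv_def R_def strict_mono_on_def by auto
  have Tblock: "T p \<le> M (Suc i) \<longleftrightarrow> p \<le> R i j" if "i \<le> n" "0 < p" "p \<le> R n j" for i p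
    using T that unfolding column_inv_def R_def M_def by auto
  have rows: "R i j \<le> R i' j" "R i (Suc j) \<le> R i' (Suc j)" if "i \<le> i'" "i' \<le> n" for i i'
    using ext_rank_rows_mono[OF r that] j unfolding R_def by auto
  have cols: "R i (Suc j) \<le> R i j" if "i \<le> n" for i
    using ext_rank_mono_col[OF r that j] unfolding R_def .
  have frob: "R (Suc i) (Suc j) + R i j \<le> R (Suc i) j + R i (Suc j)" if "i < n" for i
    using ext_rank_frobenius[OF r that j] unfolding R_def .
  have Mmono: "M i \<le> M i'" if "i \<le> i'" for i i'
    unfolding M_def using that by (rule dim_sum_mono)
  have Dle: "R i (Suc j) + D i \<le> R i j" if "i \<le> n" for i
  proof (cases i)
    case 0
    then show ?thesis using cols[of 0] by (simp add: D_def)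
  next
    case (Suc i')
    then show ?thesis using frob[of i'] cols[of i'] that by (simp add: D_def)
  qed
  have Dge: "R i' j \<le> R (Suc i') (Suc j) + D (Suc i')" if "Suc i' \<le> n" for i'
    using cols[of i'] rows(2)[of i' "Suc i'"] that by (simp add: D_def)
  show ?thesis using i
  proof (induction i)
    case 0
    have "U 0 = T" by (simp add: U_def)
    moreover have "R 0 (Suc j) \<le> R 0 j" "R 0 j \<le> R n j" using cols[of 0] rows(1)[of 0 n] by auto
    ultimately show ?case using sep Tmono Tblock[of 0] by (auto simp: D_def strict_mono_on_def)
  next
    case (Suc i)
    then have i: "i < n" by simp
    \<comment> \<open>The first \<open>a\<close> positions are settled; the \<open>y\<close> entries
      behind them, from blocks 0 to \<open>i\<close>, are to be passed by the \<open>x\<close>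
      surviving entries of block \<open>i + 1\<close>.\<close>
    define a x y where "a = R i (Suc j)" and "x = R (Suc i) (Suc j) - a" and "y = R i j - a"
    have ab: "R (Suc i) (Suc j) = a + x" "R i j = a + y" "D (Suc i) = y"
      using rows(2)[of i "Suc i"] cols[of i] i by (auto simp: a_def x_def y_def D_def)
    have le: "a + D i \<le> a + y" "a + x + y \<le> R (Suc i) j" "R (Suc i) j \<le> R n j" "a + x + y \<le> R n j"
      using Dle[of i] frob[OF i] rows(1)[of "Suc i" n] i ab by (auto simp: a_def)
    have Un: "U i = T \<circ> perm_prod (W_column r (Suc j) i)"
      and U1: "\<And>p q. 0 < p \<Longrightarrow> p < q \<Longrightarrow> q \<le> a \<Longrightarrow> U i p < U i q"
      and U2: "\<And>l p. l \<le> i \<Longrightarrow> 0 < p \<Longrightarrow> p \<le> a \<Longrightarrow> U i p \<le> M (Suc l) \<longleftrightarrow> p \<le> R l (Suc j)"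
      and U3: "\<And>p q. a < p \<Longrightarrow> p < q \<Longrightarrow> q \<le> a + D i \<Longrightarrow> U i p < U i q"
      and U4: "\<And>p. a < p \<Longrightarrow> p \<le> a + D i \<Longrightarrow> U i p \<le> M i"
      and U5: "\<And>p. a + D i < p \<Longrightarrow> U i p = T p"
      and U6: "separated_inversions r (U i)"
      using Suc unfolding a_def[symmetric] strict_mono_on_def by auto
    have W: "W_perm r i (Suc j) = block_swap a x y"
      using W_perm_eq[OF ext_rank_mono_row[OF r i, of "Suc j"]] j by (simp add: a_def x_def y_def R_def)
    have old: "U i p \<le> M (Suc i)" if "a < p" "p \<le> a + y" for p
    proof (cases "p \<le> a + D i")
      case True
      then show ?thesis using U4[OF that(1)] Mmono[of i "Suc i"] by simp
    next
      case False
      then have "U i p = T p" by (intro U5) simp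
      then show ?thesis using Tblock[of i p] that ab(2) i le by simp
    qed
    have new: "U i q = T q" "M (Suc i) < U i q" "U i q \<le> M (Suc (Suc i))"
      if "a + y < q" "q \<le> a + x + y" for q
    proof -
      show eq: "U i q = T q" using that le by (intro U5) simp
      show "M (Suc i) < U i q"
        unfolding eq using Tblock[of i q] that ab(2) i le by simp
      show "U i q \<le> M (Suc (Suc i))"
        unfolding eq using Tblock[of "Suc i" q] that i le by simp
    qed
    have oldmono: "U i p < U i q" if bounds: "a < p" "p < q" "q \<le> a + y" for p q
    proof -
      consider "q \<le> a + D i" | "a + D i < p" | "p \<le> a + D i" "a + D i < q" by linarith
      then show ?thesis
      proof cases
        case 1
        then show ?thesis using U3 that by simp
      next
        case 2
        then show ?thesis using U5[of p] U5[of q] Tmono[of p q] that le by simp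
      next
        \<comment> \<open>The entry at \<open>q\<close> is beyond the blocks below \<open>i\<close>,
          while the leftovers in front of it all come from these blocks.\<close>
        case 3
        then obtain i' where i': "i = Suc i'" using bounds 3 by (cases i) (auto simp: D_def)
        have "R i' j < q" using Dge[of i'] 3 i i' by (simp add: a_def)
        then have "M i < T q" using Tblock[of i' q] i i' that le by simp
        then show ?thesis using U4[of p] U5[of q] 3 that by simp
      qed
    qed
    have USuc: "U (Suc i) = U i \<star> block_swap a x y" by (simp add: U_def W)
    also have "\<dots> = U i \<circ> block_swap a x y"
    proof (rule star_block_swap)
      fix p q assume "a < p" "p \<le> a + y" "a + y < q" "q \<le> a + y + x"
      then show "U i p \<le> U i q" using old[of p] new(2)[of q] by simp
    qed
    finally have US: "U (Suc i) = U i \<circ> block_swap a x y" .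
    have S1: "U (Suc i) p = U i p" if "p \<le> a" for p using that by (simp add: US block_swap_def)
    have S2: "U (Suc i) p = U i (p + y)" if "a < p" "p \<le> a + x" for p
      using that by (simp add: US block_swap_def)
    have S3: "U (Suc i) p = U i (p - x)" if "a + x < p" "p \<le> a + x + y" for p
      using that by (simp add: US block_swap_def)
    have S4: "U (Suc i) p = U i p" if "a + x + y < p" for p
      using that by (simp add: US block_swap_def)
    have "U (Suc i) = T \<circ> perm_prod (W_column r (Suc j) (Suc i))"
      unfolding US Un W[symmetric] by (simp add: comp_assoc)
    moreover have "strict_mono_on {0<..a + x} (U (Suc i))"
    proof (rule strict_mono_onI)
      fix p q assume pq: "p \<in> {0<..a + x}" "q \<in> {0<..a + x}" "p < q"
      consider "q \<le> a" | "p \<le> a" "a < q" | "a < p" using pq by linarith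
      then show "U (Suc i) p < U (Suc i) q"
      proof cases
        case 1
        then show ?thesis using U1 S1 pq by simp
      next
        case 2
        have "U i p \<le> M (Suc i)" using U2[of i p] 2 pq a_def by simp
        then show ?thesis using 2 S1[of p] S2[of q] new(2)[of "q + y"] pq by simp
      next
        case 3
        then show ?thesis using S2[of p] S2[of q] new(1)[of "p + y"] new(1)[of "q + y"]
            Tmono[of "p + y" "q + y"] pq le by simp
      qed
    qed
    moreover have "U (Suc i) p \<le> M (Suc l) \<longleftrightarrow> p \<le> R l (Suc j)"
      if "l \<le> Suc i" "p \<in> {0<..a + x}" for l p
    proof (cases "p \<le> a")
      case True
      show ?thesis
      proof (cases "l \<le> i")
        case False
        then have l: "l = Suc i" using that by simp
        have "U i p \<le> M (Suc (Suc i))"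
          using U2[of i p] Mmono[of "Suc i" "Suc (Suc i)"] True that a_def by simp
        then show ?thesis using True S1[of p] ab l by simp
      qed (use True S1[of p] U2[of l p] that in simp)
    next
      case False
      have *: "U (Suc i) p = U i (p + y)" "M (Suc i) < U i (p + y)" "U i (p + y) \<le> M (Suc (Suc i))"
        using False that S2[of p] new[of "p + y"] by auto
      show ?thesis
      proof (cases "l \<le> i")
        case True
        have "R l (Suc j) \<le> a" using rows(2)[of l i] True i a_def by simp
        then show ?thesis using False * Mmono[of "Suc l" "Suc i"] True by simp
      next
        case False
        then have l: "l = Suc i" using that by simp
        then show ?thesis using * ab that by simp
      qed
    qed
    moreover have "strict_mono_on {a + x<..a + x + y} (U (Suc i))"
    proof (rule strict_mono_onI)
      fix p q assume pq: "p \<in> {a + x<..a + x + y}" "q \<in> {a + x<..a + x + y}" "p < q"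
      then show "U (Suc i) p < U (Suc i) q"
        using S3[of p] S3[of q] oldmono[of "p - x" "q - x"] by auto
    qed
    moreover have "U (Suc i) p \<le> M (Suc i)" if "p \<in> {a + x<..a + x + y}" for p
      using that S3[of p] old[of "p - x"] by auto
    moreover have "U (Suc i) p = T p" if "a + x + y < p" for p
      using that S4[of p] U5[of p] le by simp
    moreover have "separated_inversions r (U (Suc i))"
      unfolding separated_inversions_def
    proof (intro allI impI, elim conjE)
      fix p q :: nat assume pq: "0 < p" "p < q" "U (Suc i) q < U (Suc i) p"
      let ?W = "block_swap a x y"
      show "\<exists>l. U (Suc i) q \<le> dim_sum r l \<and> dim_sum r l < U (Suc i) p"
      proof (cases "?W p < ?W q")
        case True
        moreover have "0 < ?W p" using pq by (auto simp: block_swap_def)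
        ultimately show ?thesis using U6 pq unfolding separated_inversions_def US by auto
      next
        case False
        then have "a < p \<and> p \<le> a + x \<and> a + x < q \<and> q \<le> a + x + y"
          using pq by (auto simp: block_swap_def split: if_splits)
        then have "U (Suc i) q \<le> M (Suc i)" "M (Suc i) < U (Suc i) p"
          using S2[of p] S3[of q] new(2)[of "p + y"] old[of "q - x"] by auto
        then show ?thesis unfolding M_def by blast
      qed
    qed
    ultimately show ?case unfolding ab by blast
  qed
qed

text \<open>Behind the survivors lie first the discarded entries of the blocks below
  \<open>n\<close> and then those of block \<open>n\<close>, both sorted; this is the increasing
  interval that the column leaves behind.\<close>

lemma column_full:
  assumes j: "j < n" and T: "column_inv n r j T" and sep: "separated_inversions r T"
  defines "R \<equiv> ext_rank r" and "U \<equiv> foldl (\<star>) T (W_column r (Suc j) n)"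
  shows "U = T \<circ> perm_prod (W_column r (Suc j) n)" "column_inv n r (Suc j) U"
    "separated_inversions r U" "strict_mono_on {R n (Suc j)<..R n j} U" "\<And>p. R n j < p \<Longrightarrow> U p = T p"
proof -
  obtain m where m: "n = Suc m" using j by (cases n) auto
  let ?D = "R m j - R m (Suc j)"
  note * = column_step[OF j T sep order_refl, folded R_def U_def, unfolded m nat.case, folded m]
  show "U = T \<circ> perm_prod (W_column r (Suc j) n)" "separated_inversions r U" using * by blast+
  show "column_inv n r (Suc j) U"
    using * unfolding column_inv_def R_def by blast
  have frob: "R n (Suc j) + R m j \<le> R n j + R m (Suc j)"
    using ext_rank_frobenius[OF r, of m j] j m unfolding R_def by simp
  have cols: "R m (Suc j) \<le> R m j" "R m (Suc j) \<le> R n (Suc j)"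
    using ext_rank_mono_col[OF r, of m j] ext_rank_mono_row[OF r, of m "Suc j"] j m unfolding R_def by auto
  have le: "R n (Suc j) + ?D \<le> R n j" "R m j \<le> R n (Suc j) + ?D" using frob cols by auto
  show "U p = T p" if "R n j < p" for p using * that le by (meson le_less_trans)
  have "strict_mono_on {R n (Suc j)<..R n (Suc j) + ?D} U" using * by blast
  then have U3: "U p < U q" if "R n (Suc j) < p" "p < q" "q \<le> R n (Suc j) + ?D" for p q
    by (rule strict_mono_onD) (use that in simp_all)
  have U4: "U p \<le> dim_sum r n" if "R n (Suc j) < p" "p \<le> R n (Suc j) + ?D" for p
    using * that by auto
  have U5: "U p = T p" if "R n (Suc j) + ?D < p" for p using * that by blast
  show "strict_mono_on {R n (Suc j)<..R n j} U"
  proof (rule strict_mono_onI)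
    fix p q assume pq: "p \<in> {R n (Suc j)<..R n j}" "q \<in> {R n (Suc j)<..R n j}" "p < q"
    consider "q \<le> R n (Suc j) + ?D" | "R n (Suc j) + ?D < p" | "p \<le> R n (Suc j) + ?D" "R n (Suc j) + ?D < q"
      by linarith
    then show "U p < U q"
    proof cases
      case 1
      then show ?thesis using U3 pq by simp
    next
      case 2
      then show ?thesis using U5[of p] U5[of q] T pq unfolding column_inv_def strict_mono_on_def R_def by auto
    next
      case 3
      then have "\<not> T q \<le> dim_sum r (Suc m)"
        using T pq le(2) m unfolding column_inv_def R_def by auto
      then show ?thesis using U4[of p] U5[of q] 3 pq m by simp
    qed
  qed
qed

abbreviation W_columns :: "nat \<Rightarrow> (nat \<Rightarrow> nat) list" where
  "W_columns m \<equiv> concat (map (\<lambda>j. W_column r j n) [1..<Suc m])"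

text \<open>The next column only moves positions up to \<open>ext_rank r n m\<close>, so the
  increasing intervals left by the earlier ones persist.\<close>

lemma W_columns_properties:
  assumes "m \<le> n"
  shows "foldl (\<star>) id (W_columns m) = perm_prod (W_columns m) \<and>
    column_inv n r m (perm_prod (W_columns m)) \<and> separated_inversions r (perm_prod (W_columns m)) \<and>
    (\<forall>j<m. strict_mono_on {ext_rank r n (Suc j)<..ext_rank r n j} (perm_prod (W_columns m)))" (is "?P m")
  using assms
proof (induction m)
  case 0
  have "dim_sum r (Suc n) = ext_rank r n 0" by (simp add: ext_rank_0)
  then show ?case
    by (auto simp: column_inv_def separated_inversions_def ext_rank_0 strict_mono_on_def)
next
  case (Suc m)
  let ?T = "perm_prod (W_columns m)"
  have m: "m < n" using Suc.prems by simp
  have "?P m" by (rule Suc.IH) (use m in simp)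
  then have IH: "foldl (\<star>) id (W_columns m) = ?T"
    and T: "column_inv n r m ?T" "separated_inversions r ?T"
    and mono: "\<And>j. j < m \<Longrightarrow> strict_mono_on {ext_rank r n (Suc j)<..ext_rank r n j} ?T"
    by blast+
  note col = column_full[OF m T]
  have cols: "W_columns (Suc m) = W_columns m @ W_column r (Suc m) n" by simp
  have eq: "foldl (\<star>) id (W_columns (Suc m)) = foldl (\<star>) ?T (W_column r (Suc m) n)"
    "perm_prod (W_columns (Suc m)) = ?T \<circ> perm_prod (W_column r (Suc m) n)"
    unfolding cols foldl_append perm_prod_append IH by simp_all
  have "strict_mono_on {ext_rank r n (Suc j)<..ext_rank r n j} (foldl (\<star>) ?T (W_column r (Suc m) n))"
    if "j < Suc m" for j
  proof (cases "j = m")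
    case True
    then show ?thesis using col(4) by simp
  next
    case False
    then have jm: "j < m" using that by simp
    have "ext_rank r n m \<le> ext_rank r n (Suc j)"
      using jm m
    proof (induction m)
      case (Suc k)
      then show ?case using ext_rank_mono_col[OF r, of n k] by (cases "k = j") auto
    qed simp
    then have "\<And>p. p \<in> {ext_rank r n (Suc j)<..ext_rank r n j} \<Longrightarrow>
      foldl (\<star>) ?T (W_column r (Suc m) n) p = ?T p"
      using col(5) by auto
    moreover have "strict_mono_on {ext_rank r n (Suc j)<..ext_rank r n j} ?T" by (rule mono[OF jm])
    ultimately show ?thesis unfolding strict_mono_on_def by simp
  qed
  then have "\<forall>j<Suc m. strict_mono_on {ext_rank r n (Suc j)<..ext_rank r n j}
      (?T \<circ> perm_prod (W_column r (Suc m) n))" unfolding col(1) by blast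
  then show "?P (Suc m)" unfolding eq using col(1) col(2,3)[unfolded col(1)] by blast
qed

lemma zelevinsky_properties:
  shows "zelevinsky n r = foldl (\<star>) id (W_columns n)"
    and "separated_inversions r (zelevinsky n r)"
    and "\<And>j. j < n \<Longrightarrow> strict_mono_on {ext_rank r n (Suc j)<..ext_rank r n j} (zelevinsky n r)"
    and "strict_mono_on {0<..r n n} (zelevinsky n r)"
  using W_columns_properties[of n] by (simp_all add: zelevinsky_def column_inv_def ext_rank_upper)

end

section \<open>Factorization along double cosets of Young subgroups\<close>

lemma perm_length_inv:
  assumes "w permutes S" shows "perm_length (inv_into UNIV w) = perm_length w"
proof -
  let ?y = "inv_into UNIV w"
  have y: "w (?y p) = p" "?y (w p) = p" for p using permutes_inverses[OF assms] by auto
  have "bij_betw (\<lambda>(p, q). (w q, w p)) {(p, q). p < q \<and> w q < w p} {(p, q). p < q \<and> ?y q < ?y p}"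
    by (rule bij_betw_byWitness[where f' = "\<lambda>(p, q). (?y q, ?y p)"]) (auto simp: y)
  from bij_betw_same_card[OF this] show ?thesis unfolding perm_length_def by (rule HOL.sym)
qed

lemma strict_mono_on_consecutive:
  fixes f :: "nat \<Rightarrow> nat"
  assumes "\<And>k. l \<le> k \<Longrightarrow> k + 2 \<le> m \<Longrightarrow> f (Suc k) < f (Suc (Suc k))"
  shows "strict_mono_on {l<..m} f"
proof (rule strict_mono_onI)
  fix p q assume pq: "p \<in> {l<..m}" "q \<in> {l<..m}" "p < q"
  have "f p < f (Suc p + d)" if "Suc p + d \<le> m" for d
    using that
  proof (induction d)
    case 0
    then show ?case using assms[of "p - 1"] pq by simp
  next
    case (Suc d)
    then show ?case using assms[of "p + d"] pq by (auto intro: less_trans)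
  qed
  from this[of "q - Suc p"] show "f p < f q" using pq by simp
qed

lemma down_closed_interval:
  fixes P :: "nat \<Rightarrow> bool"
  assumes down: "\<And>p q. l < p \<Longrightarrow> p < q \<Longrightarrow> q \<le> m \<Longrightarrow> P q \<Longrightarrow> P p" and p: "p \<in> {l<..m}"
  shows "P p \<longleftrightarrow> p \<le> l + card {p \<in> {l<..m}. P p}"
proof
  assume "P p"
  then have "{l<..p} \<subseteq> {p \<in> {l<..m}. P p}" using down p by (auto simp: order_le_less)
  then have "card {l<..p} \<le> card {p \<in> {l<..m}. P p}" by (intro card_mono) auto
  then show "p \<le> l + card {p \<in> {l<..m}. P p}" using p by simp
next
  assume *: "p \<le> l + card {p \<in> {l<..m}. P p}"
  show "P p"
  proof (rule ccontr)
    assume "\<not> P p"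
    then have "{p \<in> {l<..m}. P p} \<subseteq> {l<..<p}"
      using down[of p] p by (metis (no_types, lifting) greaterThanAtMost_iff greaterThanLessThan_iff linorder_neqE_nat mem_Collect_eq subsetI)
    then have "card {p \<in> {l<..m}. P p} \<le> card {l<..<p}" by (intro card_mono) auto
    then have "card {p \<in> {l<..m}. P p} \<le> p - Suc l" by simp
    moreover have "l < p" using p by simp
    ultimately show False using * by linarith
  qed
qed

text \<open>The block swaps are the minimal representatives of the double cosets of two Young subgroups.\<close>

lemma block_swap_unique:
  assumes w: "w permutes {1..a + b}"
    and right: "strict_mono_on {0<..b} w" "strict_mono_on {b<..a + b} w"
    and left: "strict_mono_on {0<..a} (inv_into UNIV w)" "strict_mono_on {a<..a + b} (inv_into UNIV w)"
  defines "\<rho> \<equiv> card {p \<in> {1..b}. w p \<le> a}"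
  shows "w = block_swap \<rho> (b - \<rho>) (a - \<rho>)"
proof -
  let ?y = "inv_into UNIV w"
  have y: "w (?y p) = p" "?y (w p) = p" for p using permutes_inverses[OF w] by auto
  have iv: "{1..m} = {0<..m}" for m :: nat by auto
  have wpos: "w p \<in> {1..a + b} \<longleftrightarrow> p \<in> {1..a + b}" for p using permutes_in_image[OF w] .
  have total: "card {p \<in> {1..a + b}. w p \<le> a} = a"
  proof -
    have "w ` {p \<in> {1..a + b}. w p \<le> a} = {1..a}"
    proof (intro equalityI subsetI)
      fix v assume "v \<in> {1..a}"
      then have "v = w (?y v)" "?y v \<in> {1..a + b}" using y wpos[of "?y v"] by auto
      then show "v \<in> w ` {p \<in> {1..a + b}. w p \<le> a}" using \<open>v \<in> {1..a}\<close> by (intro image_eqI[of _ _ "?y v"]) auto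
    next
      fix v assume "v \<in> w ` {p \<in> {1..a + b}. w p \<le> a}"
      then show "v \<in> {1..a}" using wpos by auto
    qed
    moreover have "inj_on w {p \<in> {1..a + b}. w p \<le> a}" using permutes_inj[OF w] by (rule inj_on_subset) simp
    ultimately have "card {p \<in> {1..a + b}. w p \<le> a} = card {1..a}" using card_image by fastforce
    then show ?thesis by simp
  qed
  have split: "{p \<in> {1..a + b}. w p \<le> a} = {p \<in> {1..b}. w p \<le> a} \<union> {p \<in> {b<..a + b}. w p \<le> a}" by auto
  have "card ({p \<in> {1..b}. w p \<le> a} \<union> {p \<in> {b<..a + b}. w p \<le> a}) =
      \<rho> + card {p \<in> {b<..a + b}. w p \<le> a}"
    unfolding \<rho>_def by (rule card_Un_disjoint) auto
  then have card2: "\<rho> + card {p \<in> {b<..a + b}. w p \<le> a} = a" using total split by simp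
  have "card {p \<in> {1..b}. w p \<le> a} \<le> card {1..b}" by (rule card_mono) auto
  then have \<rho>: "\<rho> \<le> a" "\<rho> \<le> b" using card2 by (auto simp: \<rho>_def)
  have low: "w p \<le> a \<longleftrightarrow> p \<le> \<rho>" if "p \<in> {0<..b}" for p
  proof -
    have "w p \<le> a \<longleftrightarrow> p \<le> 0 + card {p \<in> {0<..b}. w p \<le> a}"
    proof (rule down_closed_interval[OF _ that])
      fix p q :: nat assume "0 < p" "p < q" "q \<le> b" "w q \<le> a"
      then show "w p \<le> a" using strict_mono_onD[OF right(1), of p q] by simp
    qed
    then show ?thesis unfolding \<rho>_def iv by simp
  qed
  have high: "w p \<le> a \<longleftrightarrow> p \<le> a + b - \<rho>" if "p \<in> {b<..a + b}" for p
  proof -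
    have "w p \<le> a \<longleftrightarrow> p \<le> b + card {p \<in> {b<..a + b}. w p \<le> a}"
    proof (rule down_closed_interval[OF _ that])
      fix p q :: nat assume "b < p" "p < q" "q \<le> a + b" "w q \<le> a"
      then show "w p \<le> a" using strict_mono_onD[OF right(2), of p q] by simp
    qed
    moreover have "b + card {p \<in> {b<..a + b}. w p \<le> a} = a + b - \<rho>" using card2 by simp
    ultimately show ?thesis by simp
  qed
  \<comment> \<open>The inverse of the claimed block swap, so that the claim becomes
    \<open>h = id\<close>.\<close>
  define g where "g = block_swap \<rho> (a - \<rho>) (b - \<rho>)"
  define h where "h = w \<circ> g"
  have fin: "fin_perm w" using w permutes_fin_perm' by blast
  have hfin: "fin_perm h" unfolding h_def g_def using fin by (intro fin_perm_comp) auto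
  have small: "h q \<le> a \<longleftrightarrow> q \<le> a" if "q \<in> {0<..a + b}" for q
  proof -
    consider "q \<le> \<rho>" | "\<rho> < q" "q \<le> a" | "a < q" "q \<le> a + b - \<rho>" | "a + b - \<rho> < q" "a < q"
      using \<rho> by linarith
    then show ?thesis
    proof cases
      case 1
      then have "g q = q" "q \<in> {0<..b}" using \<rho> that by (auto simp: g_def block_swap_def)
      then show ?thesis using low[of q] 1 \<rho> by (simp add: h_def)
    next
      case 2
      then have "g q = q + (b - \<rho>)" using \<rho> by (simp add: g_def block_swap_def)
      moreover from this have "b < g q" "g q \<le> a + b - \<rho>" "g q \<le> a + b" using 2 \<rho> by linarith+
      ultimately show ?thesis using high[of "g q"] 2 by (simp add: h_def)
    next
      case 3
      then have "g q = q - (a - \<rho>)" using \<rho> by (simp add: g_def block_swap_def)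
      moreover from this have "\<rho> < g q" "g q \<le> b" using 3 \<rho> by linarith+
      ultimately show ?thesis using low[of "g q"] 3 \<rho> by (simp add: h_def)
    next
      case 4
      then have "g q = q" using \<rho> by (simp add: g_def block_swap_def)
      moreover have "b < q" using 4 \<rho> by linarith
      ultimately show ?thesis using high[of q] 4 \<rho> that by (simp add: h_def)
    qed
  qed
  have gmono: "g q < g q'" if q: "q < q'" "q' \<le> a \<or> a < q" for q q'
  proof (cases "q' \<le> a")
    case True
    then show ?thesis using q(1) \<rho> by (simp add: g_def block_swap_def) linarith
  next
    case False
    have g: "g p = (if p \<le> a + b - \<rho> then p - (a - \<rho>) else p)" if "a < p" for p
      using that \<rho> by (simp add: g_def block_swap_def)
    have "a < q" using q False by simp
    moreover from this have "q - (a - \<rho>) < q' - (a - \<rho>)" "q - (a - \<rho>) < q'" using q(1) by linarith+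
    moreover have "q' \<le> a + b - \<rho> \<Longrightarrow> q \<le> a + b - \<rho>" using q(1) by linarith
    moreover have "g q = (if q \<le> a + b - \<rho> then q - (a - \<rho>) else q)"
      "g q' = (if q' \<le> a + b - \<rho> then q' - (a - \<rho>) else q')"
      by (rule g, use q(1) \<open>a < q\<close> in simp)+
    ultimately show ?thesis using q(1) by (auto split: if_splits)
  qed
  \<comment> \<open>\<open>h\<close> preserves the two intervals cut at \<open>a\<close>. On each of
    them \<open>g\<close> increases, and \<open>g\<close> is the inverse of \<open>w\<close> after
    \<open>h\<close>, so a descent of \<open>h\<close> would contradict \<open>left\<close>.\<close>
  have "h = id"
  proof (rule fin_perm_no_descent[OF hfin])
    fix k
    let ?q = "Suc k" and ?q' = "Suc (Suc k)"
    have yh: "?y (h p) = g p" for p by (simp add: h_def y)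
    have neq: "h ?q \<noteq> h ?q'" using fin_perm_adj_neq[OF hfin] .
    have gperm: "g permutes {1..a + b}"
      unfolding g_def using block_swap_permutes by (rule permutes_subset) (use \<rho> in auto)
    have hperm: "h permutes {1..a + b}" unfolding h_def using gperm w by (rule permutes_compose)
    have hin: "h p \<in> {1..a + b} \<longleftrightarrow> p \<in> {1..a + b}" for p using permutes_in_image[OF hperm] .
    have hfix: "p \<notin> {1..a + b} \<Longrightarrow> h p = p" for p using hperm by (simp add: permutes_def)
    show "h ?q < h ?q'"
    proof (cases "?q' \<le> a + b")
      case False
      then show ?thesis using hfix[of ?q'] hfix[of ?q] hin[of ?q] by (cases "?q \<le> a + b") auto
    next
      case True
      then have "?q \<in> {1..a + b}" "?q' \<in> {1..a + b}" by auto
      then have hv: "h ?q \<in> {0<..a + b}" "h ?q' \<in> {0<..a + b}" using hin[of ?q] hin[of ?q'] by auto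
      consider "?q' \<le> a" | "?q \<le> a" "a < ?q'" | "a < ?q" by linarith
      then show ?thesis
      proof cases
        case 1
        then have "g ?q < g ?q'" by (intro gmono) auto
        moreover have "h ?q \<in> {0<..a}" "h ?q' \<in> {0<..a}" using small[of ?q] small[of ?q'] 1 True hv by auto
        ultimately show ?thesis
          using strict_mono_onD[OF left(1), of "h ?q'" "h ?q"] neq unfolding yh by - (rule ccontr, simp)
      next
        case 2
        then show ?thesis using small[of ?q] small[of ?q'] True by auto
      next
        case 3
        then have "g ?q < g ?q'" by (intro gmono) auto
        moreover have "h ?q \<in> {a<..a + b}" "h ?q' \<in> {a<..a + b}" using small[of ?q] small[of ?q'] 3 True hv by auto
        ultimately show ?thesis
          using strict_mono_onD[OF left(2), of "h ?q'" "h ?q"] neq unfolding yh by - (rule ccontr, simp)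
      qed
    qed
  qed
  have "w = h \<circ> block_swap \<rho> (b - \<rho>) (a - \<rho>)"
    unfolding h_def g_def by (auto simp: fun_eq_iff block_swap_inverse)
  then show ?thesis using \<open>h = id\<close> by simp
qed

lemma card_comp_permutes:
  assumes "\<sigma> permutes S" shows "card {p \<in> S. P (\<sigma> p)} = card {p \<in> S. P p}"
proof (rule bij_betw_same_card[of \<sigma>])
  have "\<sigma> ` {p \<in> S. P (\<sigma> p)} = {p \<in> S. P p}"
  proof (intro equalityI subsetI)
    fix v assume v: "v \<in> {p \<in> S. P p}"
    then have "inv_into UNIV \<sigma> v \<in> S" "\<sigma> (inv_into UNIV \<sigma> v) = v"
      using permutes_inverses[OF assms] permutes_in_image[OF permutes_inv[OF assms]] by auto
    then show "v \<in> \<sigma> ` {p \<in> S. P (\<sigma> p)}" using v by (intro image_eqI[of _ _ "inv_into UNIV \<sigma> v"]) auto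
  qed (use permutes_in_image[OF assms] in auto)
  then show "bij_betw \<sigma> {p \<in> S. P (\<sigma> p)} {p \<in> S. P p}"
    unfolding bij_betw_def using permutes_inj[OF assms] by (auto intro: inj_on_subset)
qed

text \<open>Induction on the length: a descent of \<open>w\<close> inside the first \<open>b\<close>
  positions is peeled off to \<open>u\<close>, one of its inverse inside the first \<open>a\<close>
  values to \<open>v\<close>. Neither affects the count or the monotonicity hypotheses, and when
  none is left \<open>block_swap_unique\<close> applies.\<close>

lemma two_block_factorization:
  assumes "w permutes {1..a + b}"
    and "\<And>k. b \<le> k \<Longrightarrow> k + 2 \<le> a + b \<Longrightarrow> w (Suc k) < w (Suc (Suc k))"
    and "\<And>k. a \<le> k \<Longrightarrow> k + 2 \<le> a + b \<Longrightarrow> inv_into UNIV w (Suc k) < inv_into UNIV w (Suc (Suc k))"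
  shows "\<exists>v u. v permutes {1..a} \<and> u permutes {1..b} \<and>
    w = v \<star> block_swap (card {p \<in> {1..b}. w p \<le> a}) (b - card {p \<in> {1..b}. w p \<le> a}) (a - card {p \<in> {1..b}. w p \<le> a}) \<star> u \<and>
    perm_length w = perm_length v + perm_length (block_swap (card {p \<in> {1..b}. w p \<le> a})
      (b - card {p \<in> {1..b}. w p \<le> a}) (a - card {p \<in> {1..b}. w p \<le> a})) + perm_length u"
  using assms
proof (induction "perm_length w" arbitrary: w rule: less_induct)
  case less
  let ?y = "inv_into UNIV w"
  let ?c = "\<lambda>w. card {p \<in> {1..b}. w p \<le> a}"
  let ?W = "\<lambda>w. block_swap (?c w) (b - ?c w) (a - ?c w)"
  note w = \<open>w permutes {1..a + b}\<close> and right = less.prems(2) and left = less.prems(3)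
  have y: "w (?y p) = p" "?y (w p) = p" for p using permutes_inverses[OF w] by auto
  have yperm: "?y permutes {1..a + b}" using w by (rule permutes_inv)
  have fin: "fin_perm w" "fin_perm ?y" using w yperm permutes_fin_perm' by blast+
  consider (R) k where "k + 2 \<le> b" "w (Suc (Suc k)) < w (Suc k)"
    | (L) k where "k + 2 \<le> a" "?y (Suc (Suc k)) < ?y (Suc k)"
    | (N) "\<And>k. k + 2 \<le> b \<Longrightarrow> w (Suc k) < w (Suc (Suc k))" "\<And>k. k + 2 \<le> a \<Longrightarrow> ?y (Suc k) < ?y (Suc (Suc k))"
    using fin_perm_adj_neq[OF fin(1)] fin_perm_adj_neq[OF fin(2)] by (meson linorder_neqE_nat)
  then show ?case
  proof cases
    case R
    let ?w = "w \<circ> adj k"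
    have adj: "adj k permutes {1..b}" "adj k permutes {1..a + b}" using R by (intro adj_permutes, simp)+
    have len: "perm_length w = Suc (perm_length ?w)" by (rule perm_length_comp_adj_descent[OF fin(1) R(2)])
    have w': "?w permutes {1..a + b}" using adj(2) w by (rule permutes_compose)
    have inv: "inv_into UNIV ?w = adj k \<circ> ?y"
      by (rule inv_unique_comp) (auto simp: fun_eq_iff y)
    have "\<exists>v u. v permutes {1..a} \<and> u permutes {1..b} \<and> ?w = v \<star> ?W ?w \<star> u \<and>
        perm_length ?w = perm_length v + perm_length (?W ?w) + perm_length u"
    proof (rule less.hyps[OF _ w'])
      show "perm_length ?w < perm_length w" using len by simp
      fix m
      show "?w (Suc m) < ?w (Suc (Suc m))" if "b \<le> m" "m + 2 \<le> a + b"
        using right[OF that] R(1) that by (simp add: transpose_apply_other)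
      show "inv_into UNIV ?w (Suc m) < inv_into UNIV ?w (Suc (Suc m))" if "a \<le> m" "m + 2 \<le> a + b"
      proof -
        have "\<not> (?y (Suc m) = Suc k \<and> ?y (Suc (Suc m)) = Suc (Suc k))"
        proof
          assume "?y (Suc m) = Suc k \<and> ?y (Suc (Suc m)) = Suc (Suc k)"
          then have "w (Suc k) = Suc m" "w (Suc (Suc k)) = Suc (Suc m)" using y by metis+
          then show False using R(2) by simp
        qed
        from adj_less[OF left[OF that] this] show ?thesis unfolding inv by simp
      qed
    qed
    then obtain v u where vu: "v permutes {1..a}" "u permutes {1..b}" "?w = v \<star> ?W ?w \<star> u"
      "perm_length ?w = perm_length v + perm_length (?W ?w) + perm_length u" by blast
    have c: "?c ?w = ?c w" using card_comp_permutes[OF adj(1), of "\<lambda>p. w p \<le> a"] by simp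
    have fin': "fin_perm v" "fin_perm u" using vu permutes_fin_perm' by blast+
    have u': "(u \<star> adj k) permutes {1..b}" using star_permutes[of u 0 b "adj k"] vu(2) adj(1) by simp
    have "w = ?w \<star> adj k" using star_snoc[OF fin(1) R(2), of id] fin fin_perm_comp_adj[OF fin(1), of k]
      by (simp add: star_id_left star_adj)
    then have eq: "w = v \<star> ?W w \<star> (u \<star> adj k)"
      using vu(3) fin' star_assoc[of u "adj k" "v \<star> ?W w"] unfolding c by simp
    \<comment> \<open>Subadditivity bounds \<open>perm_length w\<close> by the three lengths; as
      \<open>u \<star> adj k\<close> is at most one longer than \<open>u\<close>, they cannot sum to
      more either.\<close>
    have "perm_length w \<le> perm_length (v \<star> ?W w) + perm_length (u \<star> adj k)"
      using perm_length_star_le[of "v \<star> ?W w" "u \<star> adj k"] fin' eq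
      by (simp add: fin_perm_star)
    also have "perm_length (v \<star> ?W w) \<le> perm_length v + perm_length (?W w)"
      using fin' by (intro perm_length_star_le) auto
    finally have "perm_length w \<le> perm_length v + perm_length (?W w) + perm_length (u \<star> adj k)" by simp
    moreover have "perm_length (u \<star> adj k) \<le> Suc (perm_length u)"
      using perm_length_star_le[of u "adj k"] fin' perm_length_comp_adj[of id k] by simp
    ultimately have "perm_length w = perm_length v + perm_length (?W w) + perm_length (u \<star> adj k)"
      using len vu(4) unfolding c by simp
    then show ?thesis using vu(1) u' eq by blast
  next
    case L
    let ?w = "adj k \<circ> w"
    have adj: "adj k permutes {1..a}" "adj k permutes {1..a + b}" using L by (intro adj_permutes, simp)+
    have inv: "inv_into UNIV ?w = ?y \<circ> adj k"
      by (rule inv_unique_comp) (auto simp: fun_eq_iff y)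
    have w': "?w permutes {1..a + b}" using w adj(2) by (rule permutes_compose)
    have "perm_length ?y = Suc (perm_length (?y \<circ> adj k))" by (rule perm_length_comp_adj_descent[OF fin(2) L(2)])
    then have len: "perm_length w = Suc (perm_length ?w)"
      using perm_length_inv[OF w] perm_length_inv[OF w'] inv by simp
    have "\<exists>v u. v permutes {1..a} \<and> u permutes {1..b} \<and> ?w = v \<star> ?W ?w \<star> u \<and>
        perm_length ?w = perm_length v + perm_length (?W ?w) + perm_length u"
    proof (rule less.hyps[OF _ w'])
      show "perm_length ?w < perm_length w" using len by simp
      fix m
      show "inv_into UNIV ?w (Suc m) < inv_into UNIV ?w (Suc (Suc m))" if "a \<le> m" "m + 2 \<le> a + b"
        using left[OF that] L(1) that unfolding inv by (simp add: transpose_apply_other)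
      show "?w (Suc m) < ?w (Suc (Suc m))" if "b \<le> m" "m + 2 \<le> a + b"
      proof -
        have "\<not> (w (Suc m) = Suc k \<and> w (Suc (Suc m)) = Suc (Suc k))"
        proof
          assume "w (Suc m) = Suc k \<and> w (Suc (Suc m)) = Suc (Suc k)"
          then have "?y (Suc k) = Suc m" "?y (Suc (Suc k)) = Suc (Suc m)" using y by metis+
          then show False using L(2) by simp
        qed
        from adj_less[OF right[OF that] this] show ?thesis by simp
      qed
    qed
    then obtain v u where vu: "v permutes {1..a}" "u permutes {1..b}" "?w = v \<star> ?W ?w \<star> u"
      "perm_length ?w = perm_length v + perm_length (?W ?w) + perm_length u" by blast
    have "?w p \<le> a \<longleftrightarrow> w p \<le> a" for p
      using L(1) by (auto simp: Transposition.transpose_def)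
    then have c: "?c ?w = ?c w" by simp
    have fin': "fin_perm v" "fin_perm u" using vu permutes_fin_perm' by blast+
    have v': "(adj k \<star> v) permutes {1..a}" using star_permutes[of "adj k" 0 a v] vu(1) adj(1) by simp
    have "w = adj k \<star> ?w"
      using star_left_descent[OF fin(1) L(2) y(1) y(1), of id] fin by (simp add: star_id_left flip: star_adj)
    then have eq: "w = adj k \<star> v \<star> ?W w \<star> u"
      using vu(3) fin' star_assoc[of v "?W w" "adj k"] star_assoc[of "v \<star> ?W w" u "adj k"]
      unfolding c by (simp add: fin_perm_star)
    have "perm_length w \<le> perm_length (adj k \<star> v \<star> ?W w) + perm_length u"
      using perm_length_star_le[of "adj k \<star> v \<star> ?W w" u] fin' eq by (simp add: fin_perm_star)
    also have "perm_length (adj k \<star> v \<star> ?W w) \<le> perm_length (adj k \<star> v) + perm_length (?W w)"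
      using fin' by (intro perm_length_star_le fin_perm_star) auto
    finally have "perm_length w \<le> perm_length (adj k \<star> v) + perm_length (?W w) + perm_length u" by simp
    moreover have "perm_length (adj k \<star> v) \<le> Suc (perm_length v)"
      using perm_length_star_le[of "adj k" v] fin' perm_length_comp_adj[of id k] by simp
    ultimately have "perm_length w = perm_length (adj k \<star> v) + perm_length (?W w) + perm_length u"
      using len vu(4) unfolding c by simp
    then show ?thesis using vu(2) v' eq by blast
  next
    case N
    have "w = ?W w"
      by (rule block_swap_unique[OF w]; rule strict_mono_on_consecutive)
        (use N right left in auto)
    then show ?thesis
      using star_id_left[OF fin(1)] by (intro exI[of _ id]) (simp add: permutes_id)
  qed
qed

section \<open>Factors of KMS-factorizations\<close>

text \<open>The trailing \<open>delta_perm n r n\<close> is the identity, so every round can be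
  given the same shape.\<close>

primrec kms_state :: "nat \<Rightarrow> (nat \<Rightarrow> nat \<Rightarrow> nat) \<Rightarrow> (nat \<Rightarrow> nat \<Rightarrow> nat) \<Rightarrow> nat \<Rightarrow> nat \<Rightarrow> nat" where
  "kms_state n r w 0 = id"
| "kms_state n r w (Suc j) = kms_state n r w j \<star> w (Suc j) \<star> delta_perm n r (Suc j)"

lemma delta_perm_n: "rank_ineqs n r \<Longrightarrow> delta_perm n r n = id"
  by (cases "n = 0") (simp_all add: delta_perm_0 delta_perm_eq(1))

lemma fin_perm_delta_perm: "rank_ineqs n r \<Longrightarrow> j \<le> n \<Longrightarrow> fin_perm (delta_perm n r j)"
  by (cases "j = 0") (simp_all add: delta_perm_0 delta_perm_eq(1))

lemma hecke_prod_kms_state: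
  assumes r: "rank_ineqs n r" and w: "\<And>i. i \<in> {1..n} \<Longrightarrow> fin_perm (w i)"
  shows "hecke_prod (concat (map (\<lambda>i. if i = 1 then [w 1] else [delta_perm n r (i - 1), w i]) [1..<n + 1])) =
    kms_state n r w n"
proof -
  let ?l = "\<lambda>m. concat (map (\<lambda>i. if i = 1 then [w 1] else [delta_perm n r (i - 1), w i]) [1..<m + 1])"
  have "foldl (\<star>) id (?l m) \<star> delta_perm n r m = kms_state n r w m" if "m \<le> n" for m
    using that
  proof (induction m)
    case 0
    show "foldl (\<star>) id (?l 0) \<star> delta_perm n r 0 = kms_state n r w 0"
      using delta_perm_0[OF r] by simp
  next
    case (Suc m)
    have "foldl (\<star>) id (?l m) \<star> delta_perm n r m = kms_state n r w m"
      using Suc.IH Suc.prems by (meson Suc_leD)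
    moreover have "foldl (\<star>) id (?l (Suc m)) = foldl (\<star>) id (?l m) \<star> delta_perm n r m \<star> w (Suc m)"
      using delta_perm_0[OF r] by (cases m) simp_all
    ultimately show "foldl (\<star>) id (?l (Suc m)) \<star> delta_perm n r (Suc m) = kms_state n r w (Suc m)" by simp
  qed
  from this[of n] have "foldl (\<star>) id (?l n) = kms_state n r w n"
    using delta_perm_n[OF r] by simp
  moreover have "hecke_prod (?l n) = foldl (\<star>) id (?l n)"
    by (rule hecke_prod_eq_foldl) (use w fin_perm_delta_perm[OF r] in \<open>auto split: if_splits\<close>)
  ultimately show ?thesis by simp
qed

lemma ext_rank_n_Suc: "j < n \<Longrightarrow> ext_rank r n j = r j j + ext_rank r n (Suc j)"
  by (rule ext_rank_lower_col)

lemma ext_rank_n_tail: "j \<le> n \<Longrightarrow> ext_rank r n j = r j j + (\<Sum>k\<in>{j<..n}. r k k)"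
  by (simp add: ext_rank_def sum.head)

lemma ext_rank_n_antimono:
  assumes "j \<le> k" "k \<le> n" shows "ext_rank r n k \<le> ext_rank r n j"
  using assms by (simp add: ext_rank_def) (rule sum_mono2, auto)

lemma dim_sum_Suc: "dim_sum r (Suc j) = dim_sum r j + r j j"
  by (simp add: dim_sum_def)

text \<open>Otherwise a reduced word of \<open>w\<close> could begin with \<open>k\<close>, which
  inverts two consecutive values of one block. The inversion persists to the end, but no block
  boundary separates these values.\<close>

lemma separated_left_increasing:
  assumes sep: "separated_inversions r (s \<star> w \<star> x)"
    and w: "w permutes {1..m}" and x: "fin_perm x"
    and s: "s (Suc (Suc k)) = Suc (s (Suc k))" "dim_sum r l < s (Suc k)" "s (Suc (Suc k)) \<le> dim_sum r (Suc l)"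
  shows "inv_into UNIV w (Suc k) < inv_into UNIV w (Suc (Suc k))"
proof (rule ccontr)
  let ?y = "inv_into UNIV w" and ?a = "comparator k s" and ?v = "(adj k \<circ> w) \<star> x"
  have fin: "fin_perm w" "fin_perm ?y" using w permutes_inv[OF w] permutes_fin_perm' by blast+
  assume "\<not> ?y (Suc k) < ?y (Suc (Suc k))"
  then have desc: "?y (Suc (Suc k)) < ?y (Suc k)" using fin_perm_adj_neq[OF fin(2), of k] by simp
  have "s \<star> w = ?a \<star> (adj k \<circ> w)"
    by (rule star_left_descent[OF fin(1) desc]) (simp_all add: permutes_inverses[OF w])
  moreover have v: "fin_perm (adj k \<circ> w)" using fin_perm_comp[OF fin_perm_adj fin(1)] .
  ultimately have eq: "s \<star> w \<star> x = ?a \<star> ?v" using x by (simp add: star_assoc)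
  have a: "?a (Suc k) = Suc (s (Suc k))" "?a (Suc (Suc k)) = s (Suc k)"
    using s(1) by (auto simp: comparator_def)
  obtain p q where "p \<noteq> 0" "p < q" "(?a \<star> ?v) p = ?a (Suc k)" "(?a \<star> ?v) q = ?a (Suc (Suc k))"
    using star_inversion[of ?v "Suc k" "Suc (Suc k)" ?a] a fin_perm_star[OF v x] by auto
  then obtain l' where l': "s (Suc k) \<le> dim_sum r l'" "dim_sum r l' < Suc (s (Suc k))"
    using sep a unfolding eq separated_inversions_def by (metis lessI neq0_conv)
  then have "dim_sum r l < dim_sum r l'" "dim_sum r l' < dim_sum r (Suc l)" using s by auto
  then show False using dim_sum_mono[of l' l r] dim_sum_mono[of "Suc l" l' r]
    by (meson leD not_less_eq_eq)
qed

context
  fixes n :: nat and r :: "nat \<Rightarrow> nat \<Rightarrow> nat" and w :: "nat \<Rightarrow> nat \<Rightarrow> nat"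
  assumes r: "rank_ineqs n r" and w: "\<And>i. i \<in> {1..n} \<Longrightarrow> w i permutes {1..r (i - 1) (i - 1) + r i i}"
begin

abbreviation "S \<equiv> kms_state n r w"
abbreviation "N \<equiv> ext_rank r n"
abbreviation "M \<equiv> dim_sum r"

lemma w_Suc: "j < n \<Longrightarrow> w (Suc j) permutes {1..r j j + r (Suc j) (Suc j)}"
  using w[of "Suc j"] by simp

lemma delta_Suc:
  "j < n \<Longrightarrow> delta_perm n r (Suc j) = block_swap (r (Suc j) (Suc j)) (\<Sum>k\<in>{Suc j<..n}. r k k) (r j j)"
  using delta_perm_eq(1)[OF r, of "Suc j"] by simp

text \<open>Beyond the first \<open>r j j\<close> positions the initial sequence is untouched,
  except that \<open>M j\<close> entries have retired behind \<open>N j\<close>. These fresh values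
  exceed all others in play, so \<open>delta_perm\<close> acts by plain composition.\<close>

lemma kms_state_inv:
  assumes "j \<le> n"
  shows "(\<forall>p\<in>{r j j<..N j}. S j p = p + M j) \<and> (\<forall>p\<in>{1..r j j}. S j p \<le> M (Suc j))"
    and "j < n \<Longrightarrow> S (Suc j) = (S j \<star> w (Suc j)) \<circ> delta_perm n r (Suc j)"
proof -
  have step: "S (Suc j) = (S j \<star> w (Suc j)) \<circ> delta_perm n r (Suc j) \<and>
      (\<forall>p\<in>{1..r j j + r (Suc j) (Suc j)}. (S j \<star> w (Suc j)) p \<le> M (Suc (Suc j)))"
    if j: "j < n" and 1: "\<forall>p\<in>{r j j<..N j}. S j p = p + M j" and 2: "\<forall>p\<in>{1..r j j}. S j p \<le> M (Suc j)" for j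
  proof -
    let ?B = "S j \<star> w (Suc j)" and ?X = "\<Sum>k\<in>{Suc j<..n}. r k k"
    have N: "N j = r j j + r (Suc j) (Suc j) + ?X"
      using ext_rank_n_Suc[OF j, of r] ext_rank_n_tail[of "Suc j" n r] j by simp
    have low: "S j p \<le> M (Suc (Suc j))" if "p \<in> {1..r j j + r (Suc j) (Suc j)}" for p
    proof (cases "p \<le> r j j")
      case True
      then show ?thesis using 2 that dim_sum_mono[of "Suc j" "Suc (Suc j)" r] by (meson atLeastAtMost_iff le_SucI le_trans order_refl)
    next
      case False
      then show ?thesis using 1 that N by (simp add: dim_sum_Suc)
    qed
    obtain \<sigma> where \<sigma>: "\<sigma> permutes {1..r j j + r (Suc j) (Suc j)}" "?B = S j \<circ> \<sigma>"
      using star_ex_perm[of "w (Suc j)" 0 _ "S j"] w_Suc[OF j] by auto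
    have low': "?B p \<le> M (Suc (Suc j))" if "p \<in> {1..r j j + r (Suc j) (Suc j)}" for p
      using low[of "\<sigma> p"] \<sigma> permutes_in_image[OF \<sigma>(1), of p] that by simp
    have high: "?B p = p + M j" if "r j j + r (Suc j) (Suc j) < p" "p \<le> N j" for p
    proof -
      have "\<sigma> p = p" using \<sigma>(1) that by (simp add: permutes_def)
      then show ?thesis using 1 that \<sigma>(2) by simp
    qed
    have "?B \<star> delta_perm n r (Suc j) = ?B \<circ> delta_perm n r (Suc j)"
      unfolding delta_Suc[OF j]
    proof (rule star_block_swap)
      fix p q assume pq: "r (Suc j) (Suc j) < p" "p \<le> r (Suc j) (Suc j) + r j j"
        "r (Suc j) (Suc j) + r j j < q" "q \<le> r (Suc j) (Suc j) + r j j + ?X"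
      then have "?B p \<le> M (Suc (Suc j))" "?B q = q + M j" using low'[of p] high[of q] N by auto
      then show "?B p \<le> ?B q" using pq by (simp add: dim_sum_Suc)
    qed
    then show ?thesis using low' by simp
  qed
  have inv: "(\<forall>p\<in>{r j j<..N j}. S j p = p + M j) \<and> (\<forall>p\<in>{1..r j j}. S j p \<le> M (Suc j))"
    if "j \<le> n" for j
    using that
  proof (induction j)
    case 0
    then show ?case by (simp add: dim_sum_def)
  next
    case (Suc j)
    then have j: "j < n" and 1: "\<forall>p\<in>{r j j<..N j}. S j p = p + M j"
      and 2: "\<forall>p\<in>{1..r j j}. S j p \<le> M (Suc j)" by auto
    note st = step[OF j 1 2]
    let ?B = "S j \<star> w (Suc j)" and ?X = "\<Sum>k\<in>{Suc j<..n}. r k k"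
    have N: "N (Suc j) = r (Suc j) (Suc j) + ?X" "N j = r j j + N (Suc j)"
      using ext_rank_n_Suc[OF j, of r] ext_rank_n_tail[of "Suc j" n r] j by auto
    have "S (Suc j) p = p + M (Suc j)" if p: "p \<in> {r (Suc j) (Suc j)<..N (Suc j)}" for p
    proof -
      have "S (Suc j) p = ?B (p + r j j)"
        using st p N by (simp add: delta_Suc[OF j] block_swap_def)
      also have "\<dots> = S j (p + r j j)"
        using star_outside[of "w (Suc j)" 0 _ "p + r j j" "S j"] w_Suc[OF j] p by simp
      also have "\<dots> = p + r j j + M j" using 1 p N by simp
      finally show ?thesis by (simp add: dim_sum_Suc)
    qed
    moreover have "S (Suc j) p \<le> M (Suc (Suc j))" if p: "p \<in> {1..r (Suc j) (Suc j)}" for p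
    proof -
      have "S (Suc j) p = ?B p" using st p by (simp add: delta_Suc[OF j] block_swap_def)
      then show ?thesis using st p by simp
    qed
    ultimately show ?case by blast
  qed
  show "(\<forall>p\<in>{r j j<..N j}. S j p = p + M j) \<and> (\<forall>p\<in>{1..r j j}. S j p \<le> M (Suc j))"
    by (rule inv[OF assms])
  show "S (Suc j) = (S j \<star> w (Suc j)) \<circ> delta_perm n r (Suc j)" if "j < n"
    using step[OF that] inv[OF assms] by blast
qed

lemma kms_state_later:
  assumes "j \<le> k" "k \<le> n" shows "\<exists>v. v permutes {1..N j} \<and> S k = S j \<star> v"
  using assms
proof (induction k rule: dec_induct)
  case base
  show "\<exists>v. v permutes {1..N j} \<and> S j = S j \<star> v" by (rule exI[of _ id]) (simp add: permutes_id)
next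
  case (step k)
  then obtain v where v: "v permutes {1..N j}" "S k = S j \<star> v" by (meson Suc_leD)
  have k: "k < n" "N k \<le> N j" using step ext_rank_n_antimono[of j k n r] by auto
  have Nk: "N k = r k k + r (Suc k) (Suc k) + (\<Sum>k\<in>{Suc k<..n}. r k k)"
    using ext_rank_n_Suc[OF k(1), of r] ext_rank_n_tail[of "Suc k" n r] k by simp
  have 1: "w (Suc k) permutes {1..N j}"
    using w_Suc[OF k(1)] by (rule permutes_mono) (use k Nk in simp)
  have 2: "delta_perm n r (Suc k) permutes {1..N j}"
    unfolding delta_Suc[OF k(1)] using block_swap_permutes by (rule permutes_subset) (use k Nk in auto)
  note fin = permutes_fin_perm'[OF v(1)] permutes_fin_perm'[OF 1] permutes_fin_perm'[OF 2]
  have "S (Suc k) = S j \<star> (v \<star> w (Suc k) \<star> delta_perm n r (Suc k))"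
    using v(2) fin by (simp add: star_assoc fin_perm_star)
  moreover have "(v \<star> w (Suc k) \<star> delta_perm n r (Suc k)) permutes {1..N j}"
    using star_permutes[of _ 0 "N j"] v 1 2 by simp
  ultimately show "\<exists>v. v permutes {1..N j} \<and> S (Suc k) = S j \<star> v" by blast
qed

lemma kms_state_rest:
  assumes "j < n" obtains x where "fin_perm x" "S n = S j \<star> w (Suc j) \<star> x"
proof -
  obtain v where v: "v permutes {1..N (Suc j)}" "S n = S (Suc j) \<star> v"
    using kms_state_later[of "Suc j" n] assms by auto
  have "fin_perm v" "fin_perm (delta_perm n r (Suc j))"
    using permutes_fin_perm'[OF v(1)] fin_perm_delta_perm[OF r, of "Suc j"] assms by auto
  then show ?thesis using v(2) that[of "delta_perm n r (Suc j) \<star> v"] by (simp add: star_assoc fin_perm_star)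
qed

lemma kms_state_final:
  assumes "j \<le> n" "N j < p" shows "S n p = S j p"
proof -
  obtain v where "v permutes {1..N j}" "S n = S j \<star> v" using kms_state_later[OF assms(1) order_refl] by blast
  then show ?thesis using star_outside[of v 0 "N j" p "S j"] assms(2) by simp
qed

text \<open>
  The number of entries of the blocks \<open>0, \<dots>, j\<close> in the first positions of the product is a
  function of \<open>w (j + 1)\<close> alone.
\<close>

lemma kms_block_count:
  assumes j: "j < n"
  shows "card {p \<in> {1..N (Suc j)}. S n p \<le> M (Suc j)} = card {p \<in> {1..r (Suc j) (Suc j)}. w (Suc j) p \<le> r j j}"
proof -
  let ?B = "S j \<star> w (Suc j)"
  obtain v where v: "v permutes {1..N (Suc j)}" "S n = S (Suc j) \<star> v" using kms_state_later[of "Suc j" n] j by auto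
  obtain \<sigma> where \<sigma>: "\<sigma> permutes {1..N (Suc j)}" "S n = S (Suc j) \<circ> \<sigma>"
    using star_ex_perm[of v 0 "N (Suc j)" "S (Suc j)"] v by auto
  have "card {p \<in> {1..N (Suc j)}. S n p \<le> M (Suc j)} = card {p \<in> {1..N (Suc j)}. S (Suc j) p \<le> M (Suc j)}"
    using card_comp_permutes[OF \<sigma>(1), of "\<lambda>p. S (Suc j) p \<le> M (Suc j)"] \<sigma>(2) by simp
  also have "{p \<in> {1..N (Suc j)}. S (Suc j) p \<le> M (Suc j)} = {p \<in> {1..r (Suc j) (Suc j)}. w (Suc j) p \<le> r j j}"
  proof -
    have N: "r (Suc j) (Suc j) \<le> N (Suc j)" "N j = r j j + N (Suc j)"
      using ext_rank_n_tail[of "Suc j" n r] ext_rank_n_Suc[OF j, of r] j by auto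
    have inv: "\<And>p. p \<in> {r j j<..N j} \<Longrightarrow> S j p = p + M j" "\<And>p. p \<in> {1..r j j} \<Longrightarrow> S j p \<le> M (Suc j)"
      and inv': "\<And>p. p \<in> {r (Suc j) (Suc j)<..N (Suc j)} \<Longrightarrow> S (Suc j) p = p + M (Suc j)"
      using kms_state_inv(1)[of j] kms_state_inv(1)[of "Suc j"] j by auto
    have low: "S (Suc j) p \<le> M (Suc j) \<longleftrightarrow> w (Suc j) p \<le> r j j" if p: "p \<in> {1..r (Suc j) (Suc j)}" for p
    proof -
      \<comment> \<open>Thresholding commutes with comparators. Before this round the threshold
        \<open>M (Suc j)\<close> cuts the positions exactly at \<open>r j j\<close>, so the history
        \<open>S j\<close> can be replaced by the identity.\<close>
      let ?\<chi> = "\<lambda>x. M (Suc j) < x" and ?m = "r j j + r (Suc j) (Suc j)"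
      have "((?\<chi> \<circ> S j) \<star> w (Suc j)) p = (r j j < (id \<star> w (Suc j)) p)"
      proof (rule star_mono_on[OF w_Suc[OF j]])
        show "mono_on (id ` {1..?m}) (\<lambda>q. r j j < q)" by (auto simp: mono_on_def)
        show "(?\<chi> \<circ> S j) q = (r j j < id q)" if "q \<in> {1..?m}" for q
          using inv(1)[of q] inv(2)[of q] that N by (cases "q \<le> r j j") (auto simp: dim_sum_Suc)
      qed (use p in simp)
      moreover have "(?\<chi> \<circ> S j) \<star> w (Suc j) = ?\<chi> \<circ> ?B"
        using permutes_fin_perm'[OF w_Suc[OF j]] by (rule star_mono) (auto simp: mono_def)
      moreover have "S (Suc j) p = ?B p"
        using kms_state_inv(2)[of j] j p by (simp add: delta_Suc[OF j] block_swap_def)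
      ultimately show ?thesis
        using star_id_left[OF permutes_fin_perm'[OF w_Suc[OF j]]] by (simp add: not_less[symmetric])
    qed
    have "\<not> S (Suc j) p \<le> M (Suc j)" if "p \<in> {r (Suc j) (Suc j)<..N (Suc j)}" for p
      using inv'[OF that] that by auto
    then have "p \<in> {1..N (Suc j)} \<and> S (Suc j) p \<le> M (Suc j) \<longleftrightarrow>
        p \<in> {1..r (Suc j) (Suc j)} \<and> w (Suc j) p \<le> r j j" for p
      using low[of p] N(1) by (cases "p \<le> r (Suc j) (Suc j)") (auto simp del: kms_state.simps)
    then show ?thesis by blast
  qed
  finally show ?thesis .
qed

context
  assumes z: "S n = zelevinsky n r"
begin

text \<open>\<open>delta_perm\<close> carries the last \<open>r j j\<close> of the positions on
  which \<open>w (Suc j)\<close> acts to places that are never touched again and where z(r)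
  increases.\<close>

lemma kms_right_increasing:
  assumes j: "j < n" and k: "r (Suc j) (Suc j) \<le> k" "k + 2 \<le> r j j + r (Suc j) (Suc j)"
  shows "w (Suc j) (Suc k) < w (Suc j) (Suc (Suc k))"
proof (rule ccontr)
  let ?B = "S j \<star> w (Suc j)" and ?e = "r (Suc j) (Suc j)"
  have fin: "fin_perm (w (Suc j))" using permutes_fin_perm'[OF w_Suc[OF j]] .
  assume "\<not> w (Suc j) (Suc k) < w (Suc j) (Suc (Suc k))"
  then have "?B (Suc (Suc k)) \<le> ?B (Suc k)"
    using fin_perm_adj_neq[OF fin, of k] by (intro star_descent[OF fin]) simp
  moreover have *: "?B (?e + i) = S n (N (Suc j) + i)" if "0 < i" "i \<le> r j j" for i
  proof -
    have "S n (N (Suc j) + i) = S (Suc j) (N (Suc j) + i)" by (rule kms_state_final) (use j that in auto)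
    also have "\<dots> = ?B (?e + i)"
      using kms_state_inv(2)[of j] j that ext_rank_n_tail[of "Suc j" n r]
      by (simp add: delta_Suc[OF j] block_swap_def)
    finally show ?thesis by simp
  qed
  moreover have "S n (N (Suc j) + (Suc k - ?e)) < S n (N (Suc j) + (Suc (Suc k) - ?e))"
    unfolding z
    by (rule strict_mono_onD[OF zelevinsky_properties(3)[OF r j]])
      (use k ext_rank_n_Suc[OF j, of r] in auto)
  ultimately show False using *[of "Suc k - ?e"] *[of "Suc (Suc k) - ?e"] k by simp
qed

text \<open>At the start of the round the positions beyond \<open>r j j\<close> hold consecutive
  values of block \<open>Suc j\<close>, so \<open>separated_left_increasing\<close> applies.\<close>

lemma kms_left_increasing:
  assumes j: "j < n" and k: "r j j \<le> k" "k + 2 \<le> r j j + r (Suc j) (Suc j)"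
  shows "inv_into UNIV (w (Suc j)) (Suc k) < inv_into UNIV (w (Suc j)) (Suc (Suc k))"
proof -
  obtain x where x: "fin_perm x" "S n = S j \<star> w (Suc j) \<star> x" by (rule kms_state_rest[OF j])
  have "N j = r j j + N (Suc j)" "r (Suc j) (Suc j) \<le> N (Suc j)"
    using ext_rank_n_tail[of "Suc j" n r] ext_rank_n_Suc[OF j, of r] j by auto
  then have Sk: "S j (Suc k) = Suc k + M j" "S j (Suc (Suc k)) = Suc (Suc k) + M j"
    using kms_state_inv(1)[of j] j k by auto
  have "M (Suc j) < S j (Suc k)" "S j (Suc (Suc k)) \<le> M (Suc (Suc j))" "S j (Suc (Suc k)) = Suc (S j (Suc k))"
    unfolding Sk dim_sum_Suc using k by linarith+
  then show ?thesis
    using separated_left_increasing[OF _ w_Suc[OF j] x(1), of r "S j" k "Suc j"]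
      zelevinsky_properties(2)[OF r] z x(2) by simp
qed

text \<open>In the first round the positions up to \<open>r 0 0\<close> hold consecutive values of a
  block as well; this forces \<open>v 0 = id\<close>.\<close>

lemma kms_left_increasing_first:
  assumes n: "0 < n" and k: "k + 2 \<le> r 0 0"
  shows "inv_into UNIV (w 1) (Suc k) < inv_into UNIV (w 1) (Suc (Suc k))"
proof -
  obtain x where x: "fin_perm x" "S n = S 0 \<star> w (Suc 0) \<star> x" by (rule kms_state_rest[OF n])
  have "inv_into UNIV (w (Suc 0)) (Suc k) < inv_into UNIV (w (Suc 0)) (Suc (Suc k))"
    using separated_left_increasing[OF _ w_Suc[OF n] x(1), of r "S 0" k 0]
      zelevinsky_properties(2)[OF r] z x(2) k by (simp add: dim_sum_def)
  then show ?thesis by simp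
qed

text \<open>No proper block swap follows \<open>w n\<close>, so its first positions are already
  those of z(r), where z(r) increases; this forces \<open>u n = id\<close>.\<close>

lemma kms_right_increasing_last:
  assumes n: "0 < n" and k: "k + 2 \<le> r n n"
  shows "w n (Suc k) < w n (Suc (Suc k))"
proof (rule ccontr)
  obtain j where j: "n = Suc j" "j < n" using n by (cases n) auto
  have fin: "fin_perm (w n)" using permutes_fin_perm'[OF w_Suc[OF j(2)]] j by simp
  assume "\<not> w n (Suc k) < w n (Suc (Suc k))"
  then have "(S j \<star> w n) (Suc (Suc k)) \<le> (S j \<star> w n) (Suc k)"
    using fin_perm_adj_neq[OF fin, of k] by (intro star_descent[OF fin]) simp
  moreover have "S n = S j \<star> w n" using delta_perm_n[OF r] j by simp
  moreover have "zelevinsky n r (Suc k) < zelevinsky n r (Suc (Suc k))"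
    by (rule strict_mono_onD[OF zelevinsky_properties(4)[OF r]]) (use k in auto)
  ultimately show False using z by simp
qed

end

end

section \<open>The factors that z(r) itself provides\<close>

definition upper_column :: "(nat \<Rightarrow> nat \<Rightarrow> nat) \<Rightarrow> nat \<Rightarrow> nat \<Rightarrow> nat" where
  "upper_column r j = foldl (\<star>) id (W_column r (Suc j) j)"

text \<open>The part of column \<open>j\<close> that precedes \<open>delta_perm\<close>; with these
  factors z(r) is itself a product of KMS shape.\<close>

definition column_factor :: "(nat \<Rightarrow> nat \<Rightarrow> nat) \<Rightarrow> nat \<Rightarrow> nat \<Rightarrow> nat" where
  "column_factor r j = foldl (\<star>) id (W_column r j j)"

lemma foldl_star_permutes:
  assumes "\<And>u. u \<in> set us \<Longrightarrow> u permutes {1..m}" "v permutes {1..m}"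
  shows "foldl (\<star>) v us permutes {1..m}"
  using assms
proof (induction us arbitrary: v)
  case (Cons u us)
  then show ?case using star_permutes[of v 0 m u] by simp
qed simp

lemma column_factor_Suc: "column_factor r (Suc j) = upper_column r j \<star> W_perm r j (Suc j)"
  by (simp add: column_factor_def upper_column_def)

lemma card_block_swap_le:
  assumes "\<rho> \<le> a" "\<rho> \<le> b"
  shows "card {p \<in> {1..b}. block_swap \<rho> (b - \<rho>) (a - \<rho>) p \<le> a} = \<rho>"
proof -
  have "{p \<in> {1..b}. block_swap \<rho> (b - \<rho>) (a - \<rho>) p \<le> a} = {1..\<rho>}"
  proof -
    have "block_swap \<rho> (b - \<rho>) (a - \<rho>) p = (if p \<le> \<rho> then p else p + (a - \<rho>))" if "p \<in> {1..b}" for p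
      using that assms by (simp add: block_swap_def)
    then have "p \<in> {1..b} \<and> block_swap \<rho> (b - \<rho>) (a - \<rho>) p \<le> a \<longleftrightarrow> p \<in> {1..\<rho>}" for p
      using assms by (cases "p \<le> \<rho>") auto
    then show ?thesis by blast
  qed
  then show ?thesis by simp
qed

context
  fixes n :: nat and r :: "nat \<Rightarrow> nat \<Rightarrow> nat"
  assumes r: "rank_ineqs n r"
begin

lemma W_perm_diag:
  assumes "j < n"
  shows "W_perm r j (Suc j) = block_swap (r j (Suc j)) (r (Suc j) (Suc j) - r j (Suc j)) (r j j - r j (Suc j))"
  using W_perm_eq[OF ext_rank_mono_row[OF r assms, of "Suc j"]] assms by (simp add: ext_rank_upper)

lemma rank_diag_le:
  assumes "j < n" shows "r j (Suc j) \<le> r j j" "r j (Suc j) \<le> r (Suc j) (Suc j)"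
  using r assms by (auto simp: rank_ineqs_def)

lemma W_perm_diag_permutes:
  assumes "j < n" shows "W_perm r j (Suc j) permutes {1..r j j + r (Suc j) (Suc j)}"
  unfolding W_perm_diag[OF assms] using block_swap_permutes
  by (rule permutes_subset) (use rank_diag_le[OF assms] in auto)

text \<open>The first bound rests on Frobenius' inequality, the second on monotonicity of the ranks;
  the second places these factors in the symmetric group that belongs to r^(1).\<close>

lemma W_perm_upper_permutes:
  assumes "i < j" "j < n"
  shows "W_perm r i (Suc j) permutes {1..r j j}"
    and "W_perm r i (Suc j) permutes {1..r (j - 1) j + r j (Suc j)}"
proof -
  let ?R = "ext_rank r"
  have le: "?R i (Suc j) \<le> ?R (Suc i) (Suc j)" "?R i (Suc j) \<le> ?R i j" "?R (Suc i) j \<le> ?R j j"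
    "?R (Suc i) (Suc j) + ?R i j \<le> ?R (Suc i) j + ?R i (Suc j)"
    using assms ext_rank_mono_row[OF r, of i "Suc j"] ext_rank_mono_col[OF r, of i j]
      ext_rank_rows_mono[OF r, of "Suc i" j j] ext_rank_frobenius[OF r, of i j] by auto
  have le': "?R (Suc i) (Suc j) \<le> ?R j (Suc j)" "?R i j \<le> ?R (j - 1) j"
    using assms ext_rank_rows_mono[OF r, of "Suc i" j "Suc j"] ext_rank_rows_mono[OF r, of i "j - 1" j] by auto
  have W: "W_perm r i (Suc j) permutes
      {Suc (?R i (Suc j))..?R i (Suc j) + (?R (Suc i) (Suc j) - ?R i (Suc j)) + (?R i j - ?R i (Suc j))}"
    unfolding W_perm_eq[OF le(1)] using block_swap_permutes by simp
  show "W_perm r i (Suc j) permutes {1..r j j}"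
    by (rule permutes_subset[OF W]) (use le in \<open>auto simp: ext_rank_upper\<close>)
  show "W_perm r i (Suc j) permutes {1..r (j - 1) j + r j (Suc j)}"
    by (rule permutes_subset[OF W]) (use le le' in \<open>auto simp: ext_rank_upper\<close>)
qed

lemma upper_column_permutes:
  assumes "j < n"
  shows "upper_column r j permutes {1..r j j}" "upper_column r j permutes {1..r (j - 1) j + r j (Suc j)}"
  unfolding upper_column_def
  by (rule foldl_star_permutes; use W_perm_upper_permutes assms in \<open>auto simp: permutes_id\<close>)+

lemma column_factor_permutes:
  assumes "i \<in> {1..n}" shows "column_factor r i permutes {1..r (i - 1) (i - 1) + r i i}"
proof -
  obtain j where j: "i = Suc j" "j < n" using assms by (cases i) auto
  have "upper_column r j permutes {1..r j j + r (Suc j) (Suc j)}"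
    using upper_column_permutes(1)[OF j(2)] by (rule permutes_mono) simp
  then show ?thesis
    using star_permutes[of _ 0] W_perm_diag_permutes[OF j(2)] by (simp add: j column_factor_Suc)
qed

text \<open>Every column splits at the diagonal into \<open>column_factor\<close> and
  \<open>delta_perm\<close>. This is the reference instance with which all other KMS-factorizations
  are compared.\<close>

lemma kms_state_column_factor: "kms_state n r (column_factor r) n = zelevinsky n r"
proof -
  have "foldl (\<star>) id (W_columns n r m) = kms_state n r (column_factor r) m" if "m \<le> n" for m
    using that
  proof (induction m)
    case 0
    show "foldl (\<star>) id (W_columns n r 0) = kms_state n r (column_factor r) 0" by simp
  next
    case (Suc m)
    have IH: "foldl (\<star>) id (W_columns n r m) = kms_state n r (column_factor r) m" (is "_ = ?T")
      using Suc.IH Suc.prems by (meson Suc_leD)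
    have m: "m < n" using Suc.prems by simp
    have "[0..<n] = [0..<Suc m] @ [Suc m..<n]" using Suc.prems upt_add_eq_append[of 0 "Suc m" "n - Suc m"] by simp
    then have col: "W_column r (Suc m) n = W_column r (Suc m) (Suc m) @ map (\<lambda>i. W_perm r i (Suc m)) [Suc m..<n]"
      by simp
    have 1: "foldl (\<star>) ?T (W_column r (Suc m) (Suc m)) = ?T \<star> column_factor r (Suc m)"
      unfolding column_factor_def
      by (rule foldl_star_id) (use m fin_perm_W_perm[OF r] in auto)
    have 2: "foldl (\<star>) id (W_columns n r (Suc m)) = foldl (\<star>) ?T (W_column r (Suc m) n)"
      unfolding IH[symmetric] by simp
    have 3: "foldl (\<star>) s (map (\<lambda>i. W_perm r i (Suc m)) [Suc m..<n]) = s \<star> delta_perm n r (Suc m)" for s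
      by (rule delta_perm_eq(2)[OF r]) (use m in auto)
    show "foldl (\<star>) id (W_columns n r (Suc m)) = kms_state n r (column_factor r) (Suc m)"
      unfolding 2 col foldl_append 1 3 by simp
  qed
  then show ?thesis using zelevinsky_properties(1)[OF r] by simp
qed

text \<open>\<open>upper_column r j\<close> permutes the values up to \<open>r j j\<close> among
  themselves, so thresholding at \<open>r j j\<close> hides it and the diagonal block swap
  decides.\<close>

lemma column_factor_count:
  assumes "j < n"
  shows "card {p \<in> {1..r (Suc j) (Suc j)}. column_factor r (Suc j) p \<le> r j j} = r j (Suc j)"
proof -
  let ?\<chi> = "\<lambda>x. r j j < x" and ?W = "W_perm r j (Suc j)" and ?y = "upper_column r j"
  have W: "fin_perm ?W" using W_perm_diag[OF assms] by simp
  have "?\<chi> (?y p) \<longleftrightarrow> ?\<chi> p" for p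
    using permutes_in_image[OF upper_column_permutes(1)[OF assms], of p] upper_column_permutes(1)[OF assms]
    by (cases "p \<in> {1..r j j}") (simp_all add: permutes_def)
  then have eq: "?\<chi> \<circ> ?y = ?\<chi> \<circ> id" by (simp only: fun_eq_iff comp_apply id_apply) simp
  have m: "mono ?\<chi>" by (rule monoI) auto
  have "?\<chi> \<circ> (?y \<star> ?W) = (?\<chi> \<circ> ?y) \<star> ?W" by (rule star_mono[OF W m, symmetric])
  also have "\<dots> = ?\<chi> \<circ> (id \<star> ?W)" unfolding eq by (rule star_mono[OF W m])
  finally have "?\<chi> \<circ> (?y \<star> ?W) = ?\<chi> \<circ> (id \<star> ?W)" .
  from fun_cong[OF this] have "column_factor r (Suc j) p \<le> r j j \<longleftrightarrow> ?W p \<le> r j j" for p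
    unfolding column_factor_Suc star_id_left[OF W] by (simp add: not_less[symmetric])
  then show ?thesis
    using card_block_swap_le[OF rank_diag_le[OF assms]] unfolding W_perm_diag[OF assms] by simp
qed

end

section \<open>Assembling the reduced factorizations of (a)\<close>

lemma permutes_descent_bound:
  assumes "u permutes {1..m}" "u (Suc (Suc k)) < u (Suc k)" shows "k + 2 \<le> m"
proof -
  have fin: "fin_perm u" using assms(1) by (rule permutes_fin_perm')
  then obtain ks where "reduced_word (u \<circ> adj k) ks" using reduced_word_ex fin_perm_comp_adj by blast
  then have "reduced_word u (ks @ [k])" using reduced_word_snoc[OF fin] assms(2) by blast
  then show ?thesis using reduced_word_letters[of u "ks @ [k]" 0 m] assms(1) by simp
qed

lemma right_factor_id:
  assumes u: "u permutes {1..b}" and w: "w = v \<star> u"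
    and inc: "\<And>k. k + 2 \<le> b \<Longrightarrow> w (Suc k) < w (Suc (Suc k))"
  shows "u = id"
proof (rule fin_perm_no_descent)
  show fin: "fin_perm u" using u by (rule permutes_fin_perm')
  fix k show "u (Suc k) < u (Suc (Suc k))"
  proof (rule ccontr)
    assume "\<not> ?thesis"
    then have desc: "u (Suc (Suc k)) < u (Suc k)" using fin_perm_adj_neq[OF fin, of k] by simp
    then show False
      using inc[OF permutes_descent_bound[OF u desc]] star_descent[OF fin desc, of v] w by simp
  qed
qed

text \<open>A descent of the inverse of \<open>v\<close> lets \<open>v\<close> begin with a
  comparator at \<open>k\<close>, and the inversion of two values that it creates persists in
  \<open>w\<close>.\<close>

lemma left_factor_id:
  assumes v: "v permutes {1..a}" and x: "fin_perm x" and w: "w = v \<star> x" "w permutes T"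
    and inc: "\<And>k. k + 2 \<le> a \<Longrightarrow> inv_into UNIV w (Suc k) < inv_into UNIV w (Suc (Suc k))"
  shows "v = id"
proof -
  let ?y = "inv_into UNIV v"
  note yperm = permutes_inv[OF v]
  have fin: "fin_perm v" "fin_perm ?y" using v yperm permutes_fin_perm' by blast+
  have "?y = id"
  proof (rule fin_perm_no_descent[OF fin(2)])
    fix k show "?y (Suc k) < ?y (Suc (Suc k))"
    proof (rule ccontr)
      assume "\<not> ?thesis"
      then have desc: "?y (Suc (Suc k)) < ?y (Suc k)" using fin_perm_adj_neq[OF fin(2), of k] by simp
      have "id \<star> v = comparator k id \<star> (adj k \<circ> v)"
        by (rule star_left_descent[OF fin(1) desc]) (simp_all add: permutes_inverses[OF v])
      then have "v \<star> x = comparator k id \<star> (adj k \<circ> v) \<star> x" unfolding star_id_left[OF fin(1)] by (rule arg_cong)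
      then have eq: "w = comparator k id \<star> ((adj k \<circ> v) \<star> x)"
        unfolding w(1) star_assoc[OF fin_perm_comp[OF fin_perm_adj fin(1)] x] .
      obtain p q where pq: "p < q" "w p = Suc (Suc k)" "w q = Suc k"
        using star_inversion[of "(adj k \<circ> v) \<star> x" "Suc k" "Suc (Suc k)" "comparator k id"]
          fin_perm_star[OF fin_perm_comp[OF fin_perm_adj fin(1)] x] unfolding eq
        by (auto simp: comparator_def)
      then have "inv_into UNIV w (Suc (Suc k)) = p" "inv_into UNIV w (Suc k) = q"
        using permutes_inverses(2)[OF w(2)] by metis+
      then show False using inc[OF permutes_descent_bound[OF yperm desc]] pq(1) by simp
    qed
  qed
  then show ?thesis using permutes_inverses(1)[OF v] by (auto simp: fun_eq_iff)
qed

lemma hecke_prod_three: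
  "fin_perm u \<Longrightarrow> fin_perm v \<Longrightarrow> fin_perm w \<Longrightarrow> hecke_prod [u, v, w] = u \<star> v \<star> w"
  by (subst hecke_prod_eq_foldl) (auto simp: star_id_left)

proposition KMS_factorization_factors:
  assumes r: "rank_ineqs n r" and n: "1 \<le> n" and kms: "KMS_factorization n r w"
  shows "\<exists>u v. v 0 = id \<and> u n = id \<and>
    (\<forall>i\<in>{1..n}. v (i - 1) permutes {1..r (i - 1) (i - 1)} \<and> u i permutes {1..r i i} \<and>
      reduced_factorization (w i) [v (i - 1), W_perm r (i - 1) i, u i])"
proof -
  have w: "\<And>i. i \<in> {1..n} \<Longrightarrow> w i permutes {1..r (i - 1) (i - 1) + r i i}"
    using kms by (simp add: KMS_factorization_def)
  have z: "kms_state n r w n = zelevinsky n r"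
    using kms hecke_prod_kms_state[OF r, of w] w permutes_fin_perm' unfolding KMS_factorization_def by metis
  have "\<exists>v u. v permutes {1..r j j} \<and> u permutes {1..r (Suc j) (Suc j)} \<and>
      w (Suc j) = v \<star> W_perm r j (Suc j) \<star> u \<and>
      perm_length (w (Suc j)) = perm_length v + perm_length (W_perm r j (Suc j)) + perm_length u"
    if j: "j < n" for j
  proof -
    have wj: "w (Suc j) permutes {1..r j j + r (Suc j) (Suc j)}" using w[of "Suc j"] j by simp
    \<comment> \<open>By \<open>kms_block_count\<close> this number depends on the final product
      alone, so it agrees with that of the reference factors.\<close>
    have "card {p \<in> {1..r (Suc j) (Suc j)}. w (Suc j) p \<le> r j j} = r j (Suc j)"
      using kms_block_count[OF r w j] kms_block_count[OF r column_factor_permutes[OF r] j]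
        z kms_state_column_factor[OF r] column_factor_count[OF r j] by simp
    then show ?thesis
      using two_block_factorization[OF wj kms_right_increasing[OF r w z j] kms_left_increasing[OF r w z j]]
      unfolding W_perm_diag[OF r j] by simp
  qed
  then obtain v' u' where vu: "\<And>j. j < n \<Longrightarrow> v' j permutes {1..r j j} \<and> u' j permutes {1..r (Suc j) (Suc j)} \<and>
      w (Suc j) = v' j \<star> W_perm r j (Suc j) \<star> u' j \<and>
      perm_length (w (Suc j)) = perm_length (v' j) + perm_length (W_perm r j (Suc j)) + perm_length (u' j)"
    by metis
  let ?u = "\<lambda>i. u' (i - 1)"
  have fin: "fin_perm (v' j)" "fin_perm (u' j)" "fin_perm (W_perm r j (Suc j))" if "j < n" for j
    using vu[OF that] permutes_fin_perm' W_perm_diag[OF r that] by auto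
  have "v' 0 = id"
  proof (rule left_factor_id)
    show "v' 0 permutes {1..r 0 0}" using vu[of 0] n by simp
    show "fin_perm (W_perm r 0 1 \<star> u' 0)" using fin[of 0] n fin_perm_star by simp
    show "w 1 = v' 0 \<star> (W_perm r 0 1 \<star> u' 0)" using vu[of 0] fin[of 0] n by (simp add: star_assoc)
    show "w 1 permutes {1..r 0 0 + r 1 1}" using w[of 1] n by simp
    show "inv_into UNIV (w 1) (Suc k) < inv_into UNIV (w 1) (Suc (Suc k))" if "k + 2 \<le> r 0 0" for k
      using kms_left_increasing_first[OF r w z _ that] n by simp
  qed
  moreover have "u' (n - 1) = id"
  proof (rule right_factor_id)
    show "u' (n - 1) permutes {1..r n n}" using vu[of "n - 1"] n by simp
    show "w n = v' (n - 1) \<star> W_perm r (n - 1) n \<star> u' (n - 1)" using vu[of "n - 1"] n by simp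
    show "w n (Suc k) < w n (Suc (Suc k))" if "k + 2 \<le> r n n" for k
      using kms_right_increasing_last[OF r w z _ that] n by simp
  qed
  moreover have "v' (i - 1) permutes {1..r (i - 1) (i - 1)} \<and> ?u i permutes {1..r i i} \<and>
      reduced_factorization (w i) [v' (i - 1), W_perm r (i - 1) i, ?u i]" if i: "i \<in> {1..n}" for i
  proof -
    obtain j where j: "i = Suc j" "j < n" using i by (cases i) auto
    note * = vu[OF j(2)]
    then have 1: "w (Suc j) = v' j \<star> W_perm r j (Suc j) \<star> u' j"
      and 2: "perm_length (w (Suc j)) = perm_length (v' j) + perm_length (W_perm r j (Suc j)) + perm_length (u' j)"
      by blast+
    have "reduced_factorization (w (Suc j)) [v' j, W_perm r j (Suc j), u' j]"
      unfolding reduced_factorization_def hecke_prod_three[OF fin(1)[OF j(2)] fin(3)[OF j(2)] fin(2)[OF j(2)]]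
      by (rule conjI[OF 1]) (simp only: 2 list.map sum_list.Cons sum_list.Nil add_0_right add.assoc)
    then show ?thesis using * by (simp add: j)
  qed
  ultimately show ?thesis by (intro exI[of _ ?u] exI[of _ v']) blast
qed

section \<open>Queues of labels\<close>

text \<open>
  The label \<open>l * B + p\<close> stands for the \<open>p\<close>-th entry of round \<open>l\<close>, where \<open>B\<close> exceeds all queue
  sizes. In round \<open>j + 1\<close> the first \<open>k j\<close> labels are kept and all others are replaced.
\<close>

primrec label_state :: "nat \<Rightarrow> (nat \<Rightarrow> nat) \<Rightarrow> (nat \<Rightarrow> nat \<Rightarrow> nat) \<Rightarrow> nat \<Rightarrow> nat \<Rightarrow> nat" where
  "label_state B k x 0 = id"
| "label_state B k x (Suc j) = (\<lambda>p. if p \<le> k j then label_state B k x j p else Suc j * B + p) \<star> x (Suc j)"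

text \<open>What waits behind the queue of round \<open>j\<close>: each later round \<open>l\<close>
  draws \<open>E l - k (l - 1)\<close> new entries from it and lets \<open>g (l - 1)\<close> pass
  without entering a queue.\<close>

definition tail_size :: "nat \<Rightarrow> (nat \<Rightarrow> nat) \<Rightarrow> (nat \<Rightarrow> nat) \<Rightarrow> (nat \<Rightarrow> nat) \<Rightarrow> nat \<Rightarrow> nat" where
  "tail_size n E k g j = (\<Sum>l\<in>{j<..n}. E l - k (l - 1) + g (l - 1))"

text \<open>
  The queue of round \<open>j\<close> has \<open>E j\<close> entries, of which the first \<open>k j\<close> are kept. The others leave
  in round \<open>j + 1\<close>, together with \<open>g j\<close> of the entries that wait behind the new ones. The two
  products of (b) differ only in \<open>E\<close> and \<open>g\<close>.
\<close>

primrec queue_state :: "nat \<Rightarrow> (nat \<Rightarrow> nat) \<Rightarrow> (nat \<Rightarrow> nat) \<Rightarrow> (nat \<Rightarrow> nat) \<Rightarrow> (nat \<Rightarrow> nat \<Rightarrow> nat) \<Rightarrow> nat \<Rightarrow> nat \<Rightarrow> nat" where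
  "queue_state n E k g x 0 = id"
| "queue_state n E k g x (Suc j) = queue_state n E k g x j \<star> block_swap (k j) (E (Suc j) - k j) (E j - k j) \<star>
    block_swap (E (Suc j)) (tail_size n E k g (Suc j)) (E j - k j + g j) \<star> x (Suc j)"

lemma block_swap_above: "a + x + y < p \<Longrightarrow> block_swap a x y p = p"
  by (auto simp: block_swap_def)

lemma block_swap_second: "a + x < p \<Longrightarrow> p \<le> a + x + y \<Longrightarrow> block_swap a x y p = p - x"
  by (auto simp: block_swap_def)

context
  fixes n B :: nat and E k g :: "nat \<Rightarrow> nat"
begin

text \<open>The value 0 beyond \<open>n\<close> makes the last queue leave like any other, to the
  positions from 1 on.\<close>

definition "queue_total j = (if j \<le> n then E j + tail_size n E k g j else 0)"

primrec queue_shift where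
  "queue_shift 0 = 0"
| "queue_shift (Suc j) = queue_shift j + (E j - k j + g j)"

text \<open>\<open>queue_shift j\<close> counts the entries that have left before. An entry new in
  round \<open>Suc j\<close> has also passed the \<open>E j - k j\<close> entries about to leave, so
  at position \<open>p\<close> its value is \<open>p + label_offset (Suc j)\<close>.\<close>

definition "label_offset l = (case l of 0 \<Rightarrow> 0 | Suc j \<Rightarrow> queue_shift j + (E j - k j))"
definition "label_lower l = (case l of 0 \<Rightarrow> 0 | Suc j \<Rightarrow> k j)"
definition "valid_labels = {l * B + p | l p. l \<le> n \<and> label_lower l < p \<and> p \<le> E l}"
definition "label_val q = q mod B + label_offset (q div B)"

context
  assumes k_le: "\<And>j. j \<le> n \<Longrightarrow> k j \<le> E j" "\<And>j. j < n \<Longrightarrow> k j \<le> E (Suc j)"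
    and E_less: "\<And>j. j \<le> n \<Longrightarrow> E j < B"
begin

lemma tail_size_Suc: "j < n \<Longrightarrow> tail_size n E k g j = E (Suc j) - k j + g j + tail_size n E k g (Suc j)"
proof -
  assume "j < n"
  then have "{j<..n} = insert (Suc j) {Suc j<..n}" by auto
  then show ?thesis by (simp add: tail_size_def)
qed

lemma queue_total_Suc: "j < n \<Longrightarrow> queue_total j = queue_total (Suc j) + (E j - k j + g j)"
  using tail_size_Suc[of j] k_le(1)[of j] k_le(2)[of j] by (simp add: queue_total_def)

lemma label_val_label: "l \<le> n \<Longrightarrow> p \<le> E l \<Longrightarrow> label_val (l * B + p) = p + label_offset l"
  using E_less[of l] by (simp add: label_val_def)

lemma label_offset_step: "l < n \<Longrightarrow> label_offset l + E l \<le> label_offset (Suc l) + k l"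
proof -
  assume l: "l < n"
  have "label_offset l \<le> queue_shift l" by (cases l) (auto simp: label_offset_def)
  then show ?thesis using k_le(1)[of l] l by (simp add: label_offset_def)
qed

lemma label_offset_mono:
  assumes "l < l'" "l' \<le> n" shows "label_offset l + E l \<le> label_offset l' + label_lower l'"
  using Suc_leI[OF assms(1)] assms(2)
proof (induction l' rule: dec_induct)
  case base
  then show ?case using label_offset_step[of l] by (simp add: label_lower_def)
next
  case (step m)
  have "label_lower m \<le> E m" using k_le(2) step by (cases m) (auto simp: label_lower_def)
  then have "label_offset l + E l \<le> label_offset m + E m" using step by simp
  also have "\<dots> \<le> label_offset (Suc m) + k m" using label_offset_step step by simp
  finally show ?case by (simp add: label_lower_def)
qed

text \<open>As \<open>B\<close> exceeds all queue sizes, labels are ordered by rounds first, and so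
  are the values. Hence comparators cannot tell a queue of values from its queue of labels.\<close>

lemma label_val_strict_mono: "strict_mono_on valid_labels label_val"
proof (rule strict_mono_onI)
  fix q q' assume q: "q \<in> valid_labels" "q' \<in> valid_labels" "q < q'"
  obtain l p where 1: "q = l * B + p" "l \<le> n" "label_lower l < p" "p \<le> E l" using q unfolding valid_labels_def by blast
  obtain l' p' where 2: "q' = l' * B + p'" "l' \<le> n" "label_lower l' < p'" "p' \<le> E l'" using q unfolding valid_labels_def by blast
  have "\<not> l' < l"
  proof
    assume "l' < l"
    then have "Suc l' * B \<le> l * B" by (intro mult_le_mono1) simp
    then show False using q(3) 1 2 E_less[of l'] by simp
  qed
  then consider "l = l'" | "l < l'" by linarith
  then show "label_val q < label_val q'"
  proof cases
    case 1
    then show ?thesis using q(3) \<open>q = _\<close> 2 \<open>p \<le> E l\<close> by (simp add: label_val_label)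
  next
    case 2
    then show ?thesis using label_offset_mono[OF 2] \<open>q' = _\<close> \<open>l' \<le> n\<close> \<open>p' \<le> E l'\<close> \<open>label_lower l' < p'\<close> 1
      by (simp add: label_val_label)
  qed
qed

context
  fixes x :: "nat \<Rightarrow> nat \<Rightarrow> nat"
  assumes x: "\<And>j. j \<in> {1..n} \<Longrightarrow> x j permutes {1..E j}"
begin

abbreviation "H \<equiv> queue_state n E k g x"
abbreviation "K \<equiv> label_state B k x"

definition queue_inv :: "nat \<Rightarrow> bool" where
  "queue_inv j \<longleftrightarrow> (\<forall>p\<in>{1..E j}. H j p = label_val (K j p) \<and> K j p \<in> valid_labels \<and> H j p \<le> E j + queue_shift j) \<and>
    (\<forall>p\<in>{E j<..queue_total j}. H j p = p + queue_shift j)"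

lemma queue_step:
  assumes j: "j < n" and inv: "queue_inv j"
  shows "queue_inv (Suc j)"
    and "\<And>i. 1 \<le> i \<Longrightarrow> i \<le> E j - k j \<Longrightarrow> H (Suc j) (queue_total (Suc j) + i) = H j (k j + i)"
    and "\<And>i. E j - k j < i \<Longrightarrow> i \<le> E j - k j + g j \<Longrightarrow> H (Suc j) (queue_total (Suc j) + i) = E (Suc j) + i + queue_shift j"
    and "\<And>p. queue_total j < p \<Longrightarrow> H (Suc j) p = H j p"
    and "\<And>p. k j < p \<Longrightarrow> p \<le> E (Suc j) \<Longrightarrow>
      (H j \<star> block_swap (k j) (E (Suc j) - k j) (E j - k j) \<star>
        block_swap (E (Suc j)) (tail_size n E k g (Suc j)) (E j - k j + g j)) p = p + label_offset (Suc j)"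
proof -
  let ?T = "tail_size n E k g (Suc j)" and ?y = "E j - k j"
  let ?b1 = "block_swap (k j) (E (Suc j) - k j) ?y" and ?b2 = "block_swap (E (Suc j)) ?T (?y + g j)"
  let ?X = "H j \<star> ?b1 \<star> ?b2"
  have kj: "k j \<le> E j" "k j \<le> E (Suc j)" using k_le j by auto
  have tot: "queue_total j = E (Suc j) + ?T + (?y + g j)" "queue_total (Suc j) = E (Suc j) + ?T"
    using queue_total_Suc[OF j] j by (auto simp: queue_total_def)
  have old: "\<And>p. p \<in> {1..E j} \<Longrightarrow> H j p = label_val (K j p)" "\<And>p. p \<in> {1..E j} \<Longrightarrow> K j p \<in> valid_labels"
    "\<And>p. p \<in> {1..E j} \<Longrightarrow> H j p \<le> E j + queue_shift j"
    and fresh: "\<And>p. E j < p \<Longrightarrow> p \<le> queue_total j \<Longrightarrow> H j p = p + queue_shift j"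
    using inv unfolding queue_inv_def by (blast, blast, blast, simp)
  \<comment> \<open>All queue entries are at most \<open>E j + queue_shift j\<close> and the waiting
    ones are larger and increasing, so both swaps move larger entries in front of smaller ones and
    act by composition.\<close>
  have b1: "H j \<star> ?b1 = H j \<circ> ?b1"
  proof (rule star_block_swap)
    fix p q assume "k j < p" "p \<le> k j + ?y" "k j + ?y < q" "q \<le> k j + ?y + (E (Suc j) - k j)"
    then show "H j p \<le> H j q" using old(3)[of p] fresh[of q] tot kj by simp
  qed
  have b2: "?X = H j \<circ> ?b1 \<circ> ?b2"
    unfolding b1
  proof (rule star_block_swap)
    fix p q assume p: "E (Suc j) < p" "p \<le> E (Suc j) + (?y + g j)"
      and q: "E (Suc j) + (?y + g j) < q" "q \<le> E (Suc j) + (?y + g j) + ?T"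
    have "?b1 q = q" by (rule block_swap_above) (use q(1) kj in linarith)
    then have Hq: "H j (?b1 q) = q + queue_shift j" using fresh[of q] q tot kj by simp
    show "(H j \<circ> ?b1) p \<le> (H j \<circ> ?b1) q"
    proof (cases "p \<le> E (Suc j) + ?y")
      case True
      then have "?b1 p = p - (E (Suc j) - k j)" using p kj by (intro block_swap_second) linarith+
      moreover have "p - (E (Suc j) - k j) \<in> {1..E j}" using p True kj by auto
      ultimately show ?thesis using Hq old(3)[of "?b1 p"] q kj by simp
    next
      case False
      then have "?b1 p = p" using kj by (intro block_swap_above) linarith
      moreover have "E j < p" "p \<le> queue_total j" "p \<le> q" using False p q kj unfolding tot by linarith+
      ultimately show ?thesis using Hq fresh[of p] by simp
    qed
  qed
  have X1: "?X p = H j p" if "p \<le> k j" for p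
    using that kj unfolding b2 by (simp add: block_swap_def)
  have X2: "?X p = p + label_offset (Suc j)" if "k j < p" "p \<le> E (Suc j)" for p
  proof -
    have "?X p = H j (p + ?y)" using that kj unfolding b2 by (simp add: block_swap_def)
    also have "\<dots> = p + ?y + queue_shift j" using that kj tot by (intro fresh) auto
    finally show ?thesis by (simp add: label_offset_def)
  qed
  show "?X p = p + label_offset (Suc j)" if "k j < p" "p \<le> E (Suc j)" for p
    by (rule X2[OF that])
  have X3: "?X p = p + queue_shift (Suc j)" if "E (Suc j) < p" "p \<le> queue_total (Suc j)" for p
  proof -
    have "?b2 p = p + (?y + g j)" using that tot by (simp add: block_swap_def)
    moreover have "?b1 (p + (?y + g j)) = p + (?y + g j)"
      by (rule block_swap_above) (use that kj in linarith)
    ultimately have "?X p = H j (p + (?y + g j))" unfolding b2 by simp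
    also have "\<dots> = p + (?y + g j) + queue_shift j" using that kj tot by (intro fresh) auto
    finally show ?thesis by simp
  qed
  have X4: "?X (queue_total (Suc j) + i) = H j (k j + i)" if "1 \<le> i" "i \<le> ?y" for i
  proof -
    have "?b2 (queue_total (Suc j) + i) = queue_total (Suc j) + i - ?T"
      by (rule block_swap_second) (use that tot in linarith)+
    then have "?b2 (queue_total (Suc j) + i) = E (Suc j) + i" using tot by simp
    moreover have "?b1 (E (Suc j) + i) = E (Suc j) + i - (E (Suc j) - k j)"
      by (rule block_swap_second) (use that kj in linarith)+
    moreover have "E (Suc j) + i - (E (Suc j) - k j) = k j + i" using kj by linarith
    ultimately show ?thesis unfolding b2 by simp
  qed
  have X5: "?X (queue_total (Suc j) + i) = E (Suc j) + i + queue_shift j" if "?y < i" "i \<le> ?y + g j" for i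
  proof -
    have "?b2 (queue_total (Suc j) + i) = queue_total (Suc j) + i - ?T"
      by (rule block_swap_second) (use that tot in linarith)+
    then have "?b2 (queue_total (Suc j) + i) = E (Suc j) + i" using tot by simp
    moreover have "?b1 (E (Suc j) + i) = E (Suc j) + i"
      by (rule block_swap_above) (use that kj in linarith)
    ultimately have "?X (queue_total (Suc j) + i) = H j (E (Suc j) + i)" unfolding b2 by simp
    also have "\<dots> = E (Suc j) + i + queue_shift j" using that kj tot by (intro fresh) auto
    finally show ?thesis .
  qed
  have X6: "?X p = H j p" if "queue_total j < p" for p
  proof -
    have "?b2 p = p" by (rule block_swap_above) (use that tot in linarith)
    moreover have "?b1 p = p" by (rule block_swap_above) (use that tot kj in linarith)
    ultimately show ?thesis unfolding b2 by simp
  qed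
  have xj: "x (Suc j) permutes {1..E (Suc j)}" using x j by simp
  obtain \<sigma> where \<sigma>: "\<sigma> permutes {1..E (Suc j)}" "H (Suc j) = ?X \<circ> \<sigma>"
    using star_ex_perm[of "x (Suc j)" 0 "E (Suc j)" ?X] xj by auto
  have out: "H (Suc j) p = ?X p" if "E (Suc j) < p" for p
    using \<sigma> that by (simp add: permutes_def)
  show "H (Suc j) (queue_total (Suc j) + i) = H j (k j + i)" if "1 \<le> i" "i \<le> ?y" for i
    using out[of "queue_total (Suc j) + i"] X4[OF that] that tot by simp
  show "H (Suc j) (queue_total (Suc j) + i) = E (Suc j) + i + queue_shift j" if "?y < i" "i \<le> ?y + g j" for i
    using out[of "queue_total (Suc j) + i"] X5[OF that] that tot by simp
  show "H (Suc j) p = H j p" if "queue_total j < p" for p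
    using out[of p] X6[OF that] that tot kj by simp
  \<comment> \<open>The labels just before the factor \<open>x (Suc j)\<close>; they decode to the
    entries of \<open>?X\<close>.\<close>
  let ?L = "\<lambda>p. if p \<le> k j then K j p else Suc j * B + p"
  have L: "?X p = label_val (?L p) \<and> ?L p \<in> valid_labels \<and> ?X p \<le> E (Suc j) + queue_shift (Suc j)"
    if p: "p \<in> {1..E (Suc j)}" for p
  proof (cases "p \<le> k j")
    case True
    then have "p \<in> {1..E j}" using p kj by simp
    then have *: "H j p = label_val (K j p)" "K j p \<in> valid_labels" "H j p \<le> E j + queue_shift j"
      by (rule old)+
    moreover have "E j + queue_shift j \<le> E (Suc j) + queue_shift (Suc j)" using kj by simp
    ultimately have "H j p \<le> E (Suc j) + queue_shift (Suc j)" by linarith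
    then show ?thesis unfolding if_P[OF True] X1[OF True] using * by blast
  next
    case False
    have "Suc j \<le> n \<and> label_lower (Suc j) < p \<and> p \<le> E (Suc j)"
      using False p j by (simp add: label_lower_def)
    then have "Suc j * B + p \<in> valid_labels" unfolding valid_labels_def by blast
    moreover have "label_val (Suc j * B + p) = p + label_offset (Suc j)"
      using label_val_label[of "Suc j" p] p j by simp
    moreover have "k j < p" "p \<le> E (Suc j)" using False p by auto
    moreover have "p + label_offset (Suc j) \<le> E (Suc j) + queue_shift (Suc j)"
      using \<open>p \<le> E (Suc j)\<close> by (simp add: label_offset_def)
    ultimately show ?thesis unfolding if_not_P[OF False] using X2 by simp
  qed
  obtain \<tau> where \<tau>: "\<tau> permutes {1..E (Suc j)}" "K (Suc j) = ?L \<circ> \<tau>"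
    using star_ex_perm[of "x (Suc j)" 0 "E (Suc j)" ?L] xj by auto
  have "mono_on valid_labels label_val"
    by (rule strict_mono_on_imp_mono_on[OF label_val_strict_mono])
  then have "mono_on (?L ` {1..E (Suc j)}) label_val"
    by (rule monotone_on_subset) (use L in blast)
  then have HK: "H (Suc j) p = label_val (K (Suc j) p)" if "p \<in> {1..E (Suc j)}" for p
    unfolding queue_state.simps label_state.simps
    by (rule star_mono_on[OF xj _ _ that]) (use L in blast)+
  show "queue_inv (Suc j)"
    unfolding queue_inv_def
  proof (intro conjI ballI)
    fix p assume p: "p \<in> {1..E (Suc j)}"
    show "H (Suc j) p = label_val (K (Suc j) p)" by (rule HK[OF p])
    have "\<tau> p \<in> {1..E (Suc j)}" "\<sigma> p \<in> {1..E (Suc j)}"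
      using permutes_in_image[OF \<tau>(1), of p] permutes_in_image[OF \<sigma>(1), of p] p by auto
    then show "K (Suc j) p \<in> valid_labels" "H (Suc j) p \<le> E (Suc j) + queue_shift (Suc j)"
      unfolding \<tau>(2) \<sigma>(2) comp_apply using L by blast+
  next
    fix p assume "p \<in> {E (Suc j)<..queue_total (Suc j)}"
    then show "H (Suc j) p = p + queue_shift (Suc j)" using out[of p] X3[of p] by simp
  qed
qed

lemma queue_inv: "j \<le> n \<Longrightarrow> queue_inv j"
proof (induction j)
  case 0
  have "p \<in> valid_labels \<and> label_val p = p" if "p \<in> {1..E 0}" for p
  proof -
    have "p = 0 * B + p \<and> 0 \<le> n \<and> label_lower 0 < p \<and> p \<le> E 0" using that by (simp add: label_lower_def)
    then have "p \<in> valid_labels" unfolding valid_labels_def by blast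
    moreover have "label_val p = p" using label_val_label[of 0 p] that by (simp add: label_offset_def)
    ultimately show ?thesis by blast
  qed
  then show ?case by (auto simp: queue_inv_def)
next
  case (Suc j)
  then show ?case using queue_step(1)[of j] by simp
qed

lemma queue_final:
  assumes "j \<le> n" "queue_total j < p" shows "H n p = H j p"
  using assms
proof (induction "n - j" arbitrary: j)
  case (Suc d)
  then have j: "j < n" by simp
  have "H n p = H (Suc j) p"
    by (rule Suc.hyps(1)) (use Suc.hyps(2) Suc.prems j queue_total_Suc[OF j] in simp_all)
  also have "\<dots> = H j p" by (rule queue_step(4)[OF j queue_inv Suc.prems(2)]) (use j in simp)
  finally show ?case .
qed simp

lemma queue_output_state:
  assumes "j \<le> n" "k n = 0" "1 \<le> i" "i \<le> E j - k j"
  shows "H n (queue_total (Suc j) + i) = H j (k j + i)"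
proof (cases "j = n")
  case True
  then show ?thesis using assms by (simp add: queue_total_def)
next
  case False
  then have j: "j < n" using assms by simp
  have "H n (queue_total (Suc j) + i) = H (Suc j) (queue_total (Suc j) + i)"
    using j assms by (intro queue_final) auto
  also have "\<dots> = H j (k j + i)" using j assms queue_inv by (intro queue_step(2)) auto
  finally show ?thesis .
qed

lemma queue_output:
  assumes "j \<le> n" "k n = 0" "1 \<le> i" "i \<le> E j - k j"
  shows "H n (queue_total (Suc j) + i) = label_val (K j (k j + i))" "K j (k j + i) \<in> valid_labels"
proof -
  have "k j + i \<in> {1..E j}" using assms by auto
  then show "H n (queue_total (Suc j) + i) = label_val (K j (k j + i))" "K j (k j + i) \<in> valid_labels"
    using queue_inv[OF assms(1)] queue_output_state[OF assms] unfolding queue_inv_def by auto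
qed

lemma queue_fresh:
  assumes "j < n" "k j < p" "p \<le> E (Suc j)"
  shows "(H j \<star> block_swap (k j) (E (Suc j) - k j) (E j - k j) \<star>
    block_swap (E (Suc j)) (tail_size n E k g (Suc j)) (E j - k j + g j)) p = p + label_offset (Suc j)"
  using queue_step(5)[OF assms(1) queue_inv assms(2,3)] assms(1) by simp

lemma queue_rest:
  assumes "j \<le> n" shows "\<exists>v. fin_perm v \<and> H n = H j \<star> v"
  using assms
proof (induction "n - j" arbitrary: j)
  case 0
  then have "fin_perm id \<and> H n = H j \<star> id" by simp
  then show ?case by blast
next
  case (Suc d)
  then have j: "j < n" and d: "d = n - Suc j" by linarith+
  obtain v where v: "fin_perm v" "H n = H (Suc j) \<star> v" using Suc.hyps(1)[of "Suc j"] d j by (auto simp del: queue_state.simps)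
  have xj: "fin_perm (x (Suc j))" using x[of "Suc j"] j permutes_fin_perm' by simp
  have "H n = H j \<star> (block_swap (k j) (E (Suc j) - k j) (E j - k j) \<star>
      (block_swap (E (Suc j)) (tail_size n E k g (Suc j)) (E j - k j + g j) \<star> (x (Suc j) \<star> v)))"
    using v xj by (simp add: star_assoc fin_perm_star)
  then show ?case using v(1) xj by (meson block_swap_fin_perm fin_perm_star)
qed

lemma queue_constant:
  assumes "j < n" "E j - k j < i" "i \<le> E j - k j + g j"
  shows "H n (queue_total (Suc j) + i) = E (Suc j) + i + queue_shift j"
proof -
  have "H n (queue_total (Suc j) + i) = H (Suc j) (queue_total (Suc j) + i)" using assms by (intro queue_final) auto
  also have "\<dots> = E (Suc j) + i + queue_shift j" using assms queue_inv by (intro queue_step(3)) auto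
  finally show ?thesis .
qed

end

text \<open>The final positions split into what each queue releases: \<open>E j - k j\<close>
  decoded labels and \<open>g j\<close> values independent of the factors. Decoding is injective, so
  equal products mean equal released labels, and those beyond \<open>f j\<close> never moved. As the
  right-hand side mentions neither \<open>E\<close> nor \<open>g\<close>, it can be shared by two
  queues.\<close>

lemma queue_state_eq_iff:
  assumes kn: "k n = 0" and f: "\<And>j. j \<in> {1..n} \<Longrightarrow> f j \<le> E j \<and> k j \<le> f j \<and> k (j - 1) \<le> f j"
    and x: "\<And>j. j \<in> {1..n} \<Longrightarrow> x j permutes {1..f j}" and y: "\<And>j. j \<in> {1..n} \<Longrightarrow> y j permutes {1..f j}"
  shows "queue_state n E k g x n = queue_state n E k g y n \<longleftrightarrow>
    (\<forall>j\<in>{1..n}. \<forall>p\<in>{k j<..f j}. label_state B k x j p = label_state B k y j p)" (is "?L \<longleftrightarrow> ?R")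
proof -
  have big: "u j permutes {1..E j}" if u: "\<And>j. j \<in> {1..n} \<Longrightarrow> u j permutes {1..f j}" and j: "j \<in> {1..n}" for u :: "nat \<Rightarrow> nat \<Rightarrow> nat" and j
    using u[OF j] f[OF j] permutes_mono by blast
  note x' = big[of x, OF x] and y' = big[of y, OF y]
  have high: "label_state B k u j p = j * B + p"
    if u: "\<And>j. j \<in> {1..n} \<Longrightarrow> u j permutes {1..f j}" and j: "j \<in> {1..n}" and p: "f j < p" for u :: "nat \<Rightarrow> nat \<Rightarrow> nat" and j p
  proof -
    obtain i where i: "j = Suc i" using j by (cases j) auto
    have "u (Suc i) permutes {Suc 0..f (Suc i)}" using u[OF j] i by simp
    then have "label_state B k u (Suc i) p = (if p \<le> k i then label_state B k u i p else Suc i * B + p)"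
      unfolding label_state.simps by (rule star_outside) (use p i in simp)
    then show ?thesis using p f[OF j] i by simp
  qed
  show ?thesis
  proof
    assume eq: ?L
    show ?R
    proof (intro ballI)
      fix j p assume j: "j \<in> {1..n}" and p: "p \<in> {k j<..f j}"
      define i where "i = p - k j"
      have i: "1 \<le> i" "i \<le> E j - k j" "p = k j + i" "j \<le> n" using p f[OF j] j by (auto simp: i_def)
      have "label_val (label_state B k x j p) = label_val (label_state B k y j p)"
        using queue_output(1)[of x j i, OF x' i(4) kn i(1,2)] queue_output(1)[of y j i, OF y' i(4) kn i(1,2)] eq i(3)
        by simp
      moreover have "label_state B k x j p \<in> valid_labels" "label_state B k y j p \<in> valid_labels"
        using queue_output(2)[of x j i, OF x' i(4) kn i(1,2)] queue_output(2)[of y j i, OF y' i(4) kn i(1,2)] i(3)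
        by auto
      ultimately show "label_state B k x j p = label_state B k y j p"
        using strict_mono_on_imp_inj_on[OF label_val_strict_mono] by (auto dest: inj_onD)
    qed
  next
    assume eq: ?R
    have eq': "label_state B k x j p = label_state B k y j p" if "j \<le> n" "k j < p" for j p
    proof (cases "j = 0")
      case False
      then have j: "j \<in> {1..n}" using that by simp
      show ?thesis
      proof (cases "p \<le> f j")
        case True
        then show ?thesis using eq j that by auto
      next
        case False
        then show ?thesis using high[of x j p, OF x j] high[of y j p, OF y j] by simp
      qed
    qed simp
    have block: "queue_state n E k g x n p = queue_state n E k g y n p"
      if j: "j \<le> n" and p: "queue_total (Suc j) < p" "p \<le> queue_total j" for j p
    proof -
      define i where "i = p - queue_total (Suc j)"
      have i: "1 \<le> i" "p = queue_total (Suc j) + i" using p by (auto simp: i_def)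
      show ?thesis
      proof (cases "i \<le> E j - k j")
        case True
        show ?thesis
          using queue_output(1)[of x j i, OF x' j kn i(1) True] queue_output(1)[of y j i, OF y' j kn i(1) True]
            eq'[OF j, of "k j + i"] i by simp
      next
        \<comment> \<open>The entries that bypass the queues; the last queue is followed by
          none.\<close>
        case False
        have "j < n"
        proof (rule ccontr)
          assume "\<not> j < n"
          then have "j = n" using j by simp
          then show False using False p i kn by (simp add: queue_total_def tail_size_def)
        qed
        moreover from this have "i \<le> E j - k j + g j" using queue_total_Suc[of j] p i by simp
        ultimately show ?thesis
          using queue_constant[of x j i, OF x'] queue_constant[of y j i, OF y'] False i by simp
      qed
    qed
    have all: "\<forall>p. queue_total j < p \<longrightarrow> queue_state n E k g x n p = queue_state n E k g y n p" if "j \<le> Suc n" for j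
      using that
    proof (induction j)
      case 0
      show ?case
        using queue_final[of x 0, OF x'] queue_final[of y 0, OF y'] by (simp del: One_nat_def)
    next
      case (Suc j)
      show ?case
      proof (intro allI impI)
        fix p assume p: "queue_total (Suc j) < p"
        show "queue_state n E k g x n p = queue_state n E k g y n p"
          using block[of j p] Suc p by (cases "p \<le> queue_total j") auto
      qed
    qed
    have fin: "fin_perm (queue_state n E k g u j)"
      if u: "\<And>j. j \<in> {1..n} \<Longrightarrow> u j permutes {1..f j}" and "j \<le> n" for u :: "nat \<Rightarrow> nat \<Rightarrow> nat" and j
      using \<open>j \<le> n\<close>
    proof (induction j)
      case 0
      show "fin_perm (queue_state n E k g u 0)" by simp
    next
      case (Suc j)
      have "fin_perm (u (Suc j))" using u[of "Suc j"] Suc permutes_fin_perm' by simp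
      moreover have "fin_perm (queue_state n E k g u j)" using Suc.IH Suc.prems by (meson Suc_leD)
      ultimately show "fin_perm (queue_state n E k g u (Suc j))" by (simp add: fin_perm_star)
    qed
    show ?L
    proof
      fix p
      show "queue_state n E k g x n p = queue_state n E k g y n p"
      proof (cases "p = 0")
        case True
        then show ?thesis using fin_perm_0[OF fin[of x n, OF x]] fin_perm_0[OF fin[of y n, OF y]] by simp
      next
        case False
        then show ?thesis using all[of "Suc n"] by (simp add: queue_total_def)
      qed
    qed
  qed
qed

end

end

section \<open>Dropping the diagonal ranks\<close>

lemma star_commute:
  assumes u: "u permutes {1..m}" and d: "d permutes {Suc m..l}"
  shows "a \<star> u \<star> d = a \<star> d \<star> u"
proof -
  have fin: "fin_perm u" "fin_perm d" using permutes_fin_perm'[OF u] permutes_fin_perm[OF d] .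
  have dfix: "d p = p" if "p \<le> m" for p using d that by (simp add: permutes_def)
  have ufix: "u p = p" if "m < p" for p using u that by (simp add: permutes_def)
  have uin: "u p \<le> m" if "p \<le> m" for p
    using permutes_in_image[OF u, of p] fin_perm_0[OF fin(1)] that by (cases "p = 0") auto
  have din: "m < d p" if "m < p" for p
    using permutes_in_image[OF d, of p] d that by (cases "p \<in> {Suc m..l}") (auto simp: permutes_def)
  have "u \<star> d = u \<circ> d"
  proof (rule star_comp[OF fin(2)])
    fix p q assume pq: "p < q" "d q < d p"
    have "m < p"
    proof (rule ccontr)
      assume "\<not> m < p"
      then show False using pq dfix[of p] dfix[of q] din[of q] by (cases "q \<le> m") auto
    qed
    then show "u (d q) \<le> u (d p)" using pq din[of p] din[of q] ufix by simp
  qed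
  moreover have "d \<star> u = d \<circ> u"
  proof (rule star_comp[OF fin(1)])
    fix p q assume pq: "p < q" "u q < u p"
    have "q \<le> m"
    proof (rule ccontr)
      assume "\<not> q \<le> m"
      then show False using pq ufix[of p] ufix[of q] uin[of p] by (cases "p \<le> m") auto
    qed
    then show "d (u q) \<le> d (u p)" using pq uin dfix by simp
  qed
  moreover have "u \<circ> d = d \<circ> u"
  proof
    fix p show "(u \<circ> d) p = (d \<circ> u) p"
      using ufix[of p] ufix[OF din[of p]] dfix[of p] dfix[OF uin[of p]] by (cases "p \<le> m") auto
  qed
  ultimately show ?thesis using star_assoc[OF fin, of a] star_assoc[OF fin(2,1), of a] by simp
qed

text \<open>The largest point is fixed: if its preimage lay beyond \<open>a\<close>,
  \<open>right\<close> would fail; otherwise \<open>left\<close> squeezes the preimages of all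
  points beyond \<open>b\<close> into the first \<open>a\<close> positions, which are too
  few.\<close>

lemma permutes_restrict:
  fixes u :: "nat \<Rightarrow> nat"
  assumes u: "u permutes {1..m}" and "b \<le> m" "a + b \<le> m"
    and right: "strict_mono_on {a<..m} u" and left: "strict_mono_on {b<..m} (inv_into UNIV u)"
  shows "u permutes {1..a + b}"
  using assms
proof (induction m)
  case (Suc m)
  note u = \<open>u permutes {1..Suc m}\<close>
  show ?case
  proof (cases "Suc m \<le> a + b")
    case True
    then show ?thesis using Suc.prems by simp
  next
    case False
    let ?y = "inv_into UNIV u"
    have y: "u (?y p) = p" "?y (u p) = p" for p using permutes_inverses[OF u] by auto
    have yin: "?y p \<in> {1..Suc m} \<longleftrightarrow> p \<in> {1..Suc m}" for p
      using permutes_in_image[OF permutes_inv[OF u]] .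
    have uin: "u p \<in> {1..Suc m} \<longleftrightarrow> p \<in> {1..Suc m}" for p
      using permutes_in_image[OF u] .
    have "u (Suc m) = Suc m"
    proof (rule ccontr)
      assume neq: "u (Suc m) \<noteq> Suc m"
      show False
      proof (cases "a < ?y (Suc m)")
        case True
        have "?y (Suc m) \<noteq> Suc m" using neq y by metis
        then have "?y (Suc m) < Suc m" using yin[of "Suc m"] by auto
        then have "u (?y (Suc m)) < u (Suc m)" using strict_mono_onD[OF Suc.prems(4)] True by auto
        then show False using uin[of "Suc m"] y by simp
      next
        case False
        have sub: "?y ` {b<..Suc m} \<subseteq> {1..a}"
        proof
          fix v assume "v \<in> ?y ` {b<..Suc m}"
          then obtain p where p: "v = ?y p" "p \<in> {b<..Suc m}" by blast
          have "?y p \<le> ?y (Suc m)"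
            using strict_mono_onD[OF Suc.prems(5), of p "Suc m"] p(2) by (cases "p = Suc m") auto
          then show "v \<in> {1..a}" using False p yin[of p] by auto
        qed
        have "card (?y ` {b<..Suc m}) = Suc m - b"
          using permutes_inj[OF permutes_inv[OF u]] by (subst card_image) (auto intro: inj_on_subset)
        moreover have "card (?y ` {b<..Suc m}) \<le> card {1..a}" by (rule card_mono[OF _ sub]) simp
        ultimately show False using \<open>\<not> Suc m \<le> a + b\<close> by simp
      qed
    qed
    then have um: "u permutes {1..m}"
      using permutes_superset[OF u, of "{1..m}"] by (auto simp: le_Suc_eq)
    show ?thesis
    proof (rule Suc.IH[OF um])
      show "b \<le> m" "a + b \<le> m" using False by auto
      show "strict_mono_on {a<..m} u" using Suc.prems(4) by (rule monotone_on_subset) auto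
      show "strict_mono_on {b<..m} ?y" using Suc.prems(5) by (rule monotone_on_subset) auto
    qed
  qed
qed simp

lemma kms_state_cong:
  "(\<And>i. i \<in> {1..j} \<Longrightarrow> w i = w' i) \<Longrightarrow> kms_state m s w j = kms_state m s w' j"
proof (induction j)
  case (Suc j)
  have "kms_state m s w j = kms_state m s w' j" by (rule Suc.IH) (use Suc.prems in auto)
  then show "kms_state m s w (Suc j) = kms_state m s w' (Suc j)" using Suc.prems by simp
qed simp

text \<open>Strictly above the diagonal the permutations for r^(1) are those for r, shifted by one
  column; hence \<open>column_factor\<close> for r^(1) is \<open>upper_column\<close> for r.\<close>

lemma W_perm_drop_diag: "l < i \<Longrightarrow> W_perm (drop_diag r) l i = W_perm r l (Suc i)"
  by (simp add: fun_eq_iff W_perm_def ext_rank_upper drop_diag_def)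

context
  fixes n :: nat and r :: "nat \<Rightarrow> nat \<Rightarrow> nat"
begin

text \<open>The dimension e_j of r^(1); the value 0 at \<open>n\<close> follows the convention for
  ranks beyond \<open>n\<close>.\<close>

definition "kept j = (if j < n then r j (Suc j) else 0)"
definition "sizes j = r j j"
text \<open>For \<open>j\<close> from 1 to \<open>n - 1\<close> this is the size of the symmetric
  group that the \<open>j\<close>-th factor for r^(1) belongs to. At 0 the value
  \<open>kept 0\<close> makes the initial queue release nothing.\<close>

definition "small_sizes j = (if j = 0 then kept 0 else kept (j - 1) + kept j)"
text \<open>One base for both queues, so that both carry the same labels.\<close>

definition "label_base = Suc (\<Sum>j\<le>n. sizes j + small_sizes j)"
definition "upper_factor j = (if j < n then upper_column r j else id)"

context
  assumes r: "rank_ineqs n r" and n: "1 \<le> n"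
begin

lemma kept_le: "j \<le> n \<Longrightarrow> kept j \<le> sizes j" "j < n \<Longrightarrow> kept j \<le> sizes (Suc j)"
  using rank_diag_le[OF r, of j] by (auto simp: kept_def sizes_def)

lemma tail_size_sizes: "tail_size n sizes kept kept j = (\<Sum>l\<in>{j<..n}. r l l)"
  unfolding tail_size_def
proof (rule sum.cong)
  fix l assume "l \<in> {j<..n}"
  then have "l - 1 < n" "Suc (l - 1) = l" by auto
  then show "sizes l - kept (l - 1) + kept (l - 1) = r l l"
    using kept_le(2)[of "l - 1"] by (simp add: sizes_def)
qed simp

lemma queue_state_sizes_Suc:
  assumes j: "j < n"
  shows "queue_state n sizes kept kept x (Suc j) =
    queue_state n sizes kept kept x j \<star> W_perm r j (Suc j) \<star> delta_perm n r (Suc j) \<star> x (Suc j)"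
  using kept_le(1)[of j] j W_perm_diag[OF r j] delta_perm_eq(1)[OF r, of "Suc j"]
  by (simp add: tail_size_sizes) (simp add: kept_def sizes_def)

text \<open>Rounds are cut in front of \<open>W_perm\<close> instead of in front of
  \<open>w\<close>, which brings \<open>u j\<close> and \<open>v j\<close> together;
  \<open>u j\<close> may pass \<open>delta_perm n r j\<close> because they move disjoint sets of
  positions.\<close>

lemma kms_state_queue_state:
  assumes u: "\<And>i. i \<in> {1..n} \<Longrightarrow> u i permutes {1..r i i}" and v: "\<And>i. i \<le> n \<Longrightarrow> fin_perm (v i)" "v 0 = id"
    and w: "\<And>j. j < n \<Longrightarrow> w (Suc j) = v j \<star> W_perm r j (Suc j) \<star> u (Suc j)" and "j \<le> n"
  shows "kms_state n r w j \<star> v j = queue_state n sizes kept kept (\<lambda>i. u i \<star> v i) j"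
  using \<open>j \<le> n\<close>
proof (induction j)
  case 0
  show "kms_state n r w 0 \<star> v 0 = queue_state n sizes kept kept (\<lambda>i. u i \<star> v i) 0" using v by simp
next
  case (Suc j)
  let ?H = "queue_state n sizes kept kept (\<lambda>i. u i \<star> v i)" and ?S = "kms_state n r w"
  have j: "j < n" using Suc.prems by simp
  have IH: "?S j \<star> v j = ?H j" using Suc.IH j by (meson less_imp_le)
  have uj: "u (Suc j) permutes {1..r (Suc j) (Suc j)}" using u j by simp
  have d: "delta_perm n r (Suc j) permutes
      {Suc (r (Suc j) (Suc j))..r (Suc j) (Suc j) + (\<Sum>k\<in>{Suc j<..n}. r k k) + r j j}"
    using delta_perm_eq(1)[OF r, of "Suc j"] block_swap_permutes j by simp
  have fin: "fin_perm (v j)" "fin_perm (u (Suc j))" "fin_perm (v (Suc j))" "fin_perm (W_perm r j (Suc j))"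
    using v(1) j permutes_fin_perm'[OF uj] W_perm_diag[OF r j] by auto
  have "?S (Suc j) = ?S j \<star> v j \<star> W_perm r j (Suc j) \<star> u (Suc j) \<star> delta_perm n r (Suc j)"
    using fin by (simp add: w[OF j] star_assoc fin_perm_star)
  also have "\<dots> = ?H j \<star> W_perm r j (Suc j) \<star> delta_perm n r (Suc j) \<star> u (Suc j)"
    unfolding IH by (rule star_commute[OF uj d])
  finally show "?S (Suc j) \<star> v (Suc j) = ?H (Suc j)"
    using fin unfolding queue_state_sizes_Suc[OF j] by (simp add: star_assoc)
qed

text \<open>The two swaps of a queue round form a single \<open>delta_perm\<close> of r^(1), cut
  where the positions of the next factor end; with \<open>g = 0\<close> nothing bypasses the
  queues.\<close>

lemma kms_state_drop_diag:
  assumes x: "\<And>i. i \<in> {1..n} \<Longrightarrow> fin_perm (x i)" "x n = id"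
  shows "kms_state (n - 1) (drop_diag r) x (n - 1) = queue_state n small_sizes kept (\<lambda>_. 0) x n"
proof -
  let ?d = "delta_perm (n - 1) (drop_diag r)" and ?H = "queue_state n small_sizes kept (\<lambda>_. 0) x"
  note r' = rank_ineqs_drop_diag[OF r]
  have tail: "kept (Suc j) + tail_size n small_sizes kept (\<lambda>_. 0) (Suc j) = (\<Sum>l\<in>{j<..n - 1}. drop_diag r l l)"
    if j: "j < n" for j
  proof -
    have "tail_size n small_sizes kept (\<lambda>_. 0) (Suc j) = (\<Sum>l\<in>{Suc j<..n}. kept l)"
      unfolding tail_size_def by (rule sum.cong) (auto simp: small_sizes_def)
    moreover have "{j<..n} = insert (Suc j) {Suc j<..n}" using j by auto
    ultimately have "kept (Suc j) + tail_size n small_sizes kept (\<lambda>_. 0) (Suc j) = (\<Sum>l\<in>{j<..n}. kept l)" by simp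
    also have "{j<..n} = insert n {j<..n - 1}" using j by auto
    also have "(\<Sum>l\<in>insert n {j<..n - 1}. kept l) = (\<Sum>l\<in>{j<..n - 1}. kept l)"
      using j n by (subst sum.insert) (auto simp: kept_def)
    also have "\<dots> = (\<Sum>l\<in>{j<..n - 1}. drop_diag r l l)"
      by (rule sum.cong) (auto simp: kept_def drop_diag_def)
    finally show ?thesis .
  qed
  have step: "?H (Suc j) = ?H j \<star> ?d j \<star> x (Suc j)" if j: "j < n" for j
  proof -
    let ?y = "small_sizes j - kept j" and ?T = "tail_size n small_sizes kept (\<lambda>_. 0) (Suc j)"
    have E: "small_sizes (Suc j) = kept j + kept (Suc j)" by (simp add: small_sizes_def)
    have "?H (Suc j) = ?H j \<star> (block_swap (kept j) (kept (Suc j)) ?y \<star> block_swap (kept j + kept (Suc j)) ?T ?y) \<star> x (Suc j)"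
      by (simp add: E star_assoc)
    also have "block_swap (kept j) (kept (Suc j)) ?y \<star> block_swap (kept j + kept (Suc j)) ?T ?y =
        block_swap (kept j) (kept (Suc j) + ?T) ?y" by (rule block_swap_star_block_swap)
    also have "\<dots> = ?d j"
    proof (cases "j = 0")
      case True
      then show ?thesis using delta_perm_0[OF r'] by (simp add: small_sizes_def)
    next
      case False
      then have "?d j = block_swap (drop_diag r j j) (\<Sum>l\<in>{j<..n - 1}. drop_diag r l l) (drop_diag r (j - 1) (j - 1))"
        using j by (intro delta_perm_eq(1)[OF r']) auto
      then show ?thesis using False j tail[OF j] by (simp add: small_sizes_def kept_def drop_diag_def)
    qed
    finally show ?thesis .
  qed
  have fd: "fin_perm (?d j)" if "j < n" for j using fin_perm_delta_perm[OF r', of j] that by simp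
  have "kms_state (n - 1) (drop_diag r) x j = ?H j \<star> ?d j" if "j < n" for j
    using that
  proof (induction j)
    case 0
    show "kms_state (n - 1) (drop_diag r) x 0 = ?H 0 \<star> ?d 0" using delta_perm_0[OF r'] by simp
  next
    case (Suc j)
    have "kms_state (n - 1) (drop_diag r) x j = ?H j \<star> ?d j" using Suc.IH Suc.prems by (meson Suc_lessD)
    then show "kms_state (n - 1) (drop_diag r) x (Suc j) = ?H (Suc j) \<star> ?d (Suc j)"
      using step[of j] Suc.prems by (simp del: queue_state.simps)
  qed
  from this[of "n - 1"] step[of "n - 1"] show ?thesis using n x(2) by simp
qed

lemma sizes_less: "j \<le> n \<Longrightarrow> sizes j < label_base" "j \<le> n \<Longrightarrow> small_sizes j < label_base"
  using member_le_sum[of j "{..n}" "\<lambda>j. sizes j + small_sizes j"] by (auto simp: label_base_def)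

lemma small_kept_le: "j \<le> n \<Longrightarrow> kept j \<le> small_sizes j" "j < n \<Longrightarrow> kept j \<le> small_sizes (Suc j)"
  by (auto simp: small_sizes_def)

lemma kept_n: "kept n = 0"
  by (simp add: kept_def)

abbreviation "Q \<equiv> queue_state n sizes kept kept"
abbreviation "Q' \<equiv> queue_state n small_sizes kept (\<lambda>_. 0)"

text \<open>
  Both products are determined by the same sequence of labels, since the entries beyond the smaller
  of the two queue sizes are not moved.
\<close>

lemma queue_states_eq_iff:
  assumes "\<And>j. j \<in> {1..n} \<Longrightarrow> x j permutes {1..sizes j} \<and> x j permutes {1..small_sizes j}"
    and "\<And>j. j \<in> {1..n} \<Longrightarrow> y j permutes {1..sizes j} \<and> y j permutes {1..small_sizes j}"
  shows "Q x n = Q y n \<longleftrightarrow> Q' x n = Q' y n"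
proof -
  let ?f = "\<lambda>j. min (sizes j) (small_sizes j)"
  have x: "x j permutes {1..?f j}" and y: "y j permutes {1..?f j}" if "j \<in> {1..n}" for j
    using assms[OF that] by (auto simp: min_def)
  have f: "?f j \<le> sizes j \<and> kept j \<le> ?f j \<and> kept (j - 1) \<le> ?f j"
    and f': "?f j \<le> small_sizes j \<and> kept j \<le> ?f j \<and> kept (j - 1) \<le> ?f j" if j: "j \<in> {1..n}" for j
  proof -
    have "j - 1 < n" "Suc (j - 1) = j" using j by auto
    then have "kept j \<le> sizes j" "kept (j - 1) \<le> sizes j" "kept j \<le> small_sizes j" "kept (j - 1) \<le> small_sizes j"
      using kept_le(1)[of j] kept_le(2)[of "j - 1"] small_kept_le(1)[of j] small_kept_le(2)[of "j - 1"] j by auto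
    then show "?f j \<le> sizes j \<and> kept j \<le> ?f j \<and> kept (j - 1) \<le> ?f j"
      "?f j \<le> small_sizes j \<and> kept j \<le> ?f j \<and> kept (j - 1) \<le> ?f j" by auto
  qed
  have "Q x n = Q y n \<longleftrightarrow> (\<forall>j\<in>{1..n}. \<forall>p\<in>{kept j<..?f j}.
      label_state label_base kept x j p = label_state label_base kept y j p)"
    by (rule queue_state_eq_iff[OF kept_le sizes_less(1) kept_n f x y])
  moreover have "Q' x n = Q' y n \<longleftrightarrow> (\<forall>j\<in>{1..n}. \<forall>p\<in>{kept j<..?f j}.
      label_state label_base kept x j p = label_state label_base kept y j p)"
    by (rule queue_state_eq_iff[OF small_kept_le sizes_less(2) kept_n f' x y])
  ultimately show ?thesis by simp
qed

section \<open>Both Zelevinsky permutations as queue products\<close>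

lemma upper_factor_permutes:
  "j \<le> n \<Longrightarrow> upper_factor j permutes {1..sizes j}"
  "1 \<le> j \<Longrightarrow> j \<le> n \<Longrightarrow> upper_factor j permutes {1..small_sizes j}"
  using upper_column_permutes[OF r, of j]
  by (auto simp: upper_factor_def sizes_def small_sizes_def kept_def permutes_id)

lemma upper_factor_0: "upper_factor 0 = id"
  by (simp add: upper_factor_def upper_column_def)

lemma fin_perm_upper_factor: "fin_perm (upper_factor j)"
  using upper_factor_permutes(1)[of j] permutes_fin_perm'
  by (cases "j \<le> n") (auto simp: upper_factor_def)

lemma queue_state_upper_factor: "Q upper_factor n = zelevinsky n r"
proof -
  have "kms_state n r (column_factor r) n \<star> upper_factor n = Q (\<lambda>i. id \<star> upper_factor i) n"
  proof (rule kms_state_queue_state)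
    show "column_factor r (Suc j) = upper_factor j \<star> W_perm r j (Suc j) \<star> id" if "j < n" for j
      using that by (simp add: column_factor_Suc upper_factor_def)
  qed (simp_all add: permutes_id fin_perm_upper_factor upper_factor_0 flip: id_def)
  moreover have "(\<lambda>i. id \<star> upper_factor i) = upper_factor"
    using star_id_left[OF fin_perm_upper_factor] by auto
  moreover have "upper_factor n = id" by (simp add: upper_factor_def)
  ultimately show ?thesis using kms_state_column_factor[OF r] by simp
qed

text \<open>The factors that give z(r) in the queue for r give z(r^(1)) in the queue for r^(1), so
  both sides of (b) compare \<open>x\<close> with one and the same sequence.\<close>

lemma small_queue_state_upper_factor: "Q' upper_factor n = zelevinsky (n - 1) (drop_diag r)"
proof -
  have "Q' upper_factor n = kms_state (n - 1) (drop_diag r) upper_factor (n - 1)"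
    by (rule kms_state_drop_diag[symmetric]) (rule fin_perm_upper_factor, simp add: upper_factor_def)
  also have "\<dots> = kms_state (n - 1) (drop_diag r) (column_factor (drop_diag r)) (n - 1)"
  proof (rule kms_state_cong)
    fix i assume "i \<in> {1..n - 1}"
    then have "i < n" by auto
    moreover have "W_column (drop_diag r) i i = W_column r (Suc i) i"
      by (rule map_cong) (auto simp: W_perm_drop_diag)
    ultimately show "upper_factor i = column_factor (drop_diag r) i"
      unfolding upper_factor_def upper_column_def column_factor_def by (simp del: map_eq_conv)
  qed
  also have "\<dots> = zelevinsky (n - 1) (drop_diag r)"
    by (rule kms_state_column_factor[OF rank_ineqs_drop_diag[OF r]])
  finally show ?thesis .
qed

lemma queue_shift_sizes: "j \<le> n \<Longrightarrow> queue_shift sizes kept kept j = dim_sum r j"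
proof (induction j)
  case (Suc j)
  then show ?case using kept_le(1)[of j] by (simp add: dim_sum_Suc) (simp add: sizes_def)
qed (simp add: dim_sum_def)

text \<open>Labels beyond \<open>kept i\<close> leave at once, to positions where z(r) increases,
  and those beyond \<open>kept (i - 1)\<close> enter as consecutive values of one block. So
  \<open>x i\<close> and its inverse increase there, and \<open>permutes_restrict\<close>
  applies.\<close>

lemma queue_factor_permutes_small:
  assumes x: "\<And>j. j \<in> {1..n} \<Longrightarrow> x j permutes {1..sizes j}" and z: "Q x n = zelevinsky n r"
    and i: "i \<in> {1..<n}"
  shows "x i permutes {1..small_sizes i}"
proof -
  obtain j where j: "i = Suc j" "j < n" using i by (cases i) auto
  have xi: "x (Suc j) permutes {1..sizes (Suc j)}" using x i j by simp
  note fin = permutes_fin_perm'[OF xi]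
  have kj: "kept j \<le> sizes j" "kept j \<le> sizes (Suc j)" "kept (Suc j) \<le> sizes (Suc j)"
    using kept_le(1)[of j] kept_le(2)[of j] kept_le(1)[of "Suc j"] i j by auto
  let ?X = "Q x j \<star> block_swap (kept j) (sizes (Suc j) - kept j) (sizes j - kept j) \<star>
    block_swap (sizes (Suc j)) (tail_size n sizes kept kept (Suc j)) (sizes j - kept j + kept j)"
  have Qi: "Q x (Suc j) = ?X \<star> x (Suc j)" by simp
  have right: "strict_mono_on {kept (Suc j)<..sizes (Suc j)} (x (Suc j))"
  proof (rule strict_mono_on_consecutive)
    fix k assume k: "kept (Suc j) \<le> k" "k + 2 \<le> sizes (Suc j)"
    let ?N = "queue_total n sizes kept kept (Suc (Suc j))"
    have N: "?N = ext_rank r n (Suc (Suc j))"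
      using i j ext_rank_n_tail[of "Suc (Suc j)" n r] by (simp add: queue_total_def tail_size_sizes sizes_def)
    have out: "zelevinsky n r (?N + t) = Q x (Suc j) (kept (Suc j) + t)"
      if "1 \<le> t" "t \<le> sizes (Suc j) - kept (Suc j)" for t
      unfolding z[symmetric] by (rule queue_output_state[OF kept_le sizes_less(1) x _ kept_n that]) (use i j in auto)
    show "x (Suc j) (Suc k) < x (Suc j) (Suc (Suc k))"
    proof (rule ccontr)
      assume "\<not> ?thesis"
      then have "Q x (Suc j) (Suc (Suc k)) \<le> Q x (Suc j) (Suc k)"
        unfolding Qi using fin_perm_adj_neq[OF fin, of k] by (intro star_descent[OF fin]) simp
      moreover have "zelevinsky n r (?N + (Suc (Suc k) - kept (Suc j))) = Q x (Suc j) (Suc (Suc k))"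
        by (subst out) (use k in auto)
      moreover have "zelevinsky n r (?N + (Suc k - kept (Suc j))) = Q x (Suc j) (Suc k)"
        by (subst out) (use k in auto)
      moreover have "zelevinsky n r (?N + (Suc k - kept (Suc j))) < zelevinsky n r (?N + (Suc (Suc k) - kept (Suc j)))"
        unfolding N
        by (rule strict_mono_onD[OF zelevinsky_properties(3)[OF r, of "Suc j"]])
          (use i j k ext_rank_n_Suc[of "Suc j" n r] in \<open>auto simp: sizes_def\<close>)
      ultimately show False by linarith
    qed
  qed
  have left: "strict_mono_on {kept j<..sizes (Suc j)} (inv_into UNIV (x (Suc j)))"
  proof (rule strict_mono_on_consecutive)
    fix k assume k: "kept j \<le> k" "k + 2 \<le> sizes (Suc j)"
    obtain v where v: "fin_perm v" "Q x n = Q x (Suc j) \<star> v"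
      using queue_rest[where n = n and g = kept and x = x and j = "Suc j", OF kept_le sizes_less(1) x] i j by auto
    have X: "?X p = p + label_offset sizes kept kept (Suc j)" if "kept j < p" "p \<le> sizes (Suc j)" for p
      by (rule queue_fresh[OF kept_le sizes_less(1) x j(2) that])
    \<comment> \<open>The new entry at position \<open>Suc (kept j)\<close> is the first value of
      block \<open>Suc j\<close>.\<close>
    have off: "label_offset sizes kept kept (Suc j) + kept j = dim_sum r (Suc j)"
      using queue_shift_sizes[of j] j kj by (simp add: label_offset_def dim_sum_Suc) (simp add: sizes_def)
    have "dim_sum r (Suc (Suc j)) = dim_sum r (Suc j) + sizes (Suc j)" by (simp add: dim_sum_Suc sizes_def)
    then have s: "?X (Suc (Suc k)) = Suc (?X (Suc k))" "dim_sum r (Suc j) < ?X (Suc k)"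
      "?X (Suc (Suc k)) \<le> dim_sum r (Suc (Suc j))"
      using X[of "Suc k"] X[of "Suc (Suc k)"] k off by simp_all
    have "separated_inversions r (?X \<star> x (Suc j) \<star> v)"
      using zelevinsky_properties(2)[OF r] v(2) z unfolding Qi by simp
    then show "inv_into UNIV (x (Suc j)) (Suc k) < inv_into UNIV (x (Suc j)) (Suc (Suc k))"
      by (rule separated_left_increasing[OF _ xi v(1) s])
  qed
  show ?thesis
  proof (cases "kept (Suc j) + kept j \<le> sizes (Suc j)")
    case True
    have "x (Suc j) permutes {1..kept (Suc j) + kept j}"
      by (rule permutes_restrict[OF xi kj(2) True right left])
    then show ?thesis by (simp add: j small_sizes_def add.commute)
  next
    case False
    then show ?thesis using permutes_mono[OF xi, of "small_sizes (Suc j)"] by (simp add: j small_sizes_def)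
  qed
qed

end

end

section \<open>Passage to r^(1), part (b)\<close>

lemma KMS_factorization_iff_kms_state:
  assumes r: "rank_ineqs n r" and w: "\<And>i. i \<in> {1..n} \<Longrightarrow> w i permutes {1..r (i - 1) (i - 1) + r i i}"
  shows "KMS_factorization n r w \<longleftrightarrow> kms_state n r w n = zelevinsky n r"
proof -
  have "hecke_prod (concat (map (\<lambda>i. if i = 1 then [w 1] else [delta_perm n r (i - 1), w i]) [1..<n + 1]))
      = kms_state n r w n"
    by (rule hecke_prod_kms_state[OF r permutes_fin_perm'[OF w]])
  then show ?thesis using w unfolding KMS_factorization_def by auto
qed

proposition KMS_factorization_drop_diag_iff:
  assumes r: "rank_ineqs n r" and n: "1 \<le> n"
    and uv: "\<And>i. i \<in> {1..<n} \<Longrightarrow> u i permutes {1..r i i}" "\<And>i. i \<in> {1..<n} \<Longrightarrow> v i permutes {1..r i i}"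
  shows "KMS_factorization n r (\<lambda>i. hecke_prod ((if i = 1 then [] else [v (i - 1)]) @ [W_perm r (i - 1) i] @
      (if i = n then [] else [u i]))) \<longleftrightarrow>
    KMS_factorization (n - 1) (drop_diag r) (\<lambda>i. hecke_prod [u i, v i])"
    (is "KMS_factorization n r ?w \<longleftrightarrow> KMS_factorization (n - 1) (drop_diag r) ?x")
proof -
  \<comment> \<open>Padding with identities at both ends gives all \<open>n\<close> factors the form
    \<open>v' j \<star> W_perm r j (Suc j) \<star> u' (Suc j)\<close>.\<close>
  define u' where "u' i = (if i \<in> {1..<n} then u i else id)" for i
  define v' where "v' i = (if i \<in> {1..<n} then v i else id)" for i
  define x where "x i = u' i \<star> v' i" for i
  have u': "u' i permutes {1..r i i}" and v': "v' i permutes {1..r i i}" for i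
    using uv[of i] by (auto simp: u'_def v'_def permutes_id)
  have fin: "fin_perm (u' i)" "fin_perm (v' i)" for i using u'[of i] v'[of i] permutes_fin_perm' by blast+
  have xn: "x n = id" by (simp add: x_def u'_def v'_def)
  have xperm: "x i permutes {1..r i i}" for i
    unfolding x_def using star_permutes[of "u' i" 0 "r i i" "v' i"] u'[of i] v'[of i] by simp
  have finx: "fin_perm (x i)" for i using permutes_fin_perm'[OF xperm] .
  have W: "fin_perm (W_perm r j (Suc j))" if "j < n" for j using W_perm_diag[OF r that] by simp
  have w: "?w (Suc j) = v' j \<star> W_perm r j (Suc j) \<star> u' (Suc j)" if j: "j < n" for j
  proof -
    have "?w (Suc j) = foldl (\<star>) id ((if Suc j = 1 then [] else [v j]) @ [W_perm r j (Suc j)] @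
        (if Suc j = n then [] else [u (Suc j)]))"
      using W[OF j] uv[of j] uv[of "Suc j"] j permutes_fin_perm'
      by (subst hecke_prod_eq_foldl) (auto split: if_splits)
    then show ?thesis
      using W[OF j] fin(2)[of j] j by (auto simp: u'_def v'_def star_id_left)
  qed
  have x: "?x i = x i" if "i \<in> {1..n - 1}" for i
  proof -
    have "i \<in> {1..<n}" using that by auto
    then show ?thesis using uv[of i] permutes_fin_perm'
      by (subst hecke_prod_eq_foldl) (auto simp: x_def u'_def v'_def star_id_left)
  qed
  have wperm: "?w i permutes {1..r (i - 1) (i - 1) + r i i}" if i: "i \<in> {1..n}" for i
  proof -
    obtain j where j: "i = Suc j" "j < n" using i by (cases i) auto
    have "v' j permutes {1..r j j + r (Suc j) (Suc j)}" "u' (Suc j) permutes {1..r j j + r (Suc j) (Suc j)}"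
      by (rule permutes_mono[OF v'], simp, rule permutes_mono[OF u'], simp)
    then have "(v' j \<star> W_perm r j (Suc j) \<star> u' (Suc j)) permutes {1..r j j + r (Suc j) (Suc j)}"
      using star_permutes[of _ 0 "r j j + r (Suc j) (Suc j)"] W_perm_diag_permutes[OF r j(2)] by simp
    then show ?thesis unfolding j(1) w[OF j(2)] by simp
  qed
  have Qw: "kms_state n r ?w n = queue_state n (sizes r) (kept n r) (kept n r) x n"
  proof -
    have "kms_state n r ?w n \<star> v' n = queue_state n (sizes r) (kept n r) (kept n r) (\<lambda>i. u' i \<star> v' i) n"
    proof (rule kms_state_queue_state[OF r n])
      show "v' 0 = id" by (simp add: v'_def)
    qed (use u' fin w in auto)
    moreover have "(\<lambda>i. u' i \<star> v' i) = x" by (simp add: x_def fun_eq_iff)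
    moreover have "v' n = id" by (simp add: v'_def)
    ultimately show ?thesis by simp
  qed
  have Qx: "kms_state (n - 1) (drop_diag r) ?x (n - 1) = queue_state n (small_sizes n r) (kept n r) (\<lambda>_. 0) x n"
  proof -
    have "kms_state (n - 1) (drop_diag r) ?x (n - 1) = kms_state (n - 1) (drop_diag r) x (n - 1)"
      by (rule kms_state_cong) (rule x)
    then show ?thesis using kms_state_drop_diag[of n r x, OF r n finx xn] by simp
  qed
  have L: "KMS_factorization n r ?w \<longleftrightarrow> queue_state n (sizes r) (kept n r) (kept n r) x n = zelevinsky n r"
  proof -
    have "KMS_factorization n r ?w \<longleftrightarrow> kms_state n r ?w n = zelevinsky n r"
      by (rule KMS_factorization_iff_kms_state[OF r]) (rule wperm)
    then show ?thesis unfolding Qw .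
  qed
  have small: "drop_diag r (i - 1) (i - 1) + drop_diag r i i = small_sizes n r i" if "i \<in> {1..n - 1}" for i
    using that by (auto simp: drop_diag_def small_sizes_def kept_def)
  have R: "KMS_factorization (n - 1) (drop_diag r) ?x \<longleftrightarrow>
      (\<forall>i\<in>{1..n - 1}. x i permutes {1..small_sizes n r i}) \<and>
      queue_state n (small_sizes n r) (kept n r) (\<lambda>_. 0) x n = zelevinsky (n - 1) (drop_diag r)"
  proof -
    have "fin_perm (?x i)" if "i \<in> {1..n - 1}" for i using x[OF that] finx by simp
    then have "hecke_prod (concat (map (\<lambda>i. if i = 1 then [?x 1] else [delta_perm (n - 1) (drop_diag r) (i - 1), ?x i])
        [1..<n - 1 + 1])) = kms_state (n - 1) (drop_diag r) ?x (n - 1)"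
      by (rule hecke_prod_kms_state[OF rank_ineqs_drop_diag[OF r]])
    moreover have "(\<forall>i\<in>{1..n - 1}. ?x i permutes {1..drop_diag r (i - 1) (i - 1) + drop_diag r i i}) \<longleftrightarrow>
        (\<forall>i\<in>{1..n - 1}. x i permutes {1..small_sizes n r i})"
      by (rule ball_cong[OF HOL.refl]) (simp only: x small)
    ultimately show ?thesis unfolding KMS_factorization_def Qx by auto
  qed
  have sizes: "x i permutes {1..sizes r i}" for i using xperm by (simp add: sizes_def)
  have eq: "queue_state n (sizes r) (kept n r) (kept n r) x n = zelevinsky n r \<longleftrightarrow>
      queue_state n (small_sizes n r) (kept n r) (\<lambda>_. 0) x n = zelevinsky (n - 1) (drop_diag r)"
    if small: "\<forall>i\<in>{1..n - 1}. x i permutes {1..small_sizes n r i}"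
    unfolding queue_state_upper_factor[OF r n, symmetric] small_queue_state_upper_factor[OF r n, symmetric]
  proof (rule queue_states_eq_iff[OF r n])
    fix j assume j: "j \<in> {1..n}"
    have "x j permutes {1..small_sizes n r j}"
      using small j xn by (cases "j = n") (auto simp: permutes_id)
    then show "x j permutes {1..sizes r j} \<and> x j permutes {1..small_sizes n r j}" using sizes by blast
    show "upper_factor n r j permutes {1..sizes r j} \<and> upper_factor n r j permutes {1..small_sizes n r j}"
      using upper_factor_permutes[OF r n, of j] j by auto
  qed
  \<comment> \<open>Membership in the groups for r^(1) is part of what is claimed there, so it is
    supplied from the product for r.\<close>
  have small: "x i permutes {1..small_sizes n r i}"
    if "queue_state n (sizes r) (kept n r) (kept n r) x n = zelevinsky n r" "i \<in> {1..n - 1}" for i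
    using queue_factor_permutes_small[OF r n sizes that(1), of i] that(2) by auto
  show ?thesis unfolding L R using eq small by blast
qed

theorem theorem7p1:
  fixes n :: nat and r :: "nat \<Rightarrow> nat \<Rightarrow> nat"
  assumes "n \<ge> 1" and "rank_conditions TYPE('k::field) n r"
  shows
    "(\<forall>w. KMS_factorization n r w \<longrightarrow>
        (\<exists>u v. v 0 = id \<and> u n = id \<and>
           (\<forall>i\<in>{1..n}.
              v (i - 1) permutes {1..r (i - 1) (i - 1)} \<and>
              u i permutes {1..r i i} \<and>
              reduced_factorization (w i) [v (i - 1), W_perm r (i - 1) i, u i]))) \<and>
     (\<forall>u v. (\<forall>i\<in>{1..<n}. u i permutes {1..r i i} \<and> v i permutes {1..r i i}) \<longrightarrow>
        (KMS_factorization n r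
           (\<lambda>i. hecke_prod ((if i = 1 then [] else [v (i - 1)]) @ [W_perm r (i - 1) i] @
                            (if i = n then [] else [u i])))
         \<longleftrightarrow>
         KMS_factorization (n - 1) (drop_diag r) (\<lambda>i. hecke_prod [u i, v i])))"
proof -
  have r: "rank_ineqs n r" using assms(2) by (rule rank_conditions_rank_ineqs)
  note part_a = KMS_factorization_factors[OF r assms(1)] and part_b = KMS_factorization_drop_diag_iff[OF r assms(1)]
  show ?thesis
  proof (intro conjI allI impI)
    fix w assume "KMS_factorization n r w"
    then show "\<exists>u v. v 0 = id \<and> u n = id \<and> (\<forall>i\<in>{1..n}. v (i - 1) permutes {1..r (i - 1) (i - 1)} \<and>
        u i permutes {1..r i i} \<and> reduced_factorization (w i) [v (i - 1), W_perm r (i - 1) i, u i])"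
      by (rule part_a)
  qed (rule part_b, auto)
qed

end
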